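(* (1) Let $(D,\lhd)$ be a proximity Dedekind algebra and let $A=\{a\in D: a\lhd a\}$ be its $\ell$-subalgebra of reflexive elements. Then the restriction $\prec$ of $\lhd$ to the boolean algebra $\mathrm{Id}(D)$ of idempotents of $D$ is a de Vries proximity on $\mathrm{Id}(D)$, and the map $\sigma_D:\mathrm{Id}(D)\to\mathsf{Ann}(A)$, $\sigma_D(e)=eD\cap A$, is a de Vries isomorphism. (2) There is a covariant functor $\mathrm{Id}:\mathsf{PDA}\to\mathsf{DeV}$ which sends $(D,\lhd)$ to $(\mathrm{Id}(D),\prec)$ and a proximity morphism $\alpha:(D,\lhd)\to(D',\lhd')$ to its restriction $\alpha|_{\mathrm{Id}(D)}$.
   Context: All algebras are commutative and unital. An $\ell$-algebra is an $\mathbb R$-algebra $A$ that is also a lattice such that: $a\le b$ implies $a+c\le b+c$; $0\le a,b$ implies $0\le ab$; $0\le a$ and $0\le r\in\mathbb R$ imply $0\le ra$. It is bounded if for each $a\in A$ there is an integer $n\ge1$ with $a\le n\cdot 1$; it is archimedean if whenever $na\le b$ for all integers $n\ge1$, then $a\le0$. A $\mathbf{ba\ell}$-algebra is a bounded archimedean $\ell$-algebra. A Dedekind algebra is a $\mathbf{ba\ell}$-algebra in which each nonempty subset bounded above has a supremum. A binary relation $\lhd$ on a Dedekind algebra $D$ is a KT-proximity if: (P1) $0\lhd0$ and $1\lhd1$; (P2) $a\lhd b$ implies $a\le b$; (P3) $a\le b\lhd c\le d$ implies $a\lhd d$; (P4) $a\lhd b,c$ implies $a\lhd b\wedge c$;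 (P5) $a\lhd b$ implies $-b\lhd-a$; (P6) $a\lhd b$ and $c\lhd d$ imply $a+c\lhd b+d$; (P7) $a\lhd b$ and $0<r\in\mathbb R$ imply $ra\lhd rb$; (P8) $a,b,c,d\ge0$ with $a\lhd b$ and $c\lhd d$ imply $ac\lhd bd$; (KT) $a\lhd b$ implies there is $c\in D$ with $c\lhd c$ and $a\lhd c\lhd b$; (P10) $a>0$ implies there is $0<b\in D$ with $b\lhd a$. A proximity Dedekind algebra is a pair $(D,\lhd)$ with $D$ a Dedekind algebra and $\lhd$ a KT-proximity on $D$. The set of reflexive elements ($a\lhd a$) is an $\ell$-subalgebra of $D$. A proximity morphism $\alpha:(D,\lhd)\to(D',\lhd')$ is a map such that for all $a,b,c\in D$ with $c\lhd c$ and $0<r\in\mathbb R$: (PM1) $\alpha(0)=0$, $\alpha(1)=1$; (PM2) $\alpha(a\wedge b)=\alpha(a)\wedge\alpha(b)$; (PM3) $a\lhd b$ implies $-\alpha(-a)\lhd'\alpha(b)$; (PM4) $\alpha(b)=\bigvee\{\alpha(x): x\lhd b\}$; (PM5) $\alpha(ra)=r\alpha(a)$; (PM6) $\alpha(a\vee c)=\alpha(a)\vee\alpha(c)$; (PM7) $\alpha(a+c)=\alpha(a)+\alpha(c)$; (PM8) $c\ge0$ implies $\alpha(ca)=\alpha(c)\alpha(a)$. $\mathsf{PDA}$ is the category of proximity Dedekind algebras and proximity morphisms with composition $(\alpha_2\star\alpha_1)(a)=\bigvee\{\alpha_2\alpha_1(x): x\lhd_1 a\}$. A de Vries algebra is a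 complete boolean algebra $B$ with a binary relation $\prec$ (a de Vries proximity) such that: (DV1) $1\prec1$; (DV2) $a\prec b$ implies $a\le b$; (DV3) $a\le b\prec c\le d$ implies $a\prec d$; (DV4) $a\prec b,c$ implies $a\prec b\wedge c$; (DV5) $a\prec b$ implies $b^*\prec a^*$ ($^*$ is complement); (DV6) $a\prec b$ implies there is $c$ with $a\prec c\prec b$; (DV7) $a\ne0$ implies there is $b\ne0$ with $b\prec a$. A de Vries morphism $\sigma:B\to B'$ satisfies (M1) $\sigma(0)=0$; (M2) $\sigma(a\wedge b)=\sigma(a)\wedge\sigma(b)$; (M3) $a\prec b$ implies $\sigma(a^* )^*\prec\sigma(b)$; (M4) $\sigma(a)=\bigvee\{\sigma(b): b\prec a\}$. $\mathsf{DeV}$ is the category of de Vries algebras and de Vries morphisms, with composition $(\sigma_2\star\sigma_1)(a)=\bigvee\{\sigma_2\sigma_1(b): b\prec a\}$. For $S\subseteq A$, $\mathrm{Ann}_A(S)=\{a\in A: as=0\ \forall s\in S\}$; $\mathsf{Ann}(A)$ is the set of annihilator ideals of $A$ (ideals of the form $\mathrm{Ann}_A(S)$), ordered by inclusion. It is known that for a $\mathbf{ba\ell}$-algebra $A$, $\mathsf{Ann}(A)$ with the relation $I\prec J$ iff $\mathrm{Ann}_A(I)+J=A$ is a de Vries algebra. *)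

theory Defs
  imports Complex_Main "HOL-Algebra.Complete_Lattice" "HOL-Algebra.Module" "HOL-Algebra.Ideal"
begin

no_notation normal (infixl \<open>\<lhd>\<close> 60)

section \<open>Dedekind algebras\<close>

definition real_ring :: "real ring" where
  "real_ring = \<lparr>carrier = UNIV, monoid.mult = (*), one = 1, ring.zero = 0, add = (+)\<rparr>"

record 'a lalg = "(real, 'a) module" +
  lalg_le :: "'a \<Rightarrow> 'a \<Rightarrow> bool" (infix \<open>\<preceq>\<index>\<close> 50)

definition ord_of :: "('a, 'm) lalg_scheme \<Rightarrow> 'a gorder" where
  "ord_of D = \<lparr>carrier = carrier D, eq = (=), le = lalg_le D\<rparr>"

locale l_algebra = algebra real_ring D + ord: lattice "ord_of D"
  for D :: "('a, 'm) lalg_scheme" (structure) +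
  assumes add_mono:
      "\<lbrakk>a \<in> carrier D; b \<in> carrier D; c \<in> carrier D; a \<preceq> b\<rbrakk> \<Longrightarrow> a \<oplus> c \<preceq> b \<oplus> c"
    and mult_nonneg:
      "\<lbrakk>a \<in> carrier D; b \<in> carrier D; \<zero> \<preceq> a; \<zero> \<preceq> b\<rbrakk> \<Longrightarrow> \<zero> \<preceq> a \<otimes> b"
    and smult_nonneg:
      "\<lbrakk>a \<in> carrier D; \<zero> \<preceq> a; 0 \<le> r\<rbrakk> \<Longrightarrow> \<zero> \<preceq> r \<odot>\<^bsub>D\<^esub> a"

locale bal_algebra = l_algebra D for D :: "('a, 'm) lalg_scheme" (structure) +
  assumes bounded:
      "a \<in> carrier D \<Longrightarrow> \<exists>n::nat. n \<ge> 1 \<and> a \<preceq> [n] \<cdot> \<one>"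
    and archimedean:
      "\<lbrakk>a \<in> carrier D; b \<in> carrier D; \<And>n::nat. n \<ge> 1 \<Longrightarrow> [n] \<cdot> a \<preceq> b\<rbrakk> \<Longrightarrow> a \<preceq> \<zero>"

locale dedekind_algebra = bal_algebra D for D :: "('a, 'm) lalg_scheme" (structure) +
  assumes dedekind_complete:
      "\<lbrakk>S \<subseteq> carrier D; S \<noteq> {}; Upper (ord_of D) S \<noteq> {}\<rbrakk> \<Longrightarrow> \<exists>s. is_lub (ord_of D) s S"


section \<open>Proximity Dedekind algebras\<close>

record 'a pda = "'a lalg" +
  prox :: "'a \<Rightarrow> 'a \<Rightarrow> bool" (infix \<open>\<lhd>\<index>\<close> 50)

locale proximity_dedekind_algebra = dedekind_algebra D
  for D :: "('a, 'm) pda_scheme" (structure) +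
  assumes P1: "\<zero> \<lhd> \<zero>" "\<one> \<lhd> \<one>"
    and P2: "\<lbrakk>a \<in> carrier D; b \<in> carrier D; a \<lhd> b\<rbrakk> \<Longrightarrow> a \<preceq> b"
    and P3: "\<lbrakk>a \<in> carrier D; b \<in> carrier D; c \<in> carrier D; d \<in> carrier D;
        a \<preceq> b; b \<lhd> c; c \<preceq> d\<rbrakk> \<Longrightarrow> a \<lhd> d"
    and P4: "\<lbrakk>a \<in> carrier D; b \<in> carrier D; c \<in> carrier D; a \<lhd> b; a \<lhd> c\<rbrakk>
        \<Longrightarrow> a \<lhd> (b \<sqinter>\<^bsub>ord_of D\<^esub> c)"
    and P5: "\<lbrakk>a \<in> carrier D; b \<in> carrier D; a \<lhd> b\<rbrakk> \<Longrightarrow> \<ominus> b \<lhd> \<ominus> a"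
    and P6: "\<lbrakk>a \<in> carrier D; b \<in> carrier D; c \<in> carrier D; d \<in> carrier D; a \<lhd> b; c \<lhd> d\<rbrakk>
        \<Longrightarrow> a \<oplus> c \<lhd> b \<oplus> d"
    and P7: "\<lbrakk>a \<in> carrier D; b \<in> carrier D; a \<lhd> b; 0 < r\<rbrakk> \<Longrightarrow> r \<odot>\<^bsub>D\<^esub> a \<lhd> r \<odot>\<^bsub>D\<^esub> b"
    and P8: "\<lbrakk>a \<in> carrier D; b \<in> carrier D; c \<in> carrier D; d \<in> carrier D;
        \<zero> \<preceq> a; \<zero> \<preceq> b; \<zero> \<preceq> c; \<zero> \<preceq> d; a \<lhd> b; c \<lhd> d\<rbrakk> \<Longrightarrow> a \<otimes> c \<lhd> b \<otimes> d"
    and KT: "\<lbrakk>a \<in> carrier D; b \<in> carrier D; a \<lhd> b\<rbrakk>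
        \<Longrightarrow> \<exists>c \<in> carrier D. c \<lhd> c \<and> a \<lhd> c \<and> c \<lhd> b"
    and P10: "\<lbrakk>a \<in> carrier D; \<zero> \<preceq> a; a \<noteq> \<zero>\<rbrakk>
        \<Longrightarrow> \<exists>b \<in> carrier D. \<zero> \<preceq> b \<and> b \<noteq> \<zero> \<and> b \<lhd> a"

definition reflexives :: "('a, 'm) pda_scheme \<Rightarrow> ('a, 'm) pda_scheme" where
  "reflexives D = D\<lparr>carrier := {a \<in> carrier D. a \<lhd>\<^bsub>D\<^esub> a}\<rparr>"

text \<open>Maps between carriers are represented by extensional functions, so that equality of
  morphisms is equality of HOL functions and the restriction of a map is \<^const>\<open>restrict\<close>.\<close>

locale proximity_morphism =
  D: proximity_dedekind_algebra D + D': proximity_dedekind_algebra D'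
  for D :: "('a, 'm) pda_scheme" and D' :: "('b, 'n) pda_scheme" and \<alpha> :: "'a \<Rightarrow> 'b" +
  assumes map: "\<alpha> \<in> carrier D \<rightarrow>\<^sub>E carrier D'"
    and PM1: "\<alpha> \<zero>\<^bsub>D\<^esub> = \<zero>\<^bsub>D'\<^esub>" "\<alpha> \<one>\<^bsub>D\<^esub> = \<one>\<^bsub>D'\<^esub>"
    and PM2: "\<lbrakk>a \<in> carrier D; b \<in> carrier D\<rbrakk>
        \<Longrightarrow> \<alpha> (a \<sqinter>\<^bsub>ord_of D\<^esub> b) = \<alpha> a \<sqinter>\<^bsub>ord_of D'\<^esub> \<alpha> b"
    and PM3: "\<lbrakk>a \<in> carrier D; b \<in> carrier D; a \<lhd>\<^bsub>D\<^esub> b\<rbrakk>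
        \<Longrightarrow> \<ominus>\<^bsub>D'\<^esub> \<alpha> (\<ominus>\<^bsub>D\<^esub> a) \<lhd>\<^bsub>D'\<^esub> \<alpha> b"
    and PM4: "b \<in> carrier D \<Longrightarrow> is_lub (ord_of D') (\<alpha> b) {\<alpha> x | x. x \<in> carrier D \<and> x \<lhd>\<^bsub>D\<^esub> b}"
    and PM5: "\<lbrakk>a \<in> carrier D; 0 < r\<rbrakk> \<Longrightarrow> \<alpha> (r \<odot>\<^bsub>D\<^esub> a) = r \<odot>\<^bsub>D'\<^esub> \<alpha> a"
    and PM6: "\<lbrakk>a \<in> carrier D; c \<in> carrier D; c \<lhd>\<^bsub>D\<^esub> c\<rbrakk>
        \<Longrightarrow> \<alpha> (a \<squnion>\<^bsub>ord_of D\<^esub> c) = \<alpha> a \<squnion>\<^bsub>ord_of D'\<^esub> \<alpha> c"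
    and PM7: "\<lbrakk>a \<in> carrier D; c \<in> carrier D; c \<lhd>\<^bsub>D\<^esub> c\<rbrakk>
        \<Longrightarrow> \<alpha> (a \<oplus>\<^bsub>D\<^esub> c) = \<alpha> a \<oplus>\<^bsub>D'\<^esub> \<alpha> c"
    and PM8: "\<lbrakk>a \<in> carrier D; c \<in> carrier D; c \<lhd>\<^bsub>D\<^esub> c; \<zero>\<^bsub>D\<^esub> \<preceq>\<^bsub>D\<^esub> c\<rbrakk>
        \<Longrightarrow> \<alpha> (c \<otimes>\<^bsub>D\<^esub> a) = \<alpha> c \<otimes>\<^bsub>D'\<^esub> \<alpha> a"

definition pda_comp ::
  "('a, 'm) pda_scheme \<Rightarrow> ('c, 'n) pda_scheme \<Rightarrow> ('b \<Rightarrow> 'c) \<Rightarrow> ('a \<Rightarrow> 'b) \<Rightarrow> 'a \<Rightarrow> 'c" where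
  "pda_comp D D'' \<beta> \<alpha> =
     (\<lambda>a \<in> carrier D. \<Squnion>\<^bsub>ord_of D''\<^esub> {\<beta> (\<alpha> x) | x. x \<in> carrier D \<and> x \<lhd>\<^bsub>D\<^esub> a})"


section \<open>De Vries algebras\<close>

locale complete_boolean_algebra = complete_lattice B for B (structure) +
  assumes meet_join_distrib:
      "\<lbrakk>a \<in> carrier B; b \<in> carrier B; c \<in> carrier B\<rbrakk>
        \<Longrightarrow> a \<sqinter> (b \<squnion> c) = (a \<sqinter> b) \<squnion> (a \<sqinter> c)"
    and complemented:
      "a \<in> carrier B \<Longrightarrow> \<exists>c \<in> carrier B. a \<sqinter> c = \<bottom> \<and> a \<squnion> c = \<top>"

definition cmpl :: "('a, 'm) gorder_scheme \<Rightarrow> 'a \<Rightarrow> 'a" where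
  "cmpl B a = (THE c. c \<in> carrier B \<and> a \<sqinter>\<^bsub>B\<^esub> c = \<bottom>\<^bsub>B\<^esub> \<and> a \<squnion>\<^bsub>B\<^esub> c = \<top>\<^bsub>B\<^esub>)"

record 'a dev = "'a gorder" +
  prec :: "'a \<Rightarrow> 'a \<Rightarrow> bool" (infix \<open>\<prec>\<index>\<close> 50)

locale de_vries_algebra = complete_boolean_algebra B
  for B :: "('a, 'm) dev_scheme" (structure) +
  assumes DV1: "\<top> \<prec> \<top>"
    and DV2: "\<lbrakk>a \<in> carrier B; b \<in> carrier B; a \<prec> b\<rbrakk> \<Longrightarrow> a \<sqsubseteq> b"
    and DV3: "\<lbrakk>a \<in> carrier B; b \<in> carrier B; c \<in> carrier B; d \<in> carrier B;
        a \<sqsubseteq> b; b \<prec> c; c \<sqsubseteq> d\<rbrakk> \<Longrightarrow> a \<prec> d"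
    and DV4: "\<lbrakk>a \<in> carrier B; b \<in> carrier B; c \<in> carrier B; a \<prec> b; a \<prec> c\<rbrakk>
        \<Longrightarrow> a \<prec> (b \<sqinter> c)"
    and DV5: "\<lbrakk>a \<in> carrier B; b \<in> carrier B; a \<prec> b\<rbrakk> \<Longrightarrow> cmpl B b \<prec> cmpl B a"
    and DV6: "\<lbrakk>a \<in> carrier B; b \<in> carrier B; a \<prec> b\<rbrakk>
        \<Longrightarrow> \<exists>c \<in> carrier B. a \<prec> c \<and> c \<prec> b"
    and DV7: "\<lbrakk>a \<in> carrier B; a \<noteq> \<bottom>\<rbrakk> \<Longrightarrow> \<exists>b \<in> carrier B. b \<noteq> \<bottom> \<and> b \<prec> a"

locale de_vries_morphism = B: de_vries_algebra B + B': de_vries_algebra B'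
  for B :: "('a, 'm) dev_scheme" and B' :: "('b, 'n) dev_scheme" and \<sigma> :: "'a \<Rightarrow> 'b" +
  assumes map: "\<sigma> \<in> carrier B \<rightarrow>\<^sub>E carrier B'"
    and M1: "\<sigma> \<bottom>\<^bsub>B\<^esub> = \<bottom>\<^bsub>B'\<^esub>"
    and M2: "\<lbrakk>a \<in> carrier B; b \<in> carrier B\<rbrakk> \<Longrightarrow> \<sigma> (a \<sqinter>\<^bsub>B\<^esub> b) = \<sigma> a \<sqinter>\<^bsub>B'\<^esub> \<sigma> b"
    and M3: "\<lbrakk>a \<in> carrier B; b \<in> carrier B; a \<prec>\<^bsub>B\<^esub> b\<rbrakk>
        \<Longrightarrow> cmpl B' (\<sigma> (cmpl B a)) \<prec>\<^bsub>B'\<^esub> \<sigma> b"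
    and M4: "a \<in> carrier B \<Longrightarrow> is_lub B' (\<sigma> a) {\<sigma> b | b. b \<in> carrier B \<and> b \<prec>\<^bsub>B\<^esub> a}"

definition dev_comp ::
  "('a, 'm) dev_scheme \<Rightarrow> ('c, 'n) dev_scheme \<Rightarrow> ('b \<Rightarrow> 'c) \<Rightarrow> ('a \<Rightarrow> 'b) \<Rightarrow> 'a \<Rightarrow> 'c" where
  "dev_comp B B'' \<tau> \<sigma> =
     (\<lambda>a \<in> carrier B. \<Squnion>\<^bsub>B''\<^esub> {\<tau> (\<sigma> b) | b. b \<in> carrier B \<and> b \<prec>\<^bsub>B\<^esub> a})"

text \<open>An isomorphism is a morphism that is invertible with respect to \<^const>\<open>dev_comp\<close>. It is
  formulated for algebras over different element types, which cannot both be objects of one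
  category in the sense of the record below.\<close>

definition de_vries_isomorphism ::
  "('a, 'm) dev_scheme \<Rightarrow> ('b, 'n) dev_scheme \<Rightarrow> ('a \<Rightarrow> 'b) \<Rightarrow> bool" where
  "de_vries_isomorphism B B' \<sigma> \<longleftrightarrow>
     de_vries_morphism B B' \<sigma> \<and>
     (\<exists>\<tau>. de_vries_morphism B' B \<tau> \<and>
          dev_comp B B \<tau> \<sigma> = (\<lambda>a \<in> carrier B. a) \<and>
          dev_comp B' B' \<sigma> \<tau> = (\<lambda>b \<in> carrier B'. b))"


section \<open>The de Vries algebras of idempotents and of annihilator ideals\<close>

text \<open>The idempotents of a commutative ring form a boolean algebra in which the meet of
  \<open>e\<close> and \<open>f\<close> is their product, so \<open>e\<close> lies below \<open>f\<close> iff \<open>e \<otimes> f = e\<close>.\<close>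

definition Id_DeV :: "('a, 'm) pda_scheme \<Rightarrow> 'a dev" where
  "Id_DeV D =
     \<lparr>carrier = {e \<in> carrier D. e \<otimes>\<^bsub>D\<^esub> e = e}, eq = (=),
      le = (\<lambda>e f. e \<otimes>\<^bsub>D\<^esub> f = e), prec = prox D\<rparr>"

definition annihilator :: "('a, 'm) ring_scheme \<Rightarrow> 'a set \<Rightarrow> 'a set" where
  "annihilator A S = {a \<in> carrier A. \<forall>s \<in> S. a \<otimes>\<^bsub>A\<^esub> s = \<zero>\<^bsub>A\<^esub>}"

definition Ann_DeV :: "('a, 'm) ring_scheme \<Rightarrow> 'a set dev" where
  "Ann_DeV A =
     \<lparr>carrier = {annihilator A S | S. S \<subseteq> carrier A}, eq = (=), le = (\<subseteq>),
      prec = (\<lambda>I J. annihilator A I <+>\<^bsub>A\<^esub> J = carrier A)\<rparr>"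

definition sigma :: "('a, 'm) pda_scheme \<Rightarrow> 'a \<Rightarrow> 'a set" where
  "sigma D = (\<lambda>e \<in> carrier (Id_DeV D). (PIdl\<^bsub>D\<^esub> e) \<inter> carrier (reflexives D))"


section \<open>Categories and functors\<close>

text \<open>Morphisms do not carry their source and target; instead, composition and the action of a
  functor on morphisms take the objects involved as arguments. \<open>Comp C x y z g f\<close> is the composite
  of \<open>f\<close> from \<open>x\<close> to \<open>y\<close> with \<open>g\<close> from \<open>y\<close> to \<open>z\<close>.\<close>

record ('o, 'f) cat =
  Obj :: "'o set"
  Hom :: "'o \<Rightarrow> 'o \<Rightarrow> 'f set"
  Idt :: "'o \<Rightarrow> 'f"
  Comp :: "'o \<Rightarrow> 'o \<Rightarrow> 'o \<Rightarrow> 'f \<Rightarrow> 'f \<Rightarrow> 'f"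

locale category =
  fixes C :: "('o, 'f) cat"
  assumes Idt_in_Hom: "x \<in> Obj C \<Longrightarrow> Idt C x \<in> Hom C x x"
    and Comp_in_Hom: "\<lbrakk>x \<in> Obj C; y \<in> Obj C; z \<in> Obj C; f \<in> Hom C x y; g \<in> Hom C y z\<rbrakk>
        \<Longrightarrow> Comp C x y z g f \<in> Hom C x z"
    and Comp_Idt: "\<lbrakk>x \<in> Obj C; y \<in> Obj C; f \<in> Hom C x y\<rbrakk> \<Longrightarrow> Comp C x x y f (Idt C x) = f"
    and Idt_Comp: "\<lbrakk>x \<in> Obj C; y \<in> Obj C; f \<in> Hom C x y\<rbrakk> \<Longrightarrow> Comp C x y y (Idt C y) f = f"
    and Comp_assoc: "\<lbrakk>w \<in> Obj C; x \<in> Obj C; y \<in> Obj C; z \<in> Obj C;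
        f \<in> Hom C w x; g \<in> Hom C x y; h \<in> Hom C y z\<rbrakk>
        \<Longrightarrow> Comp C w y z h (Comp C w x y g f) = Comp C w x z (Comp C x y z h g) f"

locale covariant_functor = C: category C + C': category C'
  for C :: "('o, 'f) cat" and C' :: "('p, 'g) cat" +
  fixes F :: "'o \<Rightarrow> 'p" and Fm :: "'o \<Rightarrow> 'o \<Rightarrow> 'f \<Rightarrow> 'g"
  assumes F_Obj: "x \<in> Obj C \<Longrightarrow> F x \<in> Obj C'"
    and F_Hom: "\<lbrakk>x \<in> Obj C; y \<in> Obj C; f \<in> Hom C x y\<rbrakk> \<Longrightarrow> Fm x y f \<in> Hom C' (F x) (F y)"
    and F_Idt: "x \<in> Obj C \<Longrightarrow> Fm x x (Idt C x) = Idt C' (F x)"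
    and F_Comp: "\<lbrakk>x \<in> Obj C; y \<in> Obj C; z \<in> Obj C; f \<in> Hom C x y; g \<in> Hom C y z\<rbrakk>
        \<Longrightarrow> Fm x z (Comp C x y z g f) = Comp C' (F x) (F y) (F z) (Fm y z g) (Fm x y f)"

text \<open>The categories of all algebras whose elements are taken from the type \<open>'a\<close>.\<close>

definition PDA :: "('a pda, 'a \<Rightarrow> 'a) cat" where
  "PDA = \<lparr>Obj = {D. proximity_dedekind_algebra D},
          Hom = (\<lambda>D D'. {\<alpha>. proximity_morphism D D' \<alpha>}),
          Idt = (\<lambda>D. \<lambda>a \<in> carrier D. a),
          Comp = (\<lambda>D D' D''. pda_comp D D'')\<rparr>"

definition DeV :: "('a dev, 'a \<Rightarrow> 'a) cat" where
  "DeV = \<lparr>Obj = {B. de_vries_algebra B},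
          Hom = (\<lambda>B B'. {\<sigma>. de_vries_morphism B B' \<sigma>}),
          Idt = (\<lambda>B. \<lambda>a \<in> carrier B. a),
          Comp = (\<lambda>B B' B''. dev_comp B B'')\<rparr>"

end

theory Submission
  imports Defs
begin

text \<open>Bounded archimedean \<open>\<ell>\<close>-algebras are reduced with nonnegative squares, and in a Dedekind algebra
  the annihilator of every subset is generated by an idempotent: a set of elements of \<open>[0, 1]\<close> closed
  under \<open>x + y - xy\<close> has an idempotent supremum. Hence \<open>Id(D)\<close> is a complete boolean algebra.

  By (KT), \<open>a \<lhd> b\<close> holds iff a reflexive element lies between \<open>a\<close> and \<open>b\<close>; interpolating and
  approximating idempotents are supports of elements \<open>(c - \<epsilon>)\<^sup>+\<close> with \<open>c\<close> reflexive. Reflexive elements are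
  also order dense by (P10), so \<open>e \<mapsto> eD \<inter> A\<close> is an order isomorphism onto the annihilator ideals of \<open>A\<close>
  and carries \<open>\<lhd>\<close> to \<open>\<prec>\<close>.

  A proximity morphism is determined by its restriction to reflexive elements, which is a homomorphism
  of \<open>\<ell>\<close>-algebras, and every such homomorphism \<open>h\<close> extends to the proximity morphism
  \<open>a \<mapsto> \<Squnion>{h(c) : c \<le> a reflexive}\<close>. So composition of proximity morphisms is composition of
  homomorphisms. A proximity morphism preserves idempotents by the criterion for idempotent suprema.\<close>

text \<open>Elements of a Dedekind algebra behave like functions on a compact space, but no points
  are available. Pointwise arguments are replaced by algebra: positive and negative parts have
  product zero, squares are nonnegative, and bounds pass through suprema of sums, meets and
  nonnegative multiples. A proximity morphism is additive and multiplicative only against a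
  reflexive element, so \<open>e \<otimes> e = e\<close> says nothing directly about
  \<open>\<alpha> e\<close>. The polynomial x + y - xy gets around this: as 1 - (x + y - xy) = (1 -
  x)(1 - y), it maps [0, 1] to itself, it is preserved on reflexive elements, and repeating it
  pushes positive values towards 1. The truncation by \<epsilon> is forced too: the support of a
  reflexive c \<le> f lies below f but need not satisfy the proximity with f, while the support of
  (c - \<epsilon>)^+ does; the archimedean property then removes \<epsilon>. Composites in both
  categories may lie strictly below composites of maps. For proximity morphisms the two agree on
  reflexive elements, which decide everything; for de Vries morphisms there is no such subset to
  compute on, and interpolation takes its place.\<close>

no_notation normal_rel (infixl \<open>\<lhd>\<close> 60)

section \<open>Lattice-ordered algebras\<close>

text \<open>\<open>Upper\<close> tests only the elements of \<open>S\<close> that lie in the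
  carrier; the inclusion lets the quantifiers range over all of \<open>S\<close>.\<close>

lemma is_lub_iff:
  assumes "S \<subseteq> carrier L"
  shows "is_lub L s S \<longleftrightarrow> s \<in> carrier L \<and> (\<forall>x\<in>S. x \<sqsubseteq>\<^bsub>L\<^esub> s) \<and>
    (\<forall>u\<in>carrier L. (\<forall>x\<in>S. x \<sqsubseteq>\<^bsub>L\<^esub> u) \<longrightarrow> s \<sqsubseteq>\<^bsub>L\<^esub> u)"
  using assms unfolding least_def Upper_def by blast

lemma (in partial_order) is_lub_sup_eq:
  assumes "is_lub L s S"
  shows "\<Squnion>S = s"
  unfolding sup_def using assms by (metis (mono_tags, lifting) least_unique someI_ex)

context l_algebra
begin

abbreviation vee (infixl \<open>\<curlyvee>\<close> 65) where "a \<curlyvee> b \<equiv> a \<squnion>\<^bsub>ord_of D\<^esub> b"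
abbreviation wedge (infixl \<open>\<curlywedge>\<close> 70) where "a \<curlywedge> b \<equiv> a \<sqinter>\<^bsub>ord_of D\<^esub> b"

lemma ord_of_simps [simp]:
  "carrier (ord_of D) = carrier D" "le (ord_of D) = lalg_le D" "eq (ord_of D) = (=)"
  by (simp_all add: ord_of_def)

lemma smult_carrier [simp, intro]: "x \<in> carrier D \<Longrightarrow> r \<odot> x \<in> carrier D"
  using smult_closed by (simp add: real_ring_def)

lemma smult_add_left: "x \<in> carrier D \<Longrightarrow> (r + s) \<odot> x = r \<odot> x \<oplus> s \<odot> x"
  using smult_l_distr[of r s x] by (simp add: real_ring_def)

lemma smult_add_right:
  "\<lbrakk>x \<in> carrier D; y \<in> carrier D\<rbrakk> \<Longrightarrow> r \<odot> (x \<oplus> y) = r \<odot> x \<oplus> r \<odot> y"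
  using smult_r_distr[of r x y] by (simp add: real_ring_def)

lemma smult_smult: "x \<in> carrier D \<Longrightarrow> r \<odot> (s \<odot> x) = (r * s) \<odot> x"
  using smult_assoc1[of r s x] by (simp add: real_ring_def)

lemma smult_1 [simp]: "x \<in> carrier D \<Longrightarrow> 1 \<odot> x = x"
  using smult_one[of x] by (simp add: real_ring_def)

lemma smult_mult_left:
  "\<lbrakk>x \<in> carrier D; y \<in> carrier D\<rbrakk> \<Longrightarrow> (r \<odot> x) \<otimes> y = r \<odot> (x \<otimes> y)"
  using smult_assoc2[of r x y] by (simp add: real_ring_def)

lemma smult_mult_right:
  "\<lbrakk>x \<in> carrier D; y \<in> carrier D\<rbrakk> \<Longrightarrow> x \<otimes> (r \<odot> y) = r \<odot> (x \<otimes> y)"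
  using smult_mult_left[of y x r] by (simp add: m_comm)

lemma smult_0 [simp]: "x \<in> carrier D \<Longrightarrow> 0 \<odot> x = \<zero>"
  using smult_l_null[of x] by (simp add: real_ring_def)

lemma smult_zero [simp]: "r \<odot> \<zero> = \<zero>"
  using smult_r_null[of r] by (simp add: real_ring_def)

lemma smult_minus_right: "x \<in> carrier D \<Longrightarrow> r \<odot> (\<ominus> x) = \<ominus> (r \<odot> x)"
  using smult_r_minus[of r x] by (simp add: real_ring_def)

lemma smult_minus_left: "x \<in> carrier D \<Longrightarrow> (- r) \<odot> x = \<ominus> (r \<odot> x)"
  using smult_add_left[of x r "- r"] minus_equality[of "(- r) \<odot> x" "r \<odot> x"]
  by (simp add: a_comm)

lemma smult_diff_right:
  "\<lbrakk>x \<in> carrier D; y \<in> carrier D\<rbrakk> \<Longrightarrow> r \<odot> (x \<ominus> y) = r \<odot> x \<ominus> r \<odot> y"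
  by (simp add: minus_eq smult_add_right smult_minus_right)

lemma le_refl [simp, intro]: "a \<in> carrier D \<Longrightarrow> a \<preceq> a"
  using ord.le_refl[of a] by simp

lemma le_trans:
  "\<lbrakk>a \<preceq> b; b \<preceq> c; a \<in> carrier D; b \<in> carrier D; c \<in> carrier D\<rbrakk> \<Longrightarrow> a \<preceq> c"
  using ord.le_trans[of a b c] by simp

lemma le_antisym: "\<lbrakk>a \<preceq> b; b \<preceq> a; a \<in> carrier D; b \<in> carrier D\<rbrakk> \<Longrightarrow> a = b"
  using ord.le_antisym[of a b] by simp

lemma vee_closed [simp, intro]: "\<lbrakk>a \<in> carrier D; b \<in> carrier D\<rbrakk> \<Longrightarrow> a \<curlyvee> b \<in> carrier D"
  using ord.join_closed[of a b] by simp

lemma wedge_closed [simp, intro]: "\<lbrakk>a \<in> carrier D; b \<in> carrier D\<rbrakk> \<Longrightarrow> a \<curlywedge> b \<in> carrier D"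
  using ord.meet_closed[of a b] by simp

lemma vee_ge1: "\<lbrakk>a \<in> carrier D; b \<in> carrier D\<rbrakk> \<Longrightarrow> a \<preceq> a \<curlyvee> b"
  using ord.join_left[of a b] by simp

lemma vee_ge2: "\<lbrakk>a \<in> carrier D; b \<in> carrier D\<rbrakk> \<Longrightarrow> b \<preceq> a \<curlyvee> b"
  using ord.join_right[of a b] by simp

lemma vee_least:
  "\<lbrakk>a \<preceq> c; b \<preceq> c; a \<in> carrier D; b \<in> carrier D; c \<in> carrier D\<rbrakk> \<Longrightarrow> a \<curlyvee> b \<preceq> c"
  using ord.join_le[of a c b] by simp

lemma wedge_le1: "\<lbrakk>a \<in> carrier D; b \<in> carrier D\<rbrakk> \<Longrightarrow> a \<curlywedge> b \<preceq> a"
  using ord.meet_left[of a b] by simp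

lemma wedge_le2: "\<lbrakk>a \<in> carrier D; b \<in> carrier D\<rbrakk> \<Longrightarrow> a \<curlywedge> b \<preceq> b"
  using ord.meet_right[of a b] by simp

lemma wedge_greatest:
  "\<lbrakk>c \<preceq> a; c \<preceq> b; a \<in> carrier D; b \<in> carrier D; c \<in> carrier D\<rbrakk> \<Longrightarrow> c \<preceq> a \<curlywedge> b"
  using ord.meet_le[of c a b] by simp

lemma wedge_absorb: "\<lbrakk>a \<preceq> b; a \<in> carrier D; b \<in> carrier D\<rbrakk> \<Longrightarrow> a \<curlywedge> b = a"
  using ord.le_iff_join[of a b] by simp

lemma minus_zero_right [simp]: "a \<in> carrier D \<Longrightarrow> a \<ominus> \<zero> = a"
  by (simp add: minus_eq)

lemma minus_zero_left [simp]: "a \<in> carrier D \<Longrightarrow> \<zero> \<ominus> a = \<ominus> a"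
  by (simp add: minus_eq)

lemma minus_self [simp]: "a \<in> carrier D \<Longrightarrow> a \<ominus> a = \<zero>"
  by (simp add: minus_eq r_neg)

lemma minus_eq_iff:
  assumes [simp]: "a \<in> carrier D" "b \<in> carrier D" "c \<in> carrier D"
  shows "a \<ominus> b = c \<longleftrightarrow> a = c \<oplus> b"
proof
  assume "a \<ominus> b = c"
  then have "(a \<ominus> b) \<oplus> b = c \<oplus> b" by simp
  then show "a = c \<oplus> b" by (simp add: minus_eq a_assoc l_neg)
qed (simp add: minus_eq a_assoc r_neg)

lemma eq_minus_iff:
  "\<lbrakk>a \<in> carrier D; b \<in> carrier D; c \<in> carrier D\<rbrakk> \<Longrightarrow> c = a \<ominus> b \<longleftrightarrow> c \<oplus> b = a"
  using minus_eq_iff[of a b c] by auto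

lemma eq_diff0: "\<lbrakk>a \<in> carrier D; b \<in> carrier D\<rbrakk> \<Longrightarrow> a \<ominus> b = \<zero> \<longleftrightarrow> a = b"
  by (simp add: minus_eq_iff)

lemma minus_mult_left:
  "\<lbrakk>a \<in> carrier D; b \<in> carrier D; c \<in> carrier D\<rbrakk> \<Longrightarrow> (a \<ominus> b) \<otimes> c = a \<otimes> c \<ominus> b \<otimes> c"
  by (simp add: minus_eq l_distr l_minus)

lemma minus_mult_right:
  "\<lbrakk>a \<in> carrier D; b \<in> carrier D; c \<in> carrier D\<rbrakk> \<Longrightarrow> c \<otimes> (a \<ominus> b) = c \<otimes> a \<ominus> c \<otimes> b"
  by (simp add: minus_eq r_distr r_minus)

lemma additive_simps:
  assumes "a \<in> carrier D" "b \<in> carrier D" "c \<in> carrier D"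
  shows "a \<oplus> (b \<ominus> c) = (a \<oplus> b) \<ominus> c" "(a \<ominus> b) \<oplus> c = (a \<oplus> c) \<ominus> b"
    "a \<ominus> (b \<ominus> c) = (a \<oplus> c) \<ominus> b" "(a \<ominus> b) \<ominus> c = a \<ominus> (b \<oplus> c)"
  using assms by (simp_all add: minus_eq a_ac minus_add)

lemma uminus_simps:
  assumes "a \<in> carrier D" "b \<in> carrier D"
  shows "\<ominus> (a \<ominus> b) = b \<ominus> a" "a \<ominus> (\<ominus> b) = a \<oplus> b"
    "(\<ominus> a) \<oplus> b = b \<ominus> a" "b \<oplus> (\<ominus> a) = b \<ominus> a" "(\<ominus> a) \<ominus> b = \<ominus> (a \<oplus> b)"
  using assms by (simp_all add: minus_eq a_ac minus_add)

text \<open>As with \<open>algebra_simps\<close>, all differences are moved across the equation and sums of monomials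
  are compared modulo associativity and commutativity.\<close>

lemmas ring_simps =
  additive_simps uminus_simps minus_eq_iff eq_minus_iff minus_mult_left minus_mult_right l_distr r_distr
  l_minus r_minus a_ac m_ac

text \<open>The rules \<open>m_ac\<close> nest products to the right, which hides a known product of
  two factors inside a longer monomial. This form lets the simplifier still find it, typically for
  \<open>e \<otimes> e = e\<close>.\<close>

lemma mult_assoc_eq:
  "\<lbrakk>a \<otimes> b = c; a \<in> carrier D; b \<in> carrier D; x \<in> carrier D\<rbrakk> \<Longrightarrow> a \<otimes> (b \<otimes> x) = c \<otimes> x"
  using m_assoc[of a b x] by simp

lemma le_iff_diff:
  assumes [simp]: "a \<in> carrier D" "b \<in> carrier D"
  shows "a \<preceq> b \<longleftrightarrow> \<zero> \<preceq> b \<ominus> a"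
proof
  assume "a \<preceq> b"
  then have "a \<oplus> (\<ominus> a) \<preceq> b \<oplus> (\<ominus> a)" by (intro add_mono) simp_all
  then show "\<zero> \<preceq> b \<ominus> a" by (simp add: r_neg minus_eq)
next
  assume "\<zero> \<preceq> b \<ominus> a"
  then have "\<zero> \<oplus> a \<preceq> (b \<ominus> a) \<oplus> a" by (intro add_mono) simp_all
  moreover have "(b \<ominus> a) \<oplus> a = b" by (simp add: ring_simps)
  ultimately show "a \<preceq> b" by simp
qed

lemma le_diffI:
  "\<lbrakk>\<zero> \<preceq> c; b \<ominus> a = c; a \<in> carrier D; b \<in> carrier D\<rbrakk> \<Longrightarrow> a \<preceq> b"
  by (simp add: le_iff_diff[of a b])

lemma add_nonneg:
  assumes "\<zero> \<preceq> a" "\<zero> \<preceq> b" and [simp]: "a \<in> carrier D" "b \<in> carrier D"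
  shows "\<zero> \<preceq> a \<oplus> b"
  using add_mono[of \<zero> a b] assms le_trans[of \<zero> b "a \<oplus> b"] by simp

lemma add_le_mono:
  assumes "a \<preceq> b" "c \<preceq> d"
    and [simp]: "a \<in> carrier D" "b \<in> carrier D" "c \<in> carrier D" "d \<in> carrier D"
  shows "a \<oplus> c \<preceq> b \<oplus> d"
proof (rule le_diffI)
  show "\<zero> \<preceq> (b \<ominus> a) \<oplus> (d \<ominus> c)"
    using assms by (intro add_nonneg) (simp_all add: le_iff_diff[symmetric])
  show "(b \<oplus> d) \<ominus> (a \<oplus> c) = (b \<ominus> a) \<oplus> (d \<ominus> c)" by (simp add: ring_simps)
qed simp_all

lemma diff_le_iff:
  assumes [simp]: "a \<in> carrier D" "b \<in> carrier D" "c \<in> carrier D"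
  shows "a \<ominus> b \<preceq> c \<longleftrightarrow> a \<preceq> b \<oplus> c"
proof -
  have "c \<ominus> (a \<ominus> b) = (b \<oplus> c) \<ominus> a" by (simp add: ring_simps)
  then show ?thesis by (simp add: le_iff_diff[of _ c] le_iff_diff[of a])
qed

lemma minus_le_iff:
  assumes [simp]: "a \<in> carrier D" "b \<in> carrier D"
  shows "\<ominus> a \<preceq> \<ominus> b \<longleftrightarrow> b \<preceq> a"
proof -
  have "(\<ominus> b) \<ominus> (\<ominus> a) = a \<ominus> b" by (simp add: ring_simps)
  then show ?thesis by (simp add: le_iff_diff[of "\<ominus> a"] le_iff_diff[of b])
qed

lemma mult_left_mono:
  assumes "a \<preceq> b" "\<zero> \<preceq> c" and [simp]: "a \<in> carrier D" "b \<in> carrier D" "c \<in> carrier D"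
  shows "c \<otimes> a \<preceq> c \<otimes> b"
proof (rule le_diffI)
  show "\<zero> \<preceq> c \<otimes> (b \<ominus> a)"
    using assms by (intro mult_nonneg) (simp_all add: le_iff_diff[symmetric])
  show "c \<otimes> b \<ominus> c \<otimes> a = c \<otimes> (b \<ominus> a)" by (simp add: ring_simps)
qed simp_all

lemma mult_right_mono:
  "\<lbrakk>a \<preceq> b; \<zero> \<preceq> c; a \<in> carrier D; b \<in> carrier D; c \<in> carrier D\<rbrakk> \<Longrightarrow> a \<otimes> c \<preceq> b \<otimes> c"
  using mult_left_mono[of a b c] by (simp add: m_comm)

lemma smult_mono:
  assumes "a \<preceq> b" "0 \<le> r" and [simp]: "a \<in> carrier D" "b \<in> carrier D"
  shows "r \<odot> a \<preceq> r \<odot> b"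
  using assms smult_nonneg[of "b \<ominus> a" r] by (simp add: le_iff_diff[of a b] le_iff_diff[of "r \<odot> a"] smult_diff_right)

lemma smult_le_iff:
  assumes "0 < r" and [simp]: "a \<in> carrier D" "b \<in> carrier D"
  shows "r \<odot> a \<preceq> b \<longleftrightarrow> a \<preceq> (1 / r) \<odot> b"
proof
  assume "r \<odot> a \<preceq> b"
  from smult_mono[OF this, of "1 / r"] assms(1) show "a \<preceq> (1 / r) \<odot> b"
    by (simp add: smult_smult)
next
  assume "a \<preceq> (1 / r) \<odot> b"
  from smult_mono[OF this, of r] assms(1) show "r \<odot> a \<preceq> b"
    by (simp add: smult_smult)
qed

lemma smult_mono_left:
  assumes "\<zero> \<preceq> a" "r \<le> s" and [simp]: "a \<in> carrier D"
  shows "r \<odot> a \<preceq> s \<odot> a"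
proof (rule le_diffI)
  show "\<zero> \<preceq> (s - r) \<odot> a" using assms by (intro smult_nonneg) simp_all
  show "s \<odot> a \<ominus> r \<odot> a = (s - r) \<odot> a"
    using smult_add_left[of a s "- r"] by (simp add: smult_minus_left minus_eq)
qed simp_all

text \<open>From m \<le> y follows x \<le> x + y - m, so a + b minus the meet is an upper bound of
  both elements. Dually, a + b minus the join is a lower bound.\<close>

lemma vee_add_wedge:
  assumes [simp]: "a \<in> carrier D" "b \<in> carrier D"
  shows "(a \<curlyvee> b) \<oplus> (a \<curlywedge> b) = a \<oplus> b"
proof -
  let ?m = "a \<curlywedge> b" and ?j = "a \<curlyvee> b"
  have [simp]: "?m \<in> carrier D" "?j \<in> carrier D" by auto
  have diff: "x \<preceq> (x \<oplus> y) \<ominus> m" if "m \<preceq> y" "x \<in> carrier D" "y \<in> carrier D" "m \<in> carrier D"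
    for x y m
  proof (rule le_diffI)
    show "\<zero> \<preceq> y \<ominus> m" using that by (simp add: le_iff_diff[symmetric])
    show "((x \<oplus> y) \<ominus> m) \<ominus> x = y \<ominus> m" by (simp add: ring_simps that)
  qed (use that in simp_all)
  have swap: "m \<oplus> x \<preceq> y" if "x \<preceq> y \<ominus> m" "x \<in> carrier D" "y \<in> carrier D" "m \<in> carrier D"
    for x y m
  proof (rule le_diffI)
    show "\<zero> \<preceq> (y \<ominus> m) \<ominus> x" using that by (simp add: le_iff_diff[symmetric])
    show "y \<ominus> (m \<oplus> x) = (y \<ominus> m) \<ominus> x" by (simp add: ring_simps that)
  qed (use that in simp_all)
  have "?j \<preceq> (a \<oplus> b) \<ominus> ?m"
    using diff[of ?m b a] diff[of ?m a b] by (intro vee_least) (simp_all add: wedge_le1 wedge_le2 a_comm)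
  then have 1: "?m \<oplus> ?j \<preceq> a \<oplus> b" by (intro swap) simp_all
  have *: "(x \<oplus> y) \<ominus> j \<preceq> x" if "y \<preceq> j" "x \<in> carrier D" "y \<in> carrier D" "j \<in> carrier D" for x y j
  proof (rule le_diffI)
    show "\<zero> \<preceq> j \<ominus> y" using that by (simp add: le_iff_diff[symmetric])
    show "x \<ominus> ((x \<oplus> y) \<ominus> j) = j \<ominus> y" by (simp add: ring_simps that)
  qed (use that in simp_all)
  have "(a \<oplus> b) \<ominus> ?j \<preceq> ?m"
    using *[of b ?j a] *[of a ?j b] by (intro wedge_greatest) (simp_all add: vee_ge1 vee_ge2 a_comm)
  then have "a \<oplus> b \<preceq> ?j \<oplus> ?m" by (simp add: diff_le_iff)
  with 1 show ?thesis by (intro le_antisym) (simp_all add: a_comm)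
qed

lemma minus_vee:
  assumes [simp]: "a \<in> carrier D" "b \<in> carrier D"
  shows "\<ominus> (a \<curlyvee> b) = (\<ominus> a) \<curlywedge> (\<ominus> b)"
proof (rule le_antisym)
  show "\<ominus> (a \<curlyvee> b) \<preceq> (\<ominus> a) \<curlywedge> (\<ominus> b)"
    by (intro wedge_greatest) (simp_all add: minus_le_iff vee_ge1 vee_ge2)
  have "a \<curlyvee> b \<preceq> \<ominus> ((\<ominus> a) \<curlywedge> (\<ominus> b))"
    using wedge_le1[of "\<ominus> a" "\<ominus> b"] wedge_le2[of "\<ominus> a" "\<ominus> b"]
      minus_le_iff[of "\<ominus> a" "(\<ominus> a) \<curlywedge> (\<ominus> b)"] minus_le_iff[of "\<ominus> b" "(\<ominus> a) \<curlywedge> (\<ominus> b)"]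
    by (intro vee_least) (simp_all)
  then show "(\<ominus> a) \<curlywedge> (\<ominus> b) \<preceq> \<ominus> (a \<curlyvee> b)"
    using minus_le_iff[of "\<ominus> ((\<ominus> a) \<curlywedge> (\<ominus> b))" "a \<curlyvee> b"] by simp
qed simp_all

end

section \<open>Consequences of boundedness and the archimedean property: disjointness, squares,
  nilpotents\<close>

context bal_algebra
begin

lemma add_pow_eq_smult: "a \<in> carrier D \<Longrightarrow> [n] \<cdot> a = real n \<odot> a" for n :: nat
proof (induction n)
  case (Suc n)
  then show ?case by (simp add: add.nat_pow_Suc smult_add_left a_comm)
qed simp

lemma le_of_real:
  assumes "a \<in> carrier D"
  obtains r where "0 < r" "a \<preceq> r \<odot> \<one>"
proof -
  obtain n :: nat where "n \<ge> 1" "a \<preceq> [n] \<cdot> \<one>" using bounded[OF assms] by blast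
  then show thesis using that[of "real n"] by (simp add: add_pow_eq_smult)
qed

text \<open>With \<epsilon> = 1/n the hypothesis scales to the integer form of the axiom for a -
  c.\<close>

lemma archimedean_eps:
  assumes "\<And>\<epsilon>. 0 < \<epsilon> \<Longrightarrow> a \<preceq> c \<oplus> \<epsilon> \<odot> b"
    and [simp]: "a \<in> carrier D" "b \<in> carrier D" "c \<in> carrier D"
  shows "a \<preceq> c"
proof -
  have "a \<ominus> c \<preceq> \<zero>"
  proof (rule archimedean)
    fix n :: nat assume n: "n \<ge> 1"
    then have "a \<ominus> c \<preceq> (1 / real n) \<odot> b" using assms(1)[of "1 / real n"] by (simp add: diff_le_iff)
    then show "[n] \<cdot> (a \<ominus> c) \<preceq> b" using n by (simp add: add_pow_eq_smult smult_le_iff)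
  qed simp_all
  then show ?thesis by (simp add: diff_le_iff)
qed

text \<open>Boundedness enters here. If both factors lie below t times the unit, then pq/t lies
  below each of them, hence is one of the common lower bounds \<open>w\<close>.\<close>

lemma disjoint_mult:
  assumes "\<zero> \<preceq> p" "\<zero> \<preceq> q" and [simp]: "p \<in> carrier D" "q \<in> carrier D"
    and disj: "\<And>w. \<lbrakk>w \<in> carrier D; w \<preceq> p; w \<preceq> q\<rbrakk> \<Longrightarrow> w \<preceq> \<zero>"
  shows "p \<otimes> q = \<zero>"
proof -
  obtain r where r: "0 < r" "p \<preceq> r \<odot> \<one>" by (rule le_of_real[of p]) simp
  obtain s where s: "0 < s" "q \<preceq> s \<odot> \<one>" by (rule le_of_real[of q]) simp
  let ?t = "max r s"
  have one: "x \<preceq> (1 / t) \<odot> x" if "x \<in> carrier D" "\<zero> \<preceq> x" "0 < t" "t \<le> 1" for x t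
    using smult_mono_left[of x 1 "1 / t"] that by simp
  have *: "(1 / ?t) \<odot> (x \<otimes> y) \<preceq> y"
    if "x \<preceq> u \<odot> \<one>" "0 < u" "u \<le> ?t" "\<zero> \<preceq> y" and [simp]: "x \<in> carrier D" "y \<in> carrier D" for x y u
  proof -
    have "x \<otimes> y \<preceq> u \<odot> y" using mult_right_mono[OF that(1) that(4)] by (simp add: smult_mult_left)
    also have "u \<odot> y \<preceq> ?t \<odot> y" using that by (intro smult_mono_left) simp_all
    finally (le_trans) have "x \<otimes> y \<preceq> ?t \<odot> y" by simp
    then show ?thesis using smult_le_iff[of "1 / ?t" "x \<otimes> y" y] r(1) by simp
  qed
  have "(1 / ?t) \<odot> (p \<otimes> q) \<preceq> \<zero>"
    using *[OF r(2,1), of q] *[OF s(2,1), of p] assms(1,2) by (intro disj) (simp_all add: m_comm[of q p])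
  then have "p \<otimes> q \<preceq> \<zero>" using smult_le_iff[of "1 / ?t" "p \<otimes> q" \<zero>] r(1) by simp
  then show ?thesis using assms by (intro le_antisym) (simp_all add: mult_nonneg)
qed

text \<open>Disjointness comes from leastness of the join: if \<open>w\<close> lies below both parts
  p and q, then p - w is still an upper bound of x and 0, because (p - w) - x = q - w. So p \<le> p
  - w, that is, w \<le> 0.\<close>

lemma pos_neg_parts:
  assumes [simp]: "x \<in> carrier D"
  shows "(x \<curlyvee> \<zero>) \<ominus> ((\<ominus> x) \<curlyvee> \<zero>) = x" "(x \<curlyvee> \<zero>) \<otimes> ((\<ominus> x) \<curlyvee> \<zero>) = \<zero>"
proof -
  let ?p = "x \<curlyvee> \<zero>" and ?q = "(\<ominus> x) \<curlyvee> \<zero>"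
  have "?p \<oplus> (x \<curlywedge> \<zero>) = x" using vee_add_wedge[of x \<zero>] by simp
  moreover have "x \<curlywedge> \<zero> = \<ominus> ?q" using minus_vee[of "\<ominus> x" \<zero>] by simp
  ultimately show eq: "?p \<ominus> ?q = x" by (simp add: minus_eq)
  show "?p \<otimes> ?q = \<zero>"
  proof (rule disjoint_mult)
    fix w assume w [simp]: "w \<in> carrier D" and le: "w \<preceq> ?p" "w \<preceq> ?q"
    have "(?p \<ominus> w) \<ominus> x = ?q \<ominus> w"
    proof -
      have "(p \<ominus> w) \<ominus> (p \<ominus> q) = q \<ominus> w" if "p \<in> carrier D" "q \<in> carrier D" for p q
        by (simp add: ring_simps that)
      from this[of ?p ?q] show ?thesis by (simp add: eq)
    qed
    then have "x \<preceq> ?p \<ominus> w" "\<zero> \<preceq> ?p \<ominus> w" using le by (simp_all add: le_iff_diff[symmetric] le_iff_diff[of x "?p \<ominus> w"])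
    then have "?p \<preceq> ?p \<ominus> w" by (intro vee_least) simp_all
    moreover have "(p \<ominus> w) \<ominus> p = \<zero> \<ominus> w" if "p \<in> carrier D" for p by (simp add: ring_simps that)
    ultimately show "w \<preceq> \<zero>" by (simp add: le_iff_diff[of w \<zero>] le_iff_diff[of _ "?p \<ominus> w"])
  qed (simp_all add: vee_ge2)
qed

text \<open>The order axioms control only products of nonnegative elements; disjointness of the two
  parts removes the mixed term of the square.\<close>

lemma square_nonneg:
  assumes [simp]: "x \<in> carrier D"
  shows "\<zero> \<preceq> x \<otimes> x"
proof -
  let ?p = "x \<curlyvee> \<zero>" and ?q = "(\<ominus> x) \<curlyvee> \<zero>"
  have "(p \<ominus> q) \<otimes> (p \<ominus> q) = p \<otimes> p \<oplus> q \<otimes> q"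
    if "p \<otimes> q = \<zero>" "p \<in> carrier D" "q \<in> carrier D" for p q
    using that by (simp add: ring_simps)
  from this[of ?p ?q] have "x \<otimes> x = ?p \<otimes> ?p \<oplus> ?q \<otimes> ?q" by (simp add: pos_neg_parts)
  then show ?thesis by (simp add: add_nonneg mult_nonneg vee_ge2)
qed

lemma one_nonneg [simp]: "\<zero> \<preceq> \<one>"
  using square_nonneg[of \<one>] by simp

text \<open>If y squares to zero, then 0 \<le> (ny - 1)^2 = 1 - 2ny, so every multiple ny stays
  below 1/2 and y \<le> 0. This is applied to x and to -x.\<close>

lemma nilpotent_zero:
  assumes "x \<otimes> x = \<zero>" and [simp]: "x \<in> carrier D"
  shows "x = \<zero>"
proof -
  have *: "y \<preceq> \<zero>" if "y \<otimes> y = \<zero>" and [simp]: "y \<in> carrier D" for y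
  proof (rule archimedean)
    fix n :: nat
    let ?z = "real n \<odot> y"
    have "?z \<otimes> ?z = \<zero>" using that by (simp add: smult_mult_left smult_mult_right)
    moreover have "(z \<ominus> \<one>) \<otimes> (z \<ominus> \<one>) = \<one> \<ominus> (z \<oplus> z)" if "z \<otimes> z = \<zero>" "z \<in> carrier D" for z
      using that by (simp add: ring_simps)
    ultimately have "\<zero> \<preceq> \<one> \<ominus> (?z \<oplus> ?z)" using square_nonneg[of "?z \<ominus> \<one>"] by simp
    moreover have "?z \<oplus> ?z = [(2 * n)] \<cdot> y"
      using smult_add_left[of y n n] by (simp add: add_pow_eq_smult)
    ultimately have le: "[(2 * n)] \<cdot> y \<preceq> \<one>" by (simp add: le_iff_diff[of "[(2 * n)] \<cdot> y" \<one>])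
    then have "2 \<odot> (real n \<odot> y) \<preceq> \<one>" by (simp add: add_pow_eq_smult smult_smult)
    then show "[n] \<cdot> y \<preceq> (1 / 2) \<odot> \<one>" using smult_le_iff[of 2 "real n \<odot> y" \<one>] by (simp add: add_pow_eq_smult)
  qed simp_all
  have "(\<ominus> x) \<otimes> (\<ominus> x) = \<zero>" using assms by (simp add: l_minus r_minus)
  then have "\<ominus> x \<preceq> \<zero>" by (intro *) simp_all
  then have "\<zero> \<preceq> x" using minus_le_iff[of x \<zero>] by simp
  then show ?thesis using *[of x] assms by (intro le_antisym) simp_all
qed

end

section \<open>Suprema and idempotents\<close>

context l_algebra
begin

abbreviation lub where "lub s S \<equiv> is_lub (ord_of D) s S"

lemma lub_iff:
  "S \<subseteq> carrier D \<Longrightarrow> lub s S \<longleftrightarrow>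
    s \<in> carrier D \<and> (\<forall>x\<in>S. x \<preceq> s) \<and> (\<forall>u\<in>carrier D. (\<forall>x\<in>S. x \<preceq> u) \<longrightarrow> s \<preceq> u)"
  using is_lub_iff[of S "ord_of D" s] by simp

text \<open>Translations are order automorphisms, so each summand in turn can be moved across the
  inequality and replaced by its supremum.\<close>

lemma lub_add_le:
  assumes "lub u S" "lub v T" and S: "S \<subseteq> carrier D" and T: "T \<subseteq> carrier D"
    and [simp]: "w \<in> carrier D" and le: "\<And>x y. \<lbrakk>x \<in> S; y \<in> T\<rbrakk> \<Longrightarrow> x \<oplus> y \<preceq> w"
  shows "u \<oplus> v \<preceq> w"
proof -
  have [simp]: "u \<in> carrier D" "v \<in> carrier D" using assms by (simp_all add: lub_iff)
  have *: "x \<oplus> y \<preceq> w \<longleftrightarrow> x \<preceq> w \<ominus> y" if [simp]: "x \<in> carrier D" "y \<in> carrier D" for x y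
  proof -
    have "w \<ominus> (x \<oplus> y) = (w \<ominus> y) \<ominus> x" by (simp add: ring_simps)
    then show ?thesis by (simp add: le_iff_diff[of x] le_iff_diff[of _ w])
  qed
  have "u \<preceq> w \<ominus> y" if "y \<in> T" for y
  proof -
    have "y \<in> carrier D" using T that by blast
    moreover from this have "\<forall>x\<in>S. x \<preceq> w \<ominus> y" using S that le *[of _ y] by blast
    ultimately show ?thesis using assms(1) by (simp add: lub_iff[OF S])
  qed
  then have "y \<preceq> w \<ominus> u" if "y \<in> T" for y
    using T that *[of u y] *[of y u] by (auto simp: a_comm[of u])
  then have "v \<preceq> w \<ominus> u" using assms(2) by (simp add: lub_iff[OF T])
  then show ?thesis using *[of v u] by (simp add: a_comm)
qed

text \<open>With m the meet of u' and y, replacing u' by a smaller x lowers the meet by at most u' -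
  x: x - (u' - m) lies below both x and y. The defect u' - m does not depend on x, so a bound valid
  for all x passes to u'. The fact \<open>*\<close> is used once for each supremum.\<close>

lemma lub_wedge_le:
  assumes u: "lub u S" and v: "lub v T" and S: "S \<subseteq> carrier D" and T: "T \<subseteq> carrier D"
    and [simp]: "w \<in> carrier D" and le: "\<And>x y. \<lbrakk>x \<in> S; y \<in> T\<rbrakk> \<Longrightarrow> x \<curlywedge> y \<preceq> w"
  shows "u \<curlywedge> v \<preceq> w"
proof -
  have *: "u' \<curlywedge> y \<preceq> w"
    if u': "lub u' S'" and S': "S' \<subseteq> carrier D" and [simp]: "y \<in> carrier D"
      and le: "\<And>x. x \<in> S' \<Longrightarrow> x \<curlywedge> y \<preceq> w" for u' S' y
  proof -
    have [simp]: "u' \<in> carrier D" using u' S' by (simp add: lub_iff)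
    let ?m = "u' \<curlywedge> y"
    have "x \<preceq> w \<oplus> (u' \<ominus> ?m)" if x: "x \<in> S'" for x
    proof -
      have [simp]: "x \<in> carrier D" and xu: "x \<preceq> u'" using x S' u' by (auto simp: lub_iff[OF S'])
      have "x \<ominus> (u' \<ominus> ?m) \<preceq> x \<curlywedge> y"
      proof (rule wedge_greatest)
        have "a \<ominus> (a \<ominus> (b \<ominus> c)) = b \<ominus> c" if "a \<in> carrier D" "b \<in> carrier D" "c \<in> carrier D" for a b c
          by (simp add: ring_simps that)
        from this[of x u' ?m] show "x \<ominus> (u' \<ominus> ?m) \<preceq> x"
          using wedge_le1[of u' y] by (simp add: le_iff_diff[of ?m] le_iff_diff[of _ x])
        have "y \<ominus> (x \<ominus> (u' \<ominus> m)) = (y \<ominus> m) \<oplus> (u' \<ominus> x)" if "m \<in> carrier D" for m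
          by (simp add: ring_simps that)
        moreover have "\<zero> \<preceq> (y \<ominus> ?m) \<oplus> (u' \<ominus> x)"
          using wedge_le2[of u' y] xu by (intro add_nonneg) (simp_all add: le_iff_diff[symmetric])
        ultimately show "x \<ominus> (u' \<ominus> ?m) \<preceq> y" by (simp add: le_iff_diff[of _ y])
      qed simp_all
      then have "x \<ominus> (u' \<ominus> ?m) \<preceq> w" using le[OF x] by (rule le_trans) simp_all
      then show ?thesis by (simp add: diff_le_iff a_comm)
    qed
    then have "u' \<preceq> w \<oplus> (u' \<ominus> ?m)" using u' by (simp add: lub_iff[OF S'])
    moreover have "(w \<oplus> (u' \<ominus> m)) \<ominus> u' = w \<ominus> m" if "m \<in> carrier D" for m
      by (simp add: ring_simps that)
    ultimately show ?thesis by (simp add: le_iff_diff[of u'] le_iff_diff[of ?m])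
  qed
  have [simp]: "u \<in> carrier D" "v \<in> carrier D" using assms by (simp_all add: lub_iff)
  have "y \<curlywedge> u \<preceq> w" if "y \<in> T" for y
    using *[OF u S, of y] that T le by (auto simp: meet_comm[of "ord_of D" y])
  then show ?thesis
    using *[OF v T, of u] by (simp add: meet_comm[of "ord_of D" u])
qed

end

section \<open>Multiplication and suprema; the order on idempotents\<close>

context bal_algebra
begin

text \<open>Division by \<open>c\<close> is impossible, so \<open>c\<close> is complemented to a
  scalar: r = d + c with d \<ge> 0. Then rx = dx + cx \<le> du + w for all x in \<open>S\<close>,
  hence ru \<le> du + w, and cancelling du leaves the claim.\<close>

lemma lub_mult_le:
  assumes "lub u S" and S: "S \<subseteq> carrier D" and c: "\<zero> \<preceq> c" and [simp]: "c \<in> carrier D" "w \<in> carrier D"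
    and le: "\<And>x. x \<in> S \<Longrightarrow> c \<otimes> x \<preceq> w"
  shows "c \<otimes> u \<preceq> w"
proof -
  have [simp]: "u \<in> carrier D" using assms by (simp add: lub_iff)
  obtain r where r: "0 < r" "c \<preceq> r \<odot> \<one>" by (rule le_of_real[of c]) simp
  define d where "d = r \<odot> \<one> \<ominus> c"
  have d: "d \<in> carrier D" "\<zero> \<preceq> d" using r by (simp_all add: d_def le_iff_diff[symmetric])
  have eq: "r \<odot> x = d \<otimes> x \<oplus> c \<otimes> x" if [simp]: "x \<in> carrier D" for x
  proof -
    have "r \<odot> x = (r \<odot> \<one>) \<otimes> x" by (simp add: smult_mult_left)
    also have "t \<otimes> x = (t \<ominus> c) \<otimes> x \<oplus> c \<otimes> x" if "t \<in> carrier D" for t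
      by (simp add: ring_simps that)
    finally show ?thesis by (simp add: d_def)
  qed
  have "x \<preceq> (1 / r) \<odot> (d \<otimes> u \<oplus> w)" if x: "x \<in> S" for x
  proof -
    have [simp]: "x \<in> carrier D" and "x \<preceq> u" using x assms by (auto simp: lub_iff)
    then have "r \<odot> x \<preceq> d \<otimes> u \<oplus> w"
      using d le[OF x] by (simp add: eq) (intro add_le_mono mult_left_mono; simp)
    then show ?thesis using d r by (simp add: smult_le_iff)
  qed
  then have "u \<preceq> (1 / r) \<odot> (d \<otimes> u \<oplus> w)" using assms(1) d by (simp add: lub_iff[OF S])
  then have "d \<otimes> u \<oplus> c \<otimes> u \<preceq> d \<otimes> u \<oplus> w" using r d by (simp add: smult_le_iff[symmetric] eq)
  then have "(d \<otimes> u \<oplus> c \<otimes> u) \<ominus> d \<otimes> u \<preceq> w" using d by (simp add: diff_le_iff)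
  moreover have "(x \<oplus> y) \<ominus> x = y" if "x \<in> carrier D" "y \<in> carrier D" for x y
    by (simp add: ring_simps that)
  ultimately show ?thesis using d by simp
qed

text \<open>Multiplying 0 \<le> x \<le> f by 1 - f squeezes x(1 - f) to zero. Together with
  \<open>mult_idem_le\<close> this makes order and absorption by an idempotent interchangeable on
  [0, 1].\<close>

lemma le_idem_mult:
  assumes "\<zero> \<preceq> x" "x \<preceq> f" "f \<otimes> f = f" and [simp]: "x \<in> carrier D" "f \<in> carrier D"
  shows "x \<otimes> f = x"
proof -
  have "\<one> \<ominus> f = (\<one> \<ominus> f) \<otimes> (\<one> \<ominus> f)" using assms(3) by (simp add: ring_simps)
  then have f: "\<zero> \<preceq> \<one> \<ominus> f" using square_nonneg[of "\<one> \<ominus> f"] by simp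
  have "f \<otimes> (\<one> \<ominus> f) = \<zero>" using assms(3) by (simp add: ring_simps)
  then have "x \<otimes> (\<one> \<ominus> f) \<preceq> \<zero>" using mult_right_mono[OF assms(2) f] by simp
  then have "x \<otimes> (\<one> \<ominus> f) = \<zero>" using assms f by (intro le_antisym mult_nonneg) simp_all
  moreover have "x \<otimes> (\<one> \<ominus> f) = x \<ominus> x \<otimes> f" by (simp add: ring_simps)
  ultimately show ?thesis by (metis eq_diff0 assms(4,5) m_closed)
qed

lemma idem_nonneg: "\<lbrakk>e \<otimes> e = e; e \<in> carrier D\<rbrakk> \<Longrightarrow> \<zero> \<preceq> e"
  using square_nonneg[of e] by simp

lemma idem_compl:
  assumes "e \<otimes> e = e" "e \<in> carrier D"
  shows "(\<one> \<ominus> e) \<otimes> (\<one> \<ominus> e) = \<one> \<ominus> e"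
  using assms by (simp add: ring_simps)

lemma idem_le_one: "\<lbrakk>e \<otimes> e = e; e \<in> carrier D\<rbrakk> \<Longrightarrow> e \<preceq> \<one>"
  using idem_nonneg[OF idem_compl] by (simp add: le_iff_diff[of e])

lemma mult_idem_le:
  assumes "x \<otimes> f = x" "x \<preceq> \<one>" "f \<otimes> f = f" and [simp]: "x \<in> carrier D" "f \<in> carrier D"
  shows "x \<preceq> f"
  using mult_right_mono[of x \<one> f] assms idem_nonneg[of f] by simp

lemma idem_le_iff:
  assumes "e \<otimes> e = e" "f \<otimes> f = f" "e \<in> carrier D" "f \<in> carrier D"
  shows "e \<preceq> f \<longleftrightarrow> e \<otimes> f = e"
  using assms le_idem_mult[of e f] mult_idem_le[of e f] by (auto simp: idem_nonneg idem_le_one)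

lemma idem_mult:
  assumes "e \<otimes> e = e" "f \<otimes> f = f" and [simp]: "e \<in> carrier D" "f \<in> carrier D"
  shows "(e \<otimes> f) \<otimes> (e \<otimes> f) = e \<otimes> f"
  using assms(1,2) by (simp add: ring_simps mult_assoc_eq[OF assms(1)] mult_assoc_eq[OF assms(2)])

text \<open>The meet lies between 0 and each of e, f, so both absorb it. This is how (PM2), a
  statement about lattice meets of D, becomes multiplicativity on idempotents.\<close>

lemma idem_wedge:
  assumes "e \<otimes> e = e" "f \<otimes> f = f" and [simp]: "e \<in> carrier D" "f \<in> carrier D"
  shows "e \<curlywedge> f = e \<otimes> f"
proof (rule le_antisym)
  have nn: "\<zero> \<preceq> e" "\<zero> \<preceq> f" "e \<preceq> \<one>" "f \<preceq> \<one>" using assms by (simp_all add: idem_nonneg idem_le_one)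
  let ?w = "e \<curlywedge> f"
  have 1: "\<zero> \<preceq> ?w" using nn by (intro wedge_greatest) simp_all
  have e: "?w \<otimes> e = ?w" and f: "?w \<otimes> f = ?w"
    using 1 assms by (auto intro!: le_idem_mult simp: wedge_le1 wedge_le2)
  have "?w \<otimes> (e \<otimes> f) = ?w" using e f by (simp add: m_assoc[symmetric])
  moreover have "?w \<preceq> \<one>" using le_trans[OF wedge_le1 nn(3)] by simp
  ultimately show "?w \<preceq> e \<otimes> f" using idem_mult[OF assms] by - (rule mult_idem_le, simp_all)
  show "e \<otimes> f \<preceq> ?w"
    using mult_left_mono[OF nn(4,1)] mult_right_mono[OF nn(3,2)] by (intro wedge_greatest) simp_all
qed simp_all

text \<open>The hypothesis x + y - xy \<le> s reads (1 - x)y \<le> s - x. Taking the supremum over y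
  gives (1 - x)s \<le> s - x, that is x \<le> xs, so s absorbs each x. Then x = xs \<le> ss for all
  x, and s \<le> ss.\<close>

lemma idempotent_lub:
  assumes s: "lub s T" and T: "T \<subseteq> carrier D" and ne: "T \<noteq> {}"
    and bds: "\<And>x. x \<in> T \<Longrightarrow> \<zero> \<preceq> x \<and> x \<preceq> \<one>"
    and closed: "\<And>x y. \<lbrakk>x \<in> T; y \<in> T\<rbrakk> \<Longrightarrow> x \<oplus> y \<ominus> x \<otimes> y \<preceq> s"
  shows "s \<otimes> s = s" "x \<in> T \<Longrightarrow> x \<otimes> s = x"
proof -
  have [simp]: "s \<in> carrier D" and Tc: "\<And>x. x \<in> T \<Longrightarrow> x \<in> carrier D \<and> x \<preceq> s" and s1: "s \<preceq> \<one>"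
    using s T bds by (auto simp: lub_iff)
  obtain x0 where "x0 \<in> T" using ne by auto
  then have s0: "\<zero> \<preceq> s" using bds Tc le_trans[of \<zero> x0 s] by simp
  have xs: "x \<otimes> s = x" if x: "x \<in> T" for x
  proof (rule le_antisym)
    have [simp]: "x \<in> carrier D" using Tc[OF x] by simp
    have "(\<one> \<ominus> x) \<otimes> s \<preceq> s \<ominus> x"
    proof (rule lub_mult_le[OF s T])
      fix y assume y: "y \<in> T"
      then have [simp]: "y \<in> carrier D" using Tc by blast
      have "(s \<ominus> x) \<ominus> (\<one> \<ominus> x) \<otimes> y = s \<ominus> (x \<oplus> y \<ominus> x \<otimes> y)" by (simp add: ring_simps)
      then show "(\<one> \<ominus> x) \<otimes> y \<preceq> s \<ominus> x"
        using closed[OF x y] by (simp add: le_iff_diff[of _ s] le_iff_diff[of _ "s \<ominus> x"])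
    qed (use bds[OF x] in \<open>simp_all add: le_iff_diff[symmetric]\<close>)
    moreover have "(s \<ominus> x) \<ominus> (\<one> \<ominus> x) \<otimes> s = x \<otimes> s \<ominus> x" by (simp add: ring_simps)
    ultimately show "x \<preceq> x \<otimes> s" by (simp add: le_iff_diff[of x] le_iff_diff[of _ "s \<ominus> x"])
    show "x \<otimes> s \<preceq> x" using mult_left_mono[OF s1, of x] bds[OF x] by simp
  qed (use Tc[OF x] in simp_all)
  then show "x \<in> T \<Longrightarrow> x \<otimes> s = x" .
  have "x \<preceq> s \<otimes> s" if "x \<in> T" for x
    using mult_right_mono[of x s s] Tc[OF that] s0 xs[OF that] by simp
  then have "s \<preceq> s \<otimes> s" using s by (simp add: lub_iff[OF T])
  moreover have "s \<otimes> s \<preceq> s" using mult_left_mono[OF s1 s0] by simp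
  ultimately show "s \<otimes> s = s" by (intro le_antisym) simp_all
qed

end

section \<open>Annihilators in a Dedekind algebra\<close>

context dedekind_algebra
begin

lemma lub_exists:
  assumes "S \<subseteq> carrier D" "S \<noteq> {}" "u \<in> carrier D" "\<And>x. x \<in> S \<Longrightarrow> x \<preceq> u"
  obtains s where "lub s S"
  using dedekind_complete[of S] assms Upper_memI[of S "ord_of D" u] by auto

text \<open>The idempotent is the supremum of the elements of [0, 1] that annihilate
  \<open>S\<close>; this set is closed under x + y - xy, so \<open>idempotent_lub\<close>
  applies.\<close>

lemma annihilating_idempotent:
  assumes S: "S \<subseteq> carrier D"
  obtains e where "e \<in> carrier D" "e \<otimes> e = e"
    "\<And>a. a \<in> carrier D \<Longrightarrow> a \<otimes> e = a \<longleftrightarrow> (\<forall>s\<in>S. a \<otimes> s = \<zero>)"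
proof -
  define T where "T = {x \<in> carrier D. \<zero> \<preceq> x \<and> x \<preceq> \<one> \<and> (\<forall>s\<in>S. x \<otimes> s = \<zero>)}"
  have T: "T \<subseteq> carrier D" by (auto simp: T_def)
  have "\<zero> \<in> T" using S by (auto simp: T_def)
  then have ne: "T \<noteq> {}" by blast
  obtain e where e: "lub e T" using T ne by (rule lub_exists[where u = \<one>]) (auto simp: T_def)
  then have [simp]: "e \<in> carrier D" and ub: "\<And>x. x \<in> T \<Longrightarrow> x \<preceq> e" using T by (auto simp: lub_iff)
  have closed: "x \<oplus> y \<ominus> x \<otimes> y \<in> T" if "x \<in> T" "y \<in> T" for x y
  proof -
    have [simp]: "x \<in> carrier D" "y \<in> carrier D" and x: "\<zero> \<preceq> x" "\<zero> \<preceq> \<one> \<ominus> x"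
      and y: "\<zero> \<preceq> y" "\<zero> \<preceq> \<one> \<ominus> y"
      using that by (auto simp: T_def le_iff_diff[symmetric])
    have "x \<oplus> y \<ominus> x \<otimes> y = x \<oplus> y \<otimes> (\<one> \<ominus> x)" by (simp add: ring_simps)
    then have "\<zero> \<preceq> x \<oplus> y \<ominus> x \<otimes> y" using x y by (simp add: add_nonneg mult_nonneg)
    moreover have "\<one> \<ominus> (x \<oplus> y \<ominus> x \<otimes> y) = (\<one> \<ominus> x) \<otimes> (\<one> \<ominus> y)" by (simp add: ring_simps)
    then have "x \<oplus> y \<ominus> x \<otimes> y \<preceq> \<one>" using x y by (simp add: le_iff_diff[of _ \<one>] mult_nonneg)
    moreover have "(x \<oplus> y \<ominus> x \<otimes> y) \<otimes> s = \<zero>" if s: "s \<in> S" for s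
    proof -
      have [simp]: "s \<in> carrier D" using S s by blast
      have "x \<otimes> s = \<zero>" "y \<otimes> s = \<zero>" using \<open>x \<in> T\<close> \<open>y \<in> T\<close> s by (auto simp: T_def)
      then show ?thesis by (simp add: l_distr minus_mult_left m_assoc)
    qed
    ultimately show ?thesis by (simp add: T_def)
  qed
  have bds: "\<zero> \<preceq> x \<and> x \<preceq> \<one>" if "x \<in> T" for x using that by (simp add: T_def)
  have idem: "e \<otimes> e = e" "x \<in> T \<Longrightarrow> x \<otimes> e = x" for x
    using idempotent_lub[OF e T ne] bds ub[OF closed] by blast+
  show thesis
  proof (rule that)
    show ee: "e \<otimes> e = e" by (rule idem(1))
    have es: "e \<otimes> s = \<zero>" if s: "s \<in> S" for s
    proof (rule nilpotent_zero)
      have [simp]: "s \<in> carrier D" using S s by blast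
      \<comment> \<open>\<open>lub_mult_le\<close> needs a nonnegative factor and s may have any
        sign, so annihilation is shown for the square of s and then recovered from (es)^2 =
        0.\<close>
      have "(s \<otimes> s) \<otimes> e \<preceq> \<zero>"
      proof (rule lub_mult_le[OF e T])
        fix x assume x: "x \<in> T"
        then have [simp]: "x \<in> carrier D" and "x \<otimes> s = \<zero>" using s by (auto simp: T_def)
        then have "(s \<otimes> s) \<otimes> x = \<zero>" by (simp add: m_assoc m_comm[of s x])
        then show "(s \<otimes> s) \<otimes> x \<preceq> \<zero>" by simp
      qed (simp_all add: square_nonneg)
      then have "(s \<otimes> s) \<otimes> e = \<zero>"
        using mult_nonneg[of "s \<otimes> s" e] ee
        by (intro le_antisym) (simp_all add: square_nonneg idem_nonneg)
      then show "(e \<otimes> s) \<otimes> (e \<otimes> s) = \<zero>"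
        by (simp add: m_assoc[symmetric] m_comm[of e s]) (simp add: m_assoc m_comm[of s e])
      show "e \<otimes> s \<in> carrier D" by simp
    qed
    have ae: "a \<otimes> e = a" if [simp]: "a \<in> carrier D" and a: "\<And>s. s \<in> S \<Longrightarrow> a \<otimes> s = \<zero>" for a
    proof -
      obtain r where r: "0 < r" "a \<otimes> a \<preceq> r \<odot> \<one>" by (rule le_of_real[of "a \<otimes> a"]) simp
      \<comment> \<open>Squaring removes the sign of a and 1/r scales the result into [0, 1]. Once e
        absorbs the square of a, it absorbs a, because (a - ae)^2 = a^2 - a^2 e = 0.\<close>
      have "(1 / r) \<odot> (a \<otimes> a) \<in> T"
      proof -
        have "(a \<otimes> a) \<otimes> s = \<zero>" if "s \<in> S" for s
          using that S a[OF that] by (simp add: subset_eq m_assoc)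
        then show ?thesis using r smult_mono[OF r(2), of "1 / r"] S
          by (auto simp: T_def subset_eq square_nonneg smult_nonneg smult_smult smult_mult_left)
      qed
      then have "((1 / r) \<odot> (a \<otimes> a)) \<otimes> e = (1 / r) \<odot> (a \<otimes> a)" by (rule idem(2))
      then have "r \<odot> ((1 / r) \<odot> ((a \<otimes> a) \<otimes> e)) = r \<odot> ((1 / r) \<odot> (a \<otimes> a))" by (simp add: smult_mult_left)
      then have aae: "(a \<otimes> a) \<otimes> e = a \<otimes> a" using r(1) by (simp add: smult_smult)
      have "(a \<ominus> a \<otimes> e) \<otimes> (a \<ominus> a \<otimes> e) = (a \<otimes> a) \<ominus> (a \<otimes> a) \<otimes> e"
        using ee by (simp add: ring_simps mult_assoc_eq[OF ee])
      also have "\<dots> = \<zero>" by (simp add: aae minus_eq r_neg)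
      finally have "a \<ominus> a \<otimes> e = \<zero>" by (rule nilpotent_zero) simp
      then show "a \<otimes> e = a" by (metis eq_diff0 \<open>a \<in> carrier D\<close> \<open>e \<in> carrier D\<close> m_closed)
    qed
    have "a \<otimes> s = \<zero>" if "a \<in> carrier D" "a \<otimes> e = a" "s \<in> S" for a s
      using m_assoc[of a e s] es that S by (auto simp: subset_eq)
    then show "a \<otimes> e = a \<longleftrightarrow> (\<forall>s\<in>S. a \<otimes> s = \<zero>)" if "a \<in> carrier D" for a
      using ae[OF that] that by blast
  qed simp
qed

end

section \<open>De Vries algebras and their category\<close>

context complete_boolean_algebra
begin

lemma lub_iff:
  "S \<subseteq> carrier B \<Longrightarrow> is_lub B s S \<longleftrightarrow>
    s \<in> carrier B \<and> (\<forall>x\<in>S. x \<sqsubseteq> s) \<and> (\<forall>u\<in>carrier B. (\<forall>x\<in>S. x \<sqsubseteq> u) \<longrightarrow> s \<sqsubseteq> u)"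
  by (rule is_lub_iff)

lemma top_meet_eq [simp]: "a \<in> carrier B \<Longrightarrow> \<top> \<sqinter> a = a"
  using top_meet[of a] by (simp add: eq_is_equal)

lemma meet_top_eq [simp]: "a \<in> carrier B \<Longrightarrow> a \<sqinter> \<top> = a"
  using top_meet_eq[of a] by (simp add: meet_comm)

lemma bottom_meet_eq [simp]: "a \<in> carrier B \<Longrightarrow> \<bottom> \<sqinter> a = \<bottom>"
  using bottom_meet[of a] by (simp add: eq_is_equal)

lemma bottom_join_eq [simp]: "a \<in> carrier B \<Longrightarrow> \<bottom> \<squnion> a = a"
  using bottom_join[of a] by (simp add: eq_is_equal)

text \<open>\<open>cmpl\<close> is a definite description, usable only once complements are unique:
  by distributivity any element disjoint from a lies below any element that joins with a to the
  top.\<close>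

lemma cmpl_eqI:
  assumes "a \<in> carrier B" "c \<in> carrier B" "a \<sqinter> c = \<bottom>" "a \<squnion> c = \<top>"
  shows "cmpl B a = c"
proof -
  have "d = d \<sqinter> e"
    if "d \<in> carrier B" "e \<in> carrier B" "a \<sqinter> d = \<bottom>" "a \<squnion> e = \<top>" for d e
  proof -
    have "d = d \<sqinter> (a \<squnion> e)" using that by simp
    also have "\<dots> = (d \<sqinter> a) \<squnion> (d \<sqinter> e)" using that assms(1) by (intro meet_join_distrib)
    also have "\<dots> = d \<sqinter> e" using that by (simp add: meet_comm[of B d a])
    finally show ?thesis .
  qed
  then have "d = c" if "d \<in> carrier B" "a \<sqinter> d = \<bottom>" "a \<squnion> d = \<top>" for d
    using that assms by (metis meet_comm)
  then show ?thesis unfolding cmpl_def using assms by (intro the_equality) blast+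
qed

lemma
  assumes "a \<in> carrier B"
  shows cmpl_closed [simp]: "cmpl B a \<in> carrier B"
    and meet_cmpl: "a \<sqinter> cmpl B a = \<bottom>"
    and join_cmpl: "a \<squnion> cmpl B a = \<top>"
  using complemented[OF assms] cmpl_eqI[OF assms] by auto

lemma cmpl_cmpl [simp]: "a \<in> carrier B \<Longrightarrow> cmpl B (cmpl B a) = a"
  by (rule cmpl_eqI) (simp_all add: meet_cmpl join_cmpl meet_comm[of B _ a] join_comm[of B _ a])

lemma meet_mono_right:
  "\<lbrakk>a \<in> carrier B; b \<in> carrier B; c \<in> carrier B; b \<sqsubseteq> c\<rbrakk> \<Longrightarrow> a \<sqinter> b \<sqsubseteq> a \<sqinter> c"
  using meet_le[of "a \<sqinter> b" a c] le_trans[of "a \<sqinter> b" b c] by (simp add: meet_left meet_right)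

lemma le_cmpl_iff:
  assumes [simp]: "a \<in> carrier B" "b \<in> carrier B"
  shows "a \<sqsubseteq> cmpl B b \<longleftrightarrow> a \<sqinter> b = \<bottom>"
proof
  assume "a \<sqsubseteq> cmpl B b"
  then have "b \<sqinter> a \<sqsubseteq> \<bottom>" using meet_mono_right[of b a "cmpl B b"] by (simp add: meet_cmpl)
  then show "a \<sqinter> b = \<bottom>" by (intro le_antisym) (simp_all add: meet_comm[of B a])
next
  assume "a \<sqinter> b = \<bottom>"
  then have "a = a \<sqinter> cmpl B b"
    using meet_join_distrib[of a b "cmpl B b"] by (simp add: join_cmpl)
  then show "a \<sqsubseteq> cmpl B b" using meet_right[of a "cmpl B b"] by simp
qed

lemma cmpl_antimono:
  assumes "a \<sqsubseteq> b" and [simp]: "a \<in> carrier B" "b \<in> carrier B"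
  shows "cmpl B b \<sqsubseteq> cmpl B a"
  using assms(1) le_cmpl_iff[of "cmpl B b" a] le_cmpl_iff[of a "cmpl B b"]
  by (simp add: meet_comm)

text \<open>Infinite distributivity in adjoint form: the meet of x and y lies below w exactly when y
  lies below the join of w with the complement of x, and the latter bound passes to suprema.\<close>

lemma meet_lub_le:
  assumes "is_lub B s S" and S: "S \<subseteq> carrier B" and [simp]: "x \<in> carrier B" "w \<in> carrier B"
    and le: "\<And>y. y \<in> S \<Longrightarrow> x \<sqinter> y \<sqsubseteq> w"
  shows "x \<sqinter> s \<sqsubseteq> w"
proof -
  have [simp]: "s \<in> carrier B" using assms by (simp add: lub_iff)
  have "y \<sqsubseteq> cmpl B x \<squnion> w" if "y \<in> S" for y
  proof -
    have [simp]: "y \<in> carrier B" using S that by blast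
    have "y = (y \<sqinter> x) \<squnion> (y \<sqinter> cmpl B x)"
      using meet_join_distrib[of y x "cmpl B x"] by (simp add: join_cmpl)
    moreover have "y \<sqinter> x \<sqsubseteq> cmpl B x \<squnion> w"
      using le[OF that] le_trans[of "x \<sqinter> y" w "cmpl B x \<squnion> w"] join_right[of "cmpl B x" w]
      by (simp add: meet_comm[of B y])
    moreover have "y \<sqinter> cmpl B x \<sqsubseteq> cmpl B x \<squnion> w"
      using le_trans[OF meet_right[of y "cmpl B x"] join_left[of "cmpl B x" w]] by simp
    ultimately show ?thesis using join_le[of "y \<sqinter> x" "cmpl B x \<squnion> w" "y \<sqinter> cmpl B x"] by simp
  qed
  then have "s \<sqsubseteq> cmpl B x \<squnion> w" using assms(1) by (simp add: lub_iff[OF S])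
  then have "x \<sqinter> s \<sqsubseteq> x \<sqinter> (cmpl B x \<squnion> w)" by (simp add: meet_mono_right)
  moreover have "x \<sqinter> (cmpl B x \<squnion> w) = x \<sqinter> w" by (simp add: meet_join_distrib meet_cmpl)
  ultimately show ?thesis using meet_right[of x w] le_trans[of "x \<sqinter> s" "x \<sqinter> w" w] by simp
qed

end

context de_vries_algebra
begin

lemma prec_meet_mono:
  assumes "a \<prec> b" "c \<prec> d"
    and [simp]: "a \<in> carrier B" "b \<in> carrier B" "c \<in> carrier B" "d \<in> carrier B"
  shows "a \<sqinter> c \<prec> b \<sqinter> d"
proof (rule DV4)
  show "a \<sqinter> c \<prec> b" using assms(1) DV3[of "a \<sqinter> c" a b b] by (simp add: meet_left)
  show "a \<sqinter> c \<prec> d" using assms(2) DV3[of "a \<sqinter> c" c d d] by (simp add: meet_right)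
qed simp_all

text \<open>If an upper bound u failed to dominate a, then a would meet the complement of u, and
  (DV7) would put a nonzero b with \<open>b \<prec> a\<close> below both u and its complement. This
  is (M4) for the identity.\<close>

lemma is_lub_prec:
  assumes a [simp]: "a \<in> carrier B"
  shows "is_lub B a {b. b \<in> carrier B \<and> b \<prec> a}"
proof -
  have "a \<sqsubseteq> u" if [simp]: "u \<in> carrier B" and ub: "\<And>b. \<lbrakk>b \<in> carrier B; b \<prec> a\<rbrakk> \<Longrightarrow> b \<sqsubseteq> u" for u
  proof (rule ccontr)
    assume "\<not> a \<sqsubseteq> u"
    then have "a \<sqinter> cmpl B u \<noteq> \<bottom>" using le_cmpl_iff[of a "cmpl B u"] by simp
    then obtain b where [simp]: "b \<in> carrier B" and b: "b \<noteq> \<bottom>" "b \<prec> a \<sqinter> cmpl B u"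
      using DV7[of "a \<sqinter> cmpl B u"] by auto
    have "b \<prec> a" using DV3[OF _ _ _ _ le_refl b(2) meet_left] by simp
    then have "b \<sqsubseteq> u" by (intro ub) simp_all
    moreover have "b \<sqsubseteq> cmpl B u" using DV2[OF _ _ b(2)] le_trans[of b "a \<sqinter> cmpl B u" "cmpl B u"] by (simp add: meet_right)
    ultimately have "b \<sqsubseteq> u \<sqinter> cmpl B u" by (intro meet_le) simp_all
    then have "b = \<bottom>" by (intro le_antisym) (simp_all add: meet_cmpl)
    with b show False by simp
  qed
  then show ?thesis using DV2[OF _ a] by (subst lub_iff) auto
qed

lemma id_morphism: "de_vries_morphism B B (\<lambda>a \<in> carrier B. a)"
proof unfold_locales
  fix a assume "a \<in> carrier B"
  moreover have "{(\<lambda>a\<in>carrier B. a) b |b. b \<in> carrier B \<and> b \<prec> a} = {b. b \<in> carrier B \<and> b \<prec> a}" by auto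
  ultimately show "is_lub B ((\<lambda>a\<in>carrier B. a) a) {(\<lambda>a\<in>carrier B. a) b |b. b \<in> carrier B \<and> b \<prec> a}"
    using is_lub_prec by simp
qed auto

end

context de_vries_morphism
begin

lemma closed [simp]: "a \<in> carrier B \<Longrightarrow> \<sigma> a \<in> carrier B'"
  using map by auto

lemma mono: "\<lbrakk>a \<sqsubseteq>\<^bsub>B\<^esub> b; a \<in> carrier B; b \<in> carrier B\<rbrakk> \<Longrightarrow> \<sigma> a \<sqsubseteq>\<^bsub>B'\<^esub> \<sigma> b"
  using M2[of a b] B.le_iff_join[of a b] B'.le_iff_join[of "\<sigma> a" "\<sigma> b"] by simp

text \<open>Complements need not be preserved, but the images of an element and its complement stay
  disjoint. This one inequality turns (M3) into preservation of the proximity in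
  \<open>prec_mono\<close>.\<close>

lemma le_cmpl: "a \<in> carrier B \<Longrightarrow> \<sigma> a \<sqsubseteq>\<^bsub>B'\<^esub> cmpl B' (\<sigma> (cmpl B a))"
  using M2[of a "cmpl B a"] by (simp add: B'.le_cmpl_iff B.meet_cmpl M1)

lemma prec_mono:
  assumes "a \<prec>\<^bsub>B\<^esub> b" and [simp]: "a \<in> carrier B" "b \<in> carrier B"
  shows "\<sigma> a \<prec>\<^bsub>B'\<^esub> \<sigma> b"
  using B'.DV3[of "\<sigma> a" "cmpl B' (\<sigma> (cmpl B a))" "\<sigma> b" "\<sigma> b"] M3[of a b] assms(1)
  by (simp add: le_cmpl)

end

section \<open>Composition of de Vries morphisms\<close>

lemma is_lub_dev_comp:
  assumes "de_vries_algebra B" "de_vries_algebra B''" and a: "a \<in> carrier B"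
    and "\<And>b. b \<in> carrier B \<Longrightarrow> \<tau> (\<sigma> b) \<in> carrier B''"
  shows "is_lub B'' (dev_comp B B'' \<tau> \<sigma> a) {\<tau> (\<sigma> b) | b. b \<in> carrier B \<and> b \<prec>\<^bsub>B\<^esub> a}"
proof -
  interpret B'': de_vries_algebra B'' by fact
  show ?thesis unfolding dev_comp_def using a assms(4) by (auto intro!: B''.sup_lub)
qed

lemma dev_comp_eqI:
  assumes "de_vries_algebra B''" and "s \<in> carrier B \<rightarrow>\<^sub>E X"
    and "\<And>a. a \<in> carrier B \<Longrightarrow> is_lub B'' (s a) {\<tau> (\<sigma> b) | b. b \<in> carrier B \<and> b \<prec>\<^bsub>B\<^esub> a}"
  shows "dev_comp B B'' \<tau> \<sigma> = s"
proof -
  interpret B'': de_vries_algebra B'' by fact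
  show ?thesis
    unfolding dev_comp_def using assms(2,3) B''.is_lub_sup_eq by (intro extensionalityI[of _ "carrier B"]) (auto simp: PiE_def)
qed

locale de_vries_morphism_pair =
  S: de_vries_morphism B B' \<sigma> + T: de_vries_morphism B' B'' \<tau>
  for B :: "('a, 'm) dev_scheme" and B' :: "('b, 'n) dev_scheme" and B'' :: "('c, 'k) dev_scheme"
    and \<sigma> \<tau>
begin

abbreviation comp where "comp \<equiv> dev_comp B B'' \<tau> \<sigma>"

lemma comp_closed [simp]: "a \<in> carrier B \<Longrightarrow> comp a \<in> carrier B''"
  using is_lub_dev_comp[OF S.B.de_vries_algebra_axioms T.B'.de_vries_algebra_axioms, of a \<tau> \<sigma>]
  by auto

lemma comp_le_iff:
  assumes "a \<in> carrier B" "u \<in> carrier B''"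
  shows "comp a \<sqsubseteq>\<^bsub>B''\<^esub> u \<longleftrightarrow> (\<forall>b\<in>carrier B. b \<prec>\<^bsub>B\<^esub> a \<longrightarrow> \<tau> (\<sigma> b) \<sqsubseteq>\<^bsub>B''\<^esub> u)"
proof -
  let ?S = "{\<tau> (\<sigma> b) | b. b \<in> carrier B \<and> b \<prec>\<^bsub>B\<^esub> a}"
  have S: "?S \<subseteq> carrier B''" by auto
  have "is_lub B'' (comp a) ?S"
    using assms by (intro is_lub_dev_comp S.B.de_vries_algebra_axioms T.B'.de_vries_algebra_axioms) simp_all
  note lub = conjunct2[OF iffD1[OF T.B'.lub_iff[OF S] this]]
  show ?thesis
  proof (intro iffI ballI impI)
    fix b assume le: "comp a \<sqsubseteq>\<^bsub>B''\<^esub> u" and b: "b \<in> carrier B" "b \<prec>\<^bsub>B\<^esub> a"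
    have "\<tau> (\<sigma> b) \<sqsubseteq>\<^bsub>B''\<^esub> comp a" using lub[THEN conjunct1] b by blast
    then show "\<tau> (\<sigma> b) \<sqsubseteq>\<^bsub>B''\<^esub> u" using le by (rule T.B'.le_trans) (use assms b in simp_all)
  next
    assume "\<forall>b\<in>carrier B. b \<prec>\<^bsub>B\<^esub> a \<longrightarrow> \<tau> (\<sigma> b) \<sqsubseteq>\<^bsub>B''\<^esub> u"
    then have "\<forall>x\<in>?S. x \<sqsubseteq>\<^bsub>B''\<^esub> u" by blast
    then show "comp a \<sqsubseteq>\<^bsub>B''\<^esub> u" using lub[THEN conjunct2] assms(2) by blast
  qed
qed

lemma le_comp:
  "\<lbrakk>b \<prec>\<^bsub>B\<^esub> a; a \<in> carrier B; b \<in> carrier B\<rbrakk> \<Longrightarrow> \<tau> (\<sigma> b) \<sqsubseteq>\<^bsub>B''\<^esub> comp a"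
  using comp_le_iff[of a "comp a"] by simp

text \<open>With \<open>le_comp\<close> this traps the composite: \<open>b \<prec> a\<close> gives
  \<open>\<tau> (\<sigma> b)\<close> \<le> \<open>comp a\<close> \<le>
  \<open>\<tau> (\<sigma> a)\<close>. Interpolating between b and a then yields the laws of
  composition.\<close>

lemma comp_le: "a \<in> carrier B \<Longrightarrow> comp a \<sqsubseteq>\<^bsub>B''\<^esub> \<tau> (\<sigma> a)"
  by (auto simp: comp_le_iff intro!: T.mono S.mono S.B.DV2)

lemma comp_mono:
  assumes "a \<sqsubseteq>\<^bsub>B\<^esub> b" and [simp]: "a \<in> carrier B" "b \<in> carrier B"
  shows "comp a \<sqsubseteq>\<^bsub>B''\<^esub> comp b"
  using assms(1) S.B.DV3[of _ _ a b] by (auto simp: comp_le_iff intro!: le_comp)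

lemma comp_lub:
  assumes a: "a \<in> carrier B"
  shows "is_lub B'' (comp a) {comp b | b. b \<in> carrier B \<and> b \<prec>\<^bsub>B\<^esub> a}"
proof (subst T.B'.lub_iff)
  have "\<forall>u\<in>carrier B''. (\<forall>x\<in>{comp b |b. b \<in> carrier B \<and> b \<prec>\<^bsub>B\<^esub> a}. x \<sqsubseteq>\<^bsub>B''\<^esub> u) \<longrightarrow> comp a \<sqsubseteq>\<^bsub>B''\<^esub> u"
  proof (intro ballI impI)
    fix u assume [simp]: "u \<in> carrier B''"
      and "\<forall>x\<in>{comp b |b. b \<in> carrier B \<and> b \<prec>\<^bsub>B\<^esub> a}. x \<sqsubseteq>\<^bsub>B''\<^esub> u"
    then have ub: "comp b \<sqsubseteq>\<^bsub>B''\<^esub> u" if "b \<in> carrier B" "b \<prec>\<^bsub>B\<^esub> a" for b using that by blast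
    show "comp a \<sqsubseteq>\<^bsub>B''\<^esub> u"
    proof (subst comp_le_iff, safe?)
      fix b assume [simp]: "b \<in> carrier B" and "b \<prec>\<^bsub>B\<^esub> a"
      then obtain c where [simp]: "c \<in> carrier B" and c: "b \<prec>\<^bsub>B\<^esub> c" "c \<prec>\<^bsub>B\<^esub> a"
        using S.B.DV6 a by blast
      show "\<tau> (\<sigma> b) \<sqsubseteq>\<^bsub>B''\<^esub> u" using T.B'.le_trans[OF le_comp[OF c(1)] ub[OF _ c(2)]] by simp
    qed (use a in simp_all)
  qed
  then show "comp a \<in> carrier B'' \<and> (\<forall>x\<in>{comp b |b. b \<in> carrier B \<and> b \<prec>\<^bsub>B\<^esub> a}. x \<sqsubseteq>\<^bsub>B''\<^esub> comp a) \<and>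
    (\<forall>u\<in>carrier B''. (\<forall>x\<in>{comp b |b. b \<in> carrier B \<and> b \<prec>\<^bsub>B\<^esub> a}. x \<sqsubseteq>\<^bsub>B''\<^esub> u) \<longrightarrow> comp a \<sqsubseteq>\<^bsub>B''\<^esub> u)"
    using a by (auto intro!: comp_mono S.B.DV2)
qed auto

text \<open>The nontrivial inequality applies \<open>meet_lub_le\<close> to each supremum in turn;
  elements c, d well inside a, b have their meet well inside the meet of a and b.\<close>

lemma comp_meet:
  assumes [simp]: "a \<in> carrier B" "b \<in> carrier B"
  shows "comp (a \<sqinter>\<^bsub>B\<^esub> b) = comp a \<sqinter>\<^bsub>B''\<^esub> comp b"
proof (rule T.B'.le_antisym)
  show "comp (a \<sqinter>\<^bsub>B\<^esub> b) \<sqsubseteq>\<^bsub>B''\<^esub> comp a \<sqinter>\<^bsub>B''\<^esub> comp b"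
    by (intro T.B'.meet_le comp_mono) (simp_all add: S.B.meet_left S.B.meet_right)
  let ?S = "\<lambda>a. {\<tau> (\<sigma> b) | b. b \<in> carrier B \<and> b \<prec>\<^bsub>B\<^esub> a}"
  have lub: "is_lub B'' (comp x) (?S x)" if "x \<in> carrier B" for x
    using that by (intro is_lub_dev_comp S.B.de_vries_algebra_axioms T.B'.de_vries_algebra_axioms) simp_all
  have "comp b \<sqinter>\<^bsub>B''\<^esub> comp a \<sqsubseteq>\<^bsub>B''\<^esub> comp (a \<sqinter>\<^bsub>B\<^esub> b)"
  proof (rule T.B'.meet_lub_le[OF lub])
    fix y assume "y \<in> ?S a"
    then obtain c where [simp]: "c \<in> carrier B" and c: "c \<prec>\<^bsub>B\<^esub> a" "y = \<tau> (\<sigma> c)" by auto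
    have "y \<sqinter>\<^bsub>B''\<^esub> comp b \<sqsubseteq>\<^bsub>B''\<^esub> comp (a \<sqinter>\<^bsub>B\<^esub> b)"
    proof (rule T.B'.meet_lub_le[OF lub])
      fix z assume "z \<in> ?S b"
      then obtain d where [simp]: "d \<in> carrier B" and d: "d \<prec>\<^bsub>B\<^esub> b" "z = \<tau> (\<sigma> d)" by auto
      have "\<tau> (\<sigma> (c \<sqinter>\<^bsub>B\<^esub> d)) \<sqsubseteq>\<^bsub>B''\<^esub> comp (a \<sqinter>\<^bsub>B\<^esub> b)"
        using c d by (intro le_comp S.B.prec_meet_mono) simp_all
      then show "y \<sqinter>\<^bsub>B''\<^esub> z \<sqsubseteq>\<^bsub>B''\<^esub> comp (a \<sqinter>\<^bsub>B\<^esub> b)" by (simp add: c d S.M2 T.M2)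
    qed (auto simp: c)
    then show "comp b \<sqinter>\<^bsub>B''\<^esub> y \<sqsubseteq>\<^bsub>B''\<^esub> comp (a \<sqinter>\<^bsub>B\<^esub> b)" by (simp add: meet_comm)
  qed auto
  then show "comp a \<sqinter>\<^bsub>B''\<^esub> comp b \<sqsubseteq>\<^bsub>B''\<^esub> comp (a \<sqinter>\<^bsub>B\<^esub> b)" by (simp add: meet_comm)
qed simp_all

text \<open>Interpolate twice, \<open>a \<prec> c \<prec> d \<prec> b\<close>: the outer steps pass
  from the composite to \<open>\<tau>\<close> after \<open>\<sigma>\<close> on either side, and the
  middle one feeds (M3).\<close>

lemma comp_prec:
  assumes "a \<prec>\<^bsub>B\<^esub> b" and [simp]: "a \<in> carrier B" "b \<in> carrier B"
  shows "cmpl B'' (comp (cmpl B a)) \<prec>\<^bsub>B''\<^esub> comp b"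
proof -
  obtain c where [simp]: "c \<in> carrier B" and c: "a \<prec>\<^bsub>B\<^esub> c" "c \<prec>\<^bsub>B\<^esub> b" using S.B.DV6 assms by blast
  obtain d where [simp]: "d \<in> carrier B" and d: "c \<prec>\<^bsub>B\<^esub> d" "d \<prec>\<^bsub>B\<^esub> b"
    using S.B.DV6[OF _ assms(3) c(2)] by auto
  have "\<tau> (\<sigma> (cmpl B c)) \<sqsubseteq>\<^bsub>B''\<^esub> comp (cmpl B a)" using c by (intro le_comp S.B.DV5) simp_all
  then have 1: "cmpl B'' (comp (cmpl B a)) \<sqsubseteq>\<^bsub>B''\<^esub> cmpl B'' (\<tau> (\<sigma> (cmpl B c)))"
    by (intro T.B'.cmpl_antimono) simp_all
  \<comment> \<open>The double complement is what (M3) for \<open>\<tau>\<close> produces from the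
    left side of (M3) for \<open>\<sigma>\<close>; it cancels in the next step.\<close>
  have "cmpl B'' (\<tau> (cmpl B' (cmpl B' (\<sigma> (cmpl B c))))) \<prec>\<^bsub>B''\<^esub> \<tau> (\<sigma> d)"
    using d by (intro T.M3 S.M3) simp_all
  then show ?thesis using T.B'.DV3[OF _ _ _ _ 1 _ le_comp[OF d(2)]] by simp
qed

lemma comp_morphism: "de_vries_morphism B B'' comp"
proof unfold_locales
  have "comp \<bottom>\<^bsub>B\<^esub> \<sqsubseteq>\<^bsub>B''\<^esub> \<bottom>\<^bsub>B''\<^esub>" using comp_le[of "\<bottom>\<^bsub>B\<^esub>"] by (simp add: S.M1 T.M1)
  then show "comp \<bottom>\<^bsub>B\<^esub> = \<bottom>\<^bsub>B''\<^esub>" by (intro T.B'.le_antisym) simp_all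
  show "comp \<in> carrier B \<rightarrow>\<^sub>E carrier B''" by (rule PiE_I, simp, simp add: dev_comp_def)
qed (simp_all add: comp_meet comp_prec comp_lub)

end

text \<open>For \<open>b \<prec> c \<prec> a\<close>, \<open>h (g (f b))\<close> lies above the
  terms at b of either bracketing and below the terms at c of the other, so each supremum bounds the
  other.\<close>

lemma dev_comp_assoc:
  assumes "de_vries_morphism B0 B1 f" "de_vries_morphism B1 B2 g" "de_vries_morphism B2 B3 h"
  shows "dev_comp B0 B3 h (dev_comp B0 B2 g f) = dev_comp B0 B3 (dev_comp B1 B3 h g) f"
proof -
  interpret f: de_vries_morphism B0 B1 f by fact
  interpret g: de_vries_morphism B1 B2 g by fact
  interpret h: de_vries_morphism B2 B3 h by fact
  interpret fg: de_vries_morphism_pair B0 B1 B2 f g ..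
  interpret gh: de_vries_morphism_pair B1 B2 B3 g h ..
  interpret gf: de_vries_morphism B0 B2 fg.comp by (rule fg.comp_morphism)
  interpret hg: de_vries_morphism B1 B3 gh.comp by (rule gh.comp_morphism)
  interpret l: de_vries_morphism_pair B0 B2 B3 fg.comp h ..
  interpret r: de_vries_morphism_pair B0 B1 B3 f gh.comp ..
  have "l.comp a = r.comp a" if [simp]: "a \<in> carrier B0" for a
  proof (rule h.B'.le_antisym)
    show "l.comp a \<sqsubseteq>\<^bsub>B3\<^esub> r.comp a"
    proof (unfold l.comp_le_iff[OF that r.comp_closed[OF that]], intro ballI impI)
      fix b assume [simp]: "b \<in> carrier B0" and "b \<prec>\<^bsub>B0\<^esub> a"
      then obtain c where [simp]: "c \<in> carrier B0" and c: "b \<prec>\<^bsub>B0\<^esub> c" "c \<prec>\<^bsub>B0\<^esub> a"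
        using f.B.DV6 \<open>a \<in> carrier B0\<close> by blast
      have "h (fg.comp b) \<sqsubseteq>\<^bsub>B3\<^esub> h (g (f b))" by (intro h.mono fg.comp_le) simp_all
      also have "h (g (f b)) \<sqsubseteq>\<^bsub>B3\<^esub> gh.comp (f c)" using c by (intro gh.le_comp f.prec_mono) simp_all
      also (h.B'.le_trans) have "gh.comp (f c) \<sqsubseteq>\<^bsub>B3\<^esub> r.comp a" using c by (intro r.le_comp) simp_all
      finally (h.B'.le_trans) show "h (fg.comp b) \<sqsubseteq>\<^bsub>B3\<^esub> r.comp a" by simp
    qed
    show "r.comp a \<sqsubseteq>\<^bsub>B3\<^esub> l.comp a"
    proof (unfold r.comp_le_iff[OF that l.comp_closed[OF that]], intro ballI impI)
      fix b assume [simp]: "b \<in> carrier B0" and "b \<prec>\<^bsub>B0\<^esub> a"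
      then obtain c where [simp]: "c \<in> carrier B0" and c: "b \<prec>\<^bsub>B0\<^esub> c" "c \<prec>\<^bsub>B0\<^esub> a"
        using f.B.DV6 \<open>a \<in> carrier B0\<close> by blast
      have "gh.comp (f b) \<sqsubseteq>\<^bsub>B3\<^esub> h (g (f b))" by (intro gh.comp_le) simp_all
      also have "h (g (f b)) \<sqsubseteq>\<^bsub>B3\<^esub> h (fg.comp c)" using c by (intro h.mono fg.le_comp) simp_all
      also (h.B'.le_trans) have "h (fg.comp c) \<sqsubseteq>\<^bsub>B3\<^esub> l.comp a" using c by (intro l.le_comp) simp_all
      finally (h.B'.le_trans) show "gh.comp (f b) \<sqsubseteq>\<^bsub>B3\<^esub> l.comp a" by simp
    qed
  qed simp_all
  then show ?thesis
    by (intro extensionalityI[of _ "carrier B0"]) (auto simp: dev_comp_def)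
qed

text \<open>Both unit laws are (M4): composing with an identity leaves the supremum of the images of
  all \<open>b \<prec> a\<close>.\<close>

lemma category_DeV: "category DeV"
proof (unfold_locales, goal_cases)
  case (1 x)
  then show ?case using de_vries_algebra.id_morphism by (auto simp: DeV_def)
next
  case (2 x y z f g)
  then interpret de_vries_morphism_pair x y z f g
    by (auto simp: DeV_def de_vries_morphism_pair_def)
  show ?case using comp_morphism by (simp add: DeV_def)
next
  case (3 x y f)
  then interpret de_vries_morphism x y f by (simp add: DeV_def)
  have "{f ((\<lambda>a\<in>carrier x. a) b) |b. b \<in> carrier x \<and> b \<prec>\<^bsub>x\<^esub> a} = {f b |b. b \<in> carrier x \<and> b \<prec>\<^bsub>x\<^esub> a}" for a
    by force
  then have "dev_comp x y f (\<lambda>a\<in>carrier x. a) = f"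
    by (intro dev_comp_eqI[OF B'.de_vries_algebra_axioms map]) (simp only:, rule M4)
  then show ?case by (simp add: DeV_def)
next
  case (4 x y f)
  then interpret de_vries_morphism x y f by (simp add: DeV_def)
  have "{(\<lambda>a\<in>carrier y. a) (f b) |b. b \<in> carrier x \<and> b \<prec>\<^bsub>x\<^esub> a} = {f b |b. b \<in> carrier x \<and> b \<prec>\<^bsub>x\<^esub> a}" for a
    by force
  then have "dev_comp x y (\<lambda>a\<in>carrier y. a) f = f"
    by (intro dev_comp_eqI[OF B'.de_vries_algebra_axioms map]) (simp only:, rule M4)
  then show ?case by (simp add: DeV_def)
next
  case (5 w x y z f g h)
  then show ?case using dev_comp_assoc by (auto simp: DeV_def)
qed

section \<open>The de Vries algebra of idempotents\<close>

context proximity_dedekind_algebra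
begin

abbreviation A where "A \<equiv> carrier (reflexives D)"

lemma mem_A: "a \<in> A \<longleftrightarrow> a \<in> carrier D \<and> a \<lhd> a"
  by (simp add: reflexives_def)

lemma A_carrier [simp]: "a \<in> A \<Longrightarrow> a \<in> carrier D"
  by (simp add: mem_A)

lemma prox_iff:
  assumes [simp]: "a \<in> carrier D" "b \<in> carrier D"
  shows "a \<lhd> b \<longleftrightarrow> (\<exists>c\<in>A. a \<preceq> c \<and> c \<preceq> b)"
proof
  assume "a \<lhd> b"
  then obtain c where "c \<in> carrier D" "c \<lhd> c" "a \<lhd> c" "c \<lhd> b" using KT[of a b] by auto
  then show "\<exists>c\<in>A. a \<preceq> c \<and> c \<preceq> b" using P2[of a c] P2[of c b] by (auto simp: mem_A)
next
  assume "\<exists>c\<in>A. a \<preceq> c \<and> c \<preceq> b"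
  then show "a \<lhd> b" using P3[of a _ _ b] by (auto simp: mem_A)
qed

lemma A_prox_iff: "\<lbrakk>c \<in> A; a \<in> carrier D\<rbrakk> \<Longrightarrow> c \<lhd> a \<longleftrightarrow> c \<preceq> a"
  using P2[of c a] prox_iff[of c a] by auto

lemma A_zero [simp]: "\<zero> \<in> A" and A_one [simp]: "\<one> \<in> A"
  using P1 by (simp_all add: mem_A)

lemma A_add [simp]: "\<lbrakk>c \<in> A; d \<in> A\<rbrakk> \<Longrightarrow> c \<oplus> d \<in> A"
  using P6[of c c d d] by (simp add: mem_A)

lemma A_minus [simp]: "c \<in> A \<Longrightarrow> \<ominus> c \<in> A"
  using P5[of c c] by (simp add: mem_A)

lemma A_diff [simp]: "\<lbrakk>c \<in> A; d \<in> A\<rbrakk> \<Longrightarrow> c \<ominus> d \<in> A"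
  by (simp add: minus_eq)

lemma A_smult [simp]: "c \<in> A \<Longrightarrow> r \<odot> c \<in> A"
proof -
  assume c: "c \<in> A"
  have pos: "s \<odot> c \<in> A" if "0 < s" for s using P7[of c c s] c that by (simp add: mem_A)
  consider "r > 0" | "r = 0" | "r < 0" by linarith
  then show ?thesis
  proof cases
    case 3
    then show ?thesis using A_minus[OF pos[of "- r"]] c by (simp add: smult_minus_left)
  qed (use pos c in simp_all)
qed

lemma A_wedge [simp]:
  assumes c: "c \<in> A" and d: "d \<in> A"
  shows "c \<curlywedge> d \<in> A"
proof -
  have [simp]: "c \<in> carrier D" "d \<in> carrier D" using c d by simp_all
  have "c \<curlywedge> d \<lhd> c" "c \<curlywedge> d \<lhd> d"
    using c d wedge_le1[of c d] wedge_le2[of c d] prox_iff[of "c \<curlywedge> d"] by auto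
  then show ?thesis using P4[of "c \<curlywedge> d" c d] by (simp add: mem_A)
qed

lemma A_vee [simp]: "\<lbrakk>c \<in> A; d \<in> A\<rbrakk> \<Longrightarrow> c \<curlyvee> d \<in> A"
proof -
  assume c: "c \<in> A" and d: "d \<in> A"
  have "\<ominus> (c \<curlyvee> d) \<in> A" using c d by (simp add: minus_vee)
  then have "\<ominus> (\<ominus> (c \<curlyvee> d)) \<in> A" by (rule A_minus)
  then show ?thesis using c d by simp
qed

text \<open>(P8) covers nonnegative factors only. Both factors are shifted by real multiples of the
  unit, and the surplus terms of the expanded product, which are linear in reflexive elements, are
  subtracted.\<close>

lemma A_mult [simp]:
  assumes c: "c \<in> A" and d: "d \<in> A"
  shows "c \<otimes> d \<in> A"
proof -
  have [simp]: "c \<in> carrier D" "d \<in> carrier D" using c d by simp_all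
  have nonneg: "x \<otimes> y \<in> A" if "x \<in> A" "y \<in> A" "\<zero> \<preceq> x" "\<zero> \<preceq> y" for x y
    using that P8[of x x y y] by (simp add: mem_A)
  have shift: "\<exists>r. \<zero> \<preceq> x \<oplus> r \<odot> \<one>" if [simp]: "x \<in> carrier D" for x
  proof -
    obtain r where "\<ominus> x \<preceq> r \<odot> \<one>" by (rule le_of_real[of "\<ominus> x"]) simp
    then have "\<zero> \<preceq> r \<odot> \<one> \<ominus> (\<ominus> x)" by (simp add: le_iff_diff[symmetric])
    then show ?thesis by (auto simp: minus_eq a_comm[of x])
  qed
  obtain r where r: "\<zero> \<preceq> c \<oplus> r \<odot> \<one>" using shift[of c] by auto
  obtain s where s: "\<zero> \<preceq> d \<oplus> s \<odot> \<one>" using shift[of d] by auto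
  have "(c \<oplus> r \<odot> \<one>) \<otimes> (d \<oplus> s \<odot> \<one>) \<in> A"
    using r s c d by (intro nonneg) simp_all
  moreover have "c \<otimes> d = (c \<oplus> p) \<otimes> (d \<oplus> q) \<ominus> (c \<otimes> q \<oplus> p \<otimes> d \<oplus> p \<otimes> q)"
    if "p \<in> carrier D" "q \<in> carrier D" for p q
    by (simp add: ring_simps that)
  from this[of "r \<odot> \<one>" "s \<odot> \<one>"]
  have "c \<otimes> d = (c \<oplus> r \<odot> \<one>) \<otimes> (d \<oplus> s \<odot> \<one>) \<ominus> (s \<odot> c \<oplus> r \<odot> d \<oplus> s \<odot> (r \<odot> \<one>))"
    by (simp add: smult_mult_left smult_mult_right)
  ultimately show ?thesis using c d A_diff A_add A_smult A_one by metis
qed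

lemma reflexive_below:
  assumes "\<zero> \<preceq> a" "a \<noteq> \<zero>" and [simp]: "a \<in> carrier D"
  obtains c where "c \<in> A" "\<zero> \<preceq> c" "c \<noteq> \<zero>" "c \<preceq> a"
proof -
  obtain b where [simp]: "b \<in> carrier D" and b: "\<zero> \<preceq> b" "b \<noteq> \<zero>" "b \<lhd> a" using P10[of a] assms by auto
  then obtain c where c: "c \<in> A" "b \<preceq> c" "c \<preceq> a" using prox_iff[of b a] by auto
  show thesis
    using that[of c] c b le_trans[of \<zero> b c] le_antisym[of b \<zero>] by auto
qed

lemma mult_compl_zero_iff:
  assumes [simp]: "a \<in> carrier D" "e \<in> carrier D"
  shows "a \<otimes> (\<one> \<ominus> e) = \<zero> \<longleftrightarrow> a \<otimes> e = a"
proof -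
  have "a \<otimes> (\<one> \<ominus> e) = a \<ominus> a \<otimes> e" by (simp add: ring_simps)
  then show ?thesis using eq_diff0[of a "a \<otimes> e"] by auto
qed

text \<open>The support of \<open>c - \<epsilon>\<close> lies below the reflexive element \<open>min (c / \<epsilon>) 1\<close>, which lies below \<open>f\<close>.\<close>

lemma idempotent_between:
  assumes c: "c \<in> A" "\<zero> \<preceq> c" "c \<preceq> f" and f: "f \<otimes> f = f" and [simp]: "f \<in> carrier D"
    and \<epsilon>: "0 < \<epsilon>"
  obtains g where "g \<in> carrier D" "g \<otimes> g = g" "g \<lhd> f"
    "((c \<ominus> \<epsilon> \<odot> \<one>) \<curlyvee> \<zero>) \<otimes> g = (c \<ominus> \<epsilon> \<odot> \<one>) \<curlyvee> \<zero>"
proof -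
  define r where "r = c \<ominus> \<epsilon> \<odot> \<one>"
  define p where "p = r \<curlyvee> \<zero>"
  define q where "q = (\<ominus> r) \<curlyvee> \<zero>"
  have r: "r \<in> A" using c by (simp add: r_def)
  have [simp]: "c \<in> carrier D" "r \<in> carrier D" "p \<in> carrier D" "q \<in> carrier D" and qA: "q \<in> A"
    using r c by (simp_all add: p_def q_def)
  have pq: "p \<otimes> q = \<zero>" using pos_neg_parts(2)[of r] by (simp add: p_def q_def)
  obtain e where [simp]: "e \<in> carrier D" and e: "e \<otimes> e = e"
    and ann: "\<And>a. a \<in> carrier D \<Longrightarrow> a \<otimes> e = a \<longleftrightarrow> a \<otimes> p = \<zero>"
    using annihilating_idempotent[of "{p}"] by auto
  have ep: "e \<otimes> p = \<zero>" using ann[of e] e by simp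
  define g where "g = \<one> \<ominus> e"
  define h where "h = \<one> \<ominus> (1 / \<epsilon>) \<odot> q"
  have [simp]: "g \<in> carrier D" "h \<in> carrier D" and hA: "h \<in> A" using qA by (simp_all add: g_def h_def)
  have gg: "g \<otimes> g = g" using e by (simp add: g_def idem_compl)
  have "q \<otimes> e = q" using pq ann[of q] by (simp add: m_comm)
  then have "q \<otimes> g = \<zero>" by (simp add: g_def mult_compl_zero_iff)
  then have "((1 / \<epsilon>) \<odot> q) \<otimes> g = \<zero>" by (simp add: smult_mult_left)
  moreover have "(\<one> \<ominus> y) \<otimes> g = g" if "y \<otimes> g = \<zero>" "y \<in> carrier D" for y
    using that by (simp add: ring_simps)
  ultimately have hg: "h \<otimes> g = g" by (simp add: h_def)
  have pg: "p \<otimes> g = p"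
  proof -
    have "p \<otimes> g = p \<ominus> e \<otimes> p" unfolding g_def by (simp add: ring_simps)
    then show ?thesis using ep by (simp add: minus_eq)
  qed
  have q_le: "(1 / \<epsilon>) \<odot> q \<preceq> \<one>"
  proof -
    have "\<epsilon> \<odot> \<one> \<ominus> (\<ominus> r) = c"
    proof -
      have "x \<ominus> (\<ominus> (c \<ominus> x)) = c" if "x \<in> carrier D" for x by (simp add: ring_simps that)
      then show ?thesis by (simp add: r_def)
    qed
    then have "\<ominus> r \<preceq> \<epsilon> \<odot> \<one>" using c by (simp add: le_iff_diff[of "\<ominus> r"])
    moreover have "\<zero> \<preceq> \<epsilon> \<odot> \<one>" using \<epsilon> by (simp add: smult_nonneg)
    ultimately have "q \<preceq> \<epsilon> \<odot> \<one>" unfolding q_def by (intro vee_least) simp_all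
    then show ?thesis using \<epsilon> by (simp add: smult_le_iff)
  qed
  then have h0: "\<zero> \<preceq> h" by (simp add: h_def le_iff_diff[symmetric])
  have h_le: "h \<preceq> (1 / \<epsilon>) \<odot> c"
  proof -
    have "\<ominus> r \<preceq> q" by (simp add: q_def vee_ge1)
    then have "(1 / \<epsilon>) \<odot> (\<ominus> r) \<preceq> (1 / \<epsilon>) \<odot> q" using \<epsilon> by (intro smult_mono) simp_all
    moreover have "(1 / \<epsilon>) \<odot> (\<ominus> r) = \<one> \<ominus> (1 / \<epsilon>) \<odot> c"
    proof -
      have "(1 / \<epsilon>) \<odot> r = (1 / \<epsilon>) \<odot> c \<ominus> \<one>" using \<epsilon> by (simp add: r_def smult_diff_right smult_smult)
      moreover have "\<ominus> (x \<ominus> \<one>) = \<one> \<ominus> x" if "x \<in> carrier D" for x by (simp add: ring_simps that)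
      ultimately show ?thesis by (simp add: smult_minus_right)
    qed
    ultimately show ?thesis by (simp add: h_def diff_le_iff a_comm)
  qed
  have "c \<otimes> f = c" using le_idem_mult[OF c(2,3) f] by simp
  then have "c \<otimes> (\<one> \<ominus> f) = \<zero>" by (simp add: mult_compl_zero_iff)
  then have "((1 / \<epsilon>) \<odot> c) \<otimes> (\<one> \<ominus> f) = \<zero>" by (simp add: smult_mult_left)
  moreover have f': "\<zero> \<preceq> \<one> \<ominus> f" using idem_le_one[OF f] by (simp add: le_iff_diff[symmetric])
  ultimately have "h \<otimes> (\<one> \<ominus> f) \<preceq> \<zero>" using mult_right_mono[OF h_le, of "\<one> \<ominus> f"] by simp
  then have "h \<otimes> (\<one> \<ominus> f) = \<zero>" using mult_nonneg[OF _ _ h0 f'] by (intro le_antisym) simp_all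
  then have "h \<otimes> f = h" by (simp add: mult_compl_zero_iff)
  moreover have "h \<preceq> \<one>"
  proof -
    have "\<one> \<ominus> (\<one> \<ominus> y) = y" if "y \<in> carrier D" for y by (simp add: ring_simps that)
    then show ?thesis
      using \<epsilon> smult_nonneg[of q "1 / \<epsilon>"] by (simp add: h_def le_iff_diff[of _ \<one>] q_def vee_ge2)
  qed
  ultimately have hf: "h \<preceq> f" using f by - (rule mult_idem_le, simp_all)
  have "g \<preceq> h"
    using mult_left_mono[OF idem_le_one[OF gg] h0] hg by simp
  with hf hA have "g \<lhd> f" using prox_iff[of g f] by auto
  with gg pg show thesis by (intro that[of g]) (simp_all add: p_def r_def)
qed

section \<open>The complete boolean algebra of idempotents and its proximity\<close>

lemma Id_simps [simp]:
  "carrier (Id_DeV D) = {e \<in> carrier D. e \<otimes> e = e}" "eq (Id_DeV D) = (=)"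
  "e \<sqsubseteq>\<^bsub>Id_DeV D\<^esub> f \<longleftrightarrow> e \<otimes> f = e" "prec (Id_DeV D) = prox D"
  by (simp_all add: Id_DeV_def)

lemma partial_order_Id: "partial_order (Id_DeV D)"
proof unfold_locales
  fix x y z
  assume "x \<sqsubseteq>\<^bsub>Id_DeV D\<^esub> y" "y \<sqsubseteq>\<^bsub>Id_DeV D\<^esub> z" "x \<in> carrier (Id_DeV D)" "y \<in> carrier (Id_DeV D)"
    "z \<in> carrier (Id_DeV D)"
  then show "x \<sqsubseteq>\<^bsub>Id_DeV D\<^esub> z" using m_assoc[of x y z] by simp
qed (auto simp: m_comm)

text \<open>The infimum of \<open>S\<close> generates the annihilator of the complements 1 - e with
  e in \<open>S\<close>, since a(1 - e) = 0 says that e absorbs a. With a top element, infima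
  suffice.\<close>

lemma complete_lattice_Id: "complete_lattice (Id_DeV D)"
proof -
  interpret partial_order "Id_DeV D" by (rule partial_order_Id)
  show ?thesis
  proof (rule complete_lattice_criterion1)
    show "\<exists>g. greatest (Id_DeV D) g (carrier (Id_DeV D))"
      by (rule exI[of _ \<one>]) (auto simp: greatest_def)
    fix S assume S: "S \<subseteq> carrier (Id_DeV D)"
    then have "(\<lambda>e. \<one> \<ominus> e) ` S \<subseteq> carrier D" by auto
    then obtain g where g: "g \<in> carrier D" "g \<otimes> g = g"
      "\<And>a. a \<in> carrier D \<Longrightarrow> a \<otimes> g = a \<longleftrightarrow> (\<forall>t\<in>(\<lambda>e. \<one> \<ominus> e) ` S. a \<otimes> t = \<zero>)"
      by (rule annihilating_idempotent) blast
    have iff: "a \<otimes> g = a \<longleftrightarrow> (\<forall>e\<in>S. a \<otimes> e = a)" if "a \<in> carrier D" for a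
    proof -
      have "a \<otimes> (\<one> \<ominus> e) = \<zero> \<longleftrightarrow> a \<otimes> e = a" if "e \<in> S" for e
        using mult_compl_zero_iff[of a e] \<open>a \<in> carrier D\<close> S that by auto
      then show ?thesis using g(3)[OF that] by simp
    qed
    from iff[OF g(1)] iff show "\<exists>g. is_glb (Id_DeV D) g S"
      using S g(1,2) by (intro exI[of _ g]) (auto simp: greatest_def Lower_def)
  qed
qed

lemma Id_lattice_ops:
  shows Id_top: "\<top>\<^bsub>Id_DeV D\<^esub> = \<one>" and Id_bottom: "\<bottom>\<^bsub>Id_DeV D\<^esub> = \<zero>"
    and Id_meet: "\<And>e f. \<lbrakk>e \<in> carrier (Id_DeV D); f \<in> carrier (Id_DeV D)\<rbrakk> \<Longrightarrow> e \<sqinter>\<^bsub>Id_DeV D\<^esub> f = e \<otimes> f"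
    and Id_join: "\<And>e f. \<lbrakk>e \<in> carrier (Id_DeV D); f \<in> carrier (Id_DeV D)\<rbrakk>
      \<Longrightarrow> e \<squnion>\<^bsub>Id_DeV D\<^esub> f = e \<oplus> f \<ominus> e \<otimes> f"
proof -
  interpret B: complete_lattice "Id_DeV D" by (rule complete_lattice_Id)
  show "\<top>\<^bsub>Id_DeV D\<^esub> = \<one>"
    using B.top_higher[of \<one>] B.top_closed by simp
  show "\<bottom>\<^bsub>Id_DeV D\<^esub> = \<zero>"
    using B.bottom_lower[of \<zero>] B.bottom_closed by simp
  fix e f assume e: "e \<in> carrier (Id_DeV D)" and f: "f \<in> carrier (Id_DeV D)"
  then have [simp]: "e \<in> carrier D" "f \<in> carrier D" and idem: "e \<otimes> e = e" "f \<otimes> f = f" by simp_all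
  show "e \<sqinter>\<^bsub>Id_DeV D\<^esub> f = e \<otimes> f"
  proof (rule B.le_antisym)
    show "e \<otimes> f \<sqsubseteq>\<^bsub>Id_DeV D\<^esub> e \<sqinter>\<^bsub>Id_DeV D\<^esub> f"
    proof (rule B.meet_le)
      have "(e \<otimes> f) \<otimes> e = e \<otimes> f" "(e \<otimes> f) \<otimes> f = e \<otimes> f" using idem by (simp_all add: ring_simps mult_assoc_eq[OF idem(1)] mult_assoc_eq[OF idem(2)])
      then show "e \<otimes> f \<sqsubseteq>\<^bsub>Id_DeV D\<^esub> e" "e \<otimes> f \<sqsubseteq>\<^bsub>Id_DeV D\<^esub> f" by simp_all
    qed (use e f in \<open>simp_all add: idem_mult\<close>)
    let ?m = "e \<sqinter>\<^bsub>Id_DeV D\<^esub> f"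
    have "?m \<in> carrier D" "?m \<otimes> e = ?m" "?m \<otimes> f = ?m"
      using B.meet_left[OF e f] B.meet_right[OF e f] B.meet_closed[OF e f] by simp_all
    then show "?m \<sqsubseteq>\<^bsub>Id_DeV D\<^esub> e \<otimes> f" by (simp add: m_assoc[symmetric])
  qed (use e f in \<open>simp_all add: idem_mult B.meet_closed[simplified]\<close>)
  let ?j = "e \<squnion>\<^bsub>Id_DeV D\<^esub> f" and ?k = "e \<oplus> f \<ominus> e \<otimes> f"
  have k: "?k \<in> carrier (Id_DeV D)"
  proof -
    have "?k \<otimes> ?k = ?k" using idem by (simp add: ring_simps mult_assoc_eq[OF idem(1)] mult_assoc_eq[OF idem(2)])
    then show ?thesis by simp
  qed
  have j: "?j \<in> carrier (Id_DeV D)" using e f by (rule B.join_closed)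
  show "?j = ?k"
  proof (rule B.le_antisym)
    have "e \<otimes> ?k = e" "f \<otimes> ?k = f" using idem by (simp_all add: ring_simps mult_assoc_eq[OF idem(1)] mult_assoc_eq[OF idem(2)])
    then show "?j \<sqsubseteq>\<^bsub>Id_DeV D\<^esub> ?k" using e f k by (intro B.join_le) simp_all
    have jc: "?j \<in> carrier D" using j by simp
    have ej: "e \<otimes> ?j = e" "f \<otimes> ?j = f" using B.join_left[OF e f] B.join_right[OF e f] by simp_all
    have "?k \<otimes> j' = ?k" if "e \<otimes> j' = e" "f \<otimes> j' = f" "j' \<in> carrier D" for j'
      using that by (simp add: ring_simps)
    from this[OF ej jc] show "?k \<sqsubseteq>\<^bsub>Id_DeV D\<^esub> ?j" by simp
  qed (use j k in simp_all)
qed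

lemma complete_boolean_algebra_Id: "complete_boolean_algebra (Id_DeV D)"
proof -
  interpret B: complete_lattice "Id_DeV D" by (rule complete_lattice_Id)
  show ?thesis
  proof unfold_locales
    fix a b c
    assume carr: "a \<in> carrier (Id_DeV D)" "b \<in> carrier (Id_DeV D)" "c \<in> carrier (Id_DeV D)"
    then have [simp]: "a \<in> carrier D" "b \<in> carrier D" "c \<in> carrier D" and aa: "a \<otimes> a = a" by simp_all
    have "a \<otimes> (b \<oplus> c \<ominus> b \<otimes> c) = a \<otimes> b \<oplus> a \<otimes> c \<ominus> (a \<otimes> b) \<otimes> (a \<otimes> c)"
      using aa by (simp add: ring_simps mult_assoc_eq[OF aa])
    then show "a \<sqinter>\<^bsub>Id_DeV D\<^esub> (b \<squnion>\<^bsub>Id_DeV D\<^esub> c) =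
        (a \<sqinter>\<^bsub>Id_DeV D\<^esub> b) \<squnion>\<^bsub>Id_DeV D\<^esub> (a \<sqinter>\<^bsub>Id_DeV D\<^esub> c)"
      using carr B.join_closed[OF carr(2,3)] B.meet_closed[OF carr(1,2)] B.meet_closed[OF carr(1,3)]
      by (simp add: Id_meet Id_join)
  next
    fix a assume a: "a \<in> carrier (Id_DeV D)"
    then have [simp]: "a \<in> carrier D" and aa: "a \<otimes> a = a" by simp_all
    have "a \<otimes> (\<one> \<ominus> a) = \<zero>" using aa by (simp add: mult_compl_zero_iff)
    moreover have "a \<oplus> (\<one> \<ominus> a) \<ominus> \<zero> = \<one>" by (simp add: ring_simps)
    ultimately show "\<exists>c\<in>carrier (Id_DeV D). a \<sqinter>\<^bsub>Id_DeV D\<^esub> c = \<bottom>\<^bsub>Id_DeV D\<^esub> \<and> a \<squnion>\<^bsub>Id_DeV D\<^esub> c = \<top>\<^bsub>Id_DeV D\<^esub>"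
      using a aa by (intro bexI[of _ "\<one> \<ominus> a"]) (simp_all add: Id_lattice_ops idem_compl)
  qed
qed

lemma Id_cmpl:
  assumes "e \<in> carrier (Id_DeV D)"
  shows "cmpl (Id_DeV D) e = \<one> \<ominus> e"
proof -
  interpret B: complete_boolean_algebra "Id_DeV D" by (rule complete_boolean_algebra_Id)
  have [simp]: "e \<in> carrier D" and ee: "e \<otimes> e = e" using assms by simp_all
  have "e \<otimes> (\<one> \<ominus> e) = \<zero>" using ee by (simp add: mult_compl_zero_iff)
  moreover have "e \<oplus> (\<one> \<ominus> e) \<ominus> \<zero> = \<one>" by (simp add: ring_simps)
  ultimately show ?thesis
    using ee by (intro B.cmpl_eqI) (simp_all add: Id_lattice_ops idem_compl)
qed

lemma positive_part_nonzero:
  assumes "c \<in> carrier D" "\<zero> \<preceq> c" "c \<noteq> \<zero>"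
  shows "\<exists>\<epsilon>>0. (c \<ominus> \<epsilon> \<odot> \<one>) \<curlyvee> \<zero> \<noteq> \<zero>"
proof (rule ccontr)
  assume "\<not> ?thesis"
  then have *: "(c \<ominus> \<epsilon> \<odot> \<one>) \<curlyvee> \<zero> = \<zero>" if "0 < \<epsilon>" for \<epsilon>
    using that by blast
  have "c \<preceq> \<zero>"
  proof (rule archimedean_eps[where b = \<one>])
    fix \<epsilon> :: real assume "0 < \<epsilon>"
    then have "c \<ominus> \<epsilon> \<odot> \<one> \<preceq> \<zero>" using * vee_ge1[of "c \<ominus> \<epsilon> \<odot> \<one>" \<zero>] assms by simp
    then show "c \<preceq> \<zero> \<oplus> \<epsilon> \<odot> \<one>" using assms by (simp add: diff_le_iff)
  qed (use assms in simp_all)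
  then show False using assms le_antisym by simp
qed

text \<open>Choose c reflexive with e \<le> c \<le> f and let g be an idempotent absorbing p = (c -
  1/2)^+ as in \<open>idempotent_between\<close>. The reflexive element 2p witnesses
  \<open>e \<lhd> g\<close>: it lies in [0, 1], is absorbed by g, and dominates e because c is 1 on
  e.\<close>

lemma Id_interpolation:
  assumes e: "e \<otimes> e = e" and f: "f \<otimes> f = f" and [simp]: "e \<in> carrier D" "f \<in> carrier D" and ef: "e \<lhd> f"
  obtains g where "g \<in> carrier D" "g \<otimes> g = g" "e \<lhd> g" "g \<lhd> f"
proof -
  obtain c where c: "c \<in> A" "e \<preceq> c" "c \<preceq> f" using ef prox_iff[of e f] by auto
  then have [simp]: "c \<in> carrier D" by simp
  have e0: "\<zero> \<preceq> e" and e1: "e \<preceq> \<one>" and f1: "f \<preceq> \<one>" using e f by (simp_all add: idem_nonneg idem_le_one)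
  have c0: "\<zero> \<preceq> c" using e0 c by (meson le_trans A_carrier assms(3) zero_closed)
  have c1: "c \<preceq> \<one>" using f1 c by (meson le_trans A_carrier assms(4) one_closed)
  \<comment> \<open>Any threshold t strictly between 0 and 1 would serve, with 1/(1 - t) as the
    factor that rescales p to [0, 1]; for t = 1/2 this factor is 2.\<close>
  define p where "p = (c \<ominus> (1 / 2) \<odot> \<one>) \<curlyvee> \<zero>"
  obtain g where [simp]: "g \<in> carrier D" and g: "g \<otimes> g = g" "g \<lhd> f" "p \<otimes> g = p"
    using idempotent_between[OF c(1) c0 c(3) f, of "1 / 2"] by (auto simp: p_def)
  have [simp]: "p \<in> carrier D" and pA: "2 \<odot> p \<in> A" and p0: "\<zero> \<preceq> p"
    using c by (simp_all add: p_def vee_ge2)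
  have "p \<preceq> (1 / 2) \<odot> \<one>"
    unfolding p_def
  proof (rule vee_least)
    have "c \<preceq> (1 / 2) \<odot> \<one> \<oplus> (1 / 2) \<odot> \<one>" using c1 smult_add_left[of \<one> "1 / 2" "1 / 2"] by simp
    then show "c \<ominus> (1 / 2) \<odot> \<one> \<preceq> (1 / 2) \<odot> \<one>" by (simp add: diff_le_iff)
  qed (simp_all add: smult_nonneg)
  then have "2 \<odot> p \<preceq> \<one>" by (simp add: smult_le_iff)
  then have "2 \<odot> p \<preceq> g" using g by - (rule mult_idem_le, simp_all add: smult_mult_left)
  moreover have "e \<preceq> 2 \<odot> p"
  proof -
    have "e \<preceq> c \<otimes> e" using mult_right_mono[OF c(2) e0] e by simp
    moreover have "c \<otimes> e \<preceq> e" using mult_right_mono[OF c1 e0] by simp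
    ultimately have ce: "c \<otimes> e = e" by (intro le_antisym) simp_all
    have "2 \<odot> (c \<ominus> (1 / 2) \<odot> \<one>) \<preceq> 2 \<odot> p" unfolding p_def by (intro smult_mono) (simp_all add: vee_ge1)
    then have "(2 \<odot> c \<ominus> \<one>) \<otimes> e \<preceq> (2 \<odot> p) \<otimes> e"
      using e0 by (intro mult_right_mono) (simp_all add: smult_diff_right smult_smult)
    moreover have "(2 \<odot> c \<ominus> \<one>) \<otimes> e = e"
    proof -
      have "(x \<ominus> \<one>) \<otimes> e = x \<otimes> e \<ominus> e" if "x \<in> carrier D" for x by (simp add: ring_simps that)
      then have "(2 \<odot> c \<ominus> \<one>) \<otimes> e = 2 \<odot> e \<ominus> e" using ce by (simp add: smult_mult_left)
      also have "2 \<odot> e = e \<oplus> e" using smult_add_left[of e 1 1] by simp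
      also have "(e \<oplus> e) \<ominus> e = e" by (simp add: ring_simps)
      finally show ?thesis .
    qed
    moreover have "(2 \<odot> p) \<otimes> e \<preceq> 2 \<odot> p"
      using mult_left_mono[OF e1, of "2 \<odot> p"] p0 by (simp add: smult_nonneg)
    ultimately show ?thesis using le_trans[of e "(2 \<odot> p) \<otimes> e" "2 \<odot> p"] by simp
  qed
  ultimately have "e \<lhd> g" using pA prox_iff[of e g] by auto
  with g show thesis by (intro that[of g]) simp_all
qed

lemma de_vries_algebra_Id: "de_vries_algebra (Id_DeV D)"
proof -
  interpret B: complete_boolean_algebra "Id_DeV D" by (rule complete_boolean_algebra_Id)
  show ?thesis
  proof unfold_locales
    show "\<top>\<^bsub>Id_DeV D\<^esub> \<prec>\<^bsub>Id_DeV D\<^esub> \<top>\<^bsub>Id_DeV D\<^esub>" by (simp add: Id_top P1)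
  next
    fix a b c d
    assume "a \<in> carrier (Id_DeV D)" "b \<in> carrier (Id_DeV D)" "c \<in> carrier (Id_DeV D)" "d \<in> carrier (Id_DeV D)"
      "a \<sqsubseteq>\<^bsub>Id_DeV D\<^esub> b" "b \<prec>\<^bsub>Id_DeV D\<^esub> c" "c \<sqsubseteq>\<^bsub>Id_DeV D\<^esub> d"
    then show "a \<prec>\<^bsub>Id_DeV D\<^esub> d" using P3[of a b c d] by (simp add: idem_le_iff)
  next
    fix a b c
    assume "a \<in> carrier (Id_DeV D)" "b \<in> carrier (Id_DeV D)" "c \<in> carrier (Id_DeV D)"
      "a \<prec>\<^bsub>Id_DeV D\<^esub> b" "a \<prec>\<^bsub>Id_DeV D\<^esub> c"
    \<comment> \<open>The meet in this algebra is the product, so (DV4) is (P8) applied to two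
      copies of the idempotent a.\<close>
    then show "a \<prec>\<^bsub>Id_DeV D\<^esub> b \<sqinter>\<^bsub>Id_DeV D\<^esub> c"
      using P8[of a b a c] by (simp add: Id_meet idem_nonneg)
  next
    fix a b assume "a \<in> carrier (Id_DeV D)" "b \<in> carrier (Id_DeV D)" "a \<prec>\<^bsub>Id_DeV D\<^esub> b"
    \<comment> \<open>Complements are 1 - e: negate by (P5), then add the unit, which is reflexive,
      by (P6).\<close>
    then show "cmpl (Id_DeV D) b \<prec>\<^bsub>Id_DeV D\<^esub> cmpl (Id_DeV D) a"
      using P6[of \<one> \<one> "\<ominus> b" "\<ominus> a"] P5[of a b] P1 by (simp add: Id_cmpl minus_eq)
  next
    fix a b assume "a \<in> carrier (Id_DeV D)" "b \<in> carrier (Id_DeV D)" "a \<prec>\<^bsub>Id_DeV D\<^esub> b"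
    then show "\<exists>c\<in>carrier (Id_DeV D). a \<prec>\<^bsub>Id_DeV D\<^esub> c \<and> c \<prec>\<^bsub>Id_DeV D\<^esub> b"
      using Id_interpolation[of a b] by auto
  next
    fix a assume a: "a \<in> carrier (Id_DeV D)" "a \<noteq> \<bottom>\<^bsub>Id_DeV D\<^esub>"
    then have [simp]: "a \<in> carrier D" and aa: "a \<otimes> a = a" and "a \<noteq> \<zero>" by (simp_all add: Id_bottom)
    then obtain c where c: "c \<in> A" "\<zero> \<preceq> c" "c \<noteq> \<zero>" "c \<preceq> a"
      using reflexive_below[OF idem_nonneg] by metis
    then obtain \<epsilon> where "0 < \<epsilon>" and \<epsilon>: "(c \<ominus> \<epsilon> \<odot> \<one>) \<curlyvee> \<zero> \<noteq> \<zero>"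
      using positive_part_nonzero[of c] by auto
    obtain g where "g \<in> carrier D" "g \<otimes> g = g" "g \<lhd> a"
      "((c \<ominus> \<epsilon> \<odot> \<one>) \<curlyvee> \<zero>) \<otimes> g = (c \<ominus> \<epsilon> \<odot> \<one>) \<curlyvee> \<zero>"
      using idempotent_between[OF c(1,2,4) aa _ \<open>0 < \<epsilon>\<close>] by auto
    moreover from this \<epsilon> c have "g \<noteq> \<zero>" by auto
    ultimately show "\<exists>b\<in>carrier (Id_DeV D). b \<noteq> \<bottom>\<^bsub>Id_DeV D\<^esub> \<and> b \<prec>\<^bsub>Id_DeV D\<^esub> a"
      by (auto simp: Id_bottom)
  qed (auto simp: P2 simp flip: idem_le_iff)
qed

end

section \<open>The isomorphism with annihilator ideals\<close>

lemma setcompr_fixed_points: "(\<And>b. P b \<Longrightarrow> f b = b) \<Longrightarrow> {f b |b. P b} = {b. P b}"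
  by force

text \<open>The lattice operations, complements and all de Vries axioms of the target are carried
  over along \<phi>. For annihilator ideals it remains only to compare inclusion with the order and
  comaximality with the proximity.\<close>

lemma de_vries_transport:
  assumes "de_vries_algebra B" and bij: "bij_betw \<phi> (carrier B) (carrier B')" and "eq B' = (=)"
    and le: "\<And>a b. \<lbrakk>a \<in> carrier B; b \<in> carrier B\<rbrakk> \<Longrightarrow> \<phi> a \<sqsubseteq>\<^bsub>B'\<^esub> \<phi> b \<longleftrightarrow> a \<sqsubseteq>\<^bsub>B\<^esub> b"
    and pr: "\<And>a b. \<lbrakk>a \<in> carrier B; b \<in> carrier B\<rbrakk> \<Longrightarrow> \<phi> a \<prec>\<^bsub>B'\<^esub> \<phi> b \<longleftrightarrow> a \<prec>\<^bsub>B\<^esub> b"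
    and ext: "\<phi> \<in> extensional (carrier B)"
  shows "de_vries_isomorphism B B' \<phi>"
proof -
  interpret B: de_vries_algebra B by fact
  define \<psi> where "\<psi> = restrict (inv_into (carrier B) \<phi>) (carrier B')"
  have \<phi> [simp]: "\<phi> a \<in> carrier B'" and \<psi>\<phi> [simp]: "\<psi> (\<phi> a) = a" if "a \<in> carrier B" for a
    using that bij by (auto simp: \<psi>_def bij_betw_def)
  have \<psi> [simp]: "\<psi> b \<in> carrier B" and \<phi>\<psi> [simp]: "\<phi> (\<psi> b) = b" if "b \<in> carrier B'" for b
    using that bij by (auto simp: \<psi>_def bij_betw_def inv_into_into f_inv_into_f)
  have le': "x \<sqsubseteq>\<^bsub>B'\<^esub> y \<longleftrightarrow> \<psi> x \<sqsubseteq>\<^bsub>B\<^esub> \<psi> y" if "x \<in> carrier B'" "y \<in> carrier B'" for x y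
    using le[of "\<psi> x" "\<psi> y"] that by simp
  have pr': "x \<prec>\<^bsub>B'\<^esub> y \<longleftrightarrow> \<psi> x \<prec>\<^bsub>B\<^esub> \<psi> y" if "x \<in> carrier B'" "y \<in> carrier B'" for x y
    using pr[of "\<psi> x" "\<psi> y"] that by simp
  have eq': "x = y" if "\<psi> x = \<psi> y" "x \<in> carrier B'" "y \<in> carrier B'" for x y
    using that by (metis \<phi>\<psi>)
  interpret po: partial_order B'
  proof unfold_locales
    fix x y assume "x \<sqsubseteq>\<^bsub>B'\<^esub> y" "y \<sqsubseteq>\<^bsub>B'\<^esub> x" "x \<in> carrier B'" "y \<in> carrier B'"
    then show "x .=\<^bsub>B'\<^esub> y" using eq'[of x y] B.le_antisym[of "\<psi> x" "\<psi> y"] by (simp add: \<open>eq B' = (=)\<close> le')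
  next
    fix x y z
    assume "x \<sqsubseteq>\<^bsub>B'\<^esub> y" "y \<sqsubseteq>\<^bsub>B'\<^esub> z" "x \<in> carrier B'" "y \<in> carrier B'" "z \<in> carrier B'"
    then show "x \<sqsubseteq>\<^bsub>B'\<^esub> z" using B.le_trans[of "\<psi> x" "\<psi> y" "\<psi> z"] by (simp add: le')
  qed (auto simp: \<open>eq B' = (=)\<close> le')
  have lub: "is_lub B' (\<phi> s) (\<phi> ` S)" if "is_lub B s S" "S \<subseteq> carrier B" for s S
  proof -
    have s: "s \<in> carrier B" using that by auto
    have "\<phi> ` S \<subseteq> carrier B'" using that by auto
    then show ?thesis
      using that s by (subst is_lub_iff) (auto simp: is_lub_iff le' subset_eq)
  qed
  interpret cl: complete_lattice B'
  proof (rule po.complete_lattice_criterion1)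
    have "x \<sqsubseteq>\<^bsub>B'\<^esub> \<phi> \<top>\<^bsub>B\<^esub>" if "x \<in> carrier B'" for x using that by (simp add: le')
    then show "\<exists>g. greatest B' g (carrier B')"
      by (intro exI[of _ "\<phi> \<top>\<^bsub>B\<^esub>"]) (simp add: greatest_def)
    fix S assume S: "S \<subseteq> carrier B'"
    then have S': "\<psi> ` S \<subseteq> carrier B" by auto
    then have "greatest B (\<Sqinter>\<^bsub>B\<^esub>(\<psi> ` S)) (Lower B (\<psi> ` S))" by (rule B.inf_glb)
    then have "is_glb B' (\<phi> (\<Sqinter>\<^bsub>B\<^esub>(\<psi> ` S))) S"
      using S S' B.inf_closed[OF S'] unfolding greatest_def Lower_def by (auto simp: le' subset_eq)
    then show "\<exists>i. is_glb B' i S" ..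
  qed
  have meet: "\<phi> a \<sqinter>\<^bsub>B'\<^esub> \<phi> b = \<phi> (a \<sqinter>\<^bsub>B\<^esub> b)" if [simp]: "a \<in> carrier B" "b \<in> carrier B" for a b
  proof (rule po.le_antisym)
    show "\<phi> (a \<sqinter>\<^bsub>B\<^esub> b) \<sqsubseteq>\<^bsub>B'\<^esub> \<phi> a \<sqinter>\<^bsub>B'\<^esub> \<phi> b"
      by (intro cl.meet_le) (simp_all add: le B.meet_left B.meet_right)
    have "\<psi> (\<phi> a \<sqinter>\<^bsub>B'\<^esub> \<phi> b) \<sqsubseteq>\<^bsub>B\<^esub> a \<sqinter>\<^bsub>B\<^esub> b"
      using cl.meet_left[of "\<phi> a" "\<phi> b"] cl.meet_right[of "\<phi> a" "\<phi> b"]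
      by (intro B.meet_le) (simp_all add: le')
    then show "\<phi> a \<sqinter>\<^bsub>B'\<^esub> \<phi> b \<sqsubseteq>\<^bsub>B'\<^esub> \<phi> (a \<sqinter>\<^bsub>B\<^esub> b)" by (simp add: le')
  qed simp_all
  have join: "\<phi> a \<squnion>\<^bsub>B'\<^esub> \<phi> b = \<phi> (a \<squnion>\<^bsub>B\<^esub> b)" if [simp]: "a \<in> carrier B" "b \<in> carrier B" for a b
  proof (rule po.le_antisym)
    show "\<phi> a \<squnion>\<^bsub>B'\<^esub> \<phi> b \<sqsubseteq>\<^bsub>B'\<^esub> \<phi> (a \<squnion>\<^bsub>B\<^esub> b)"
      by (intro cl.join_le) (simp_all add: le B.join_left B.join_right)
    have "a \<squnion>\<^bsub>B\<^esub> b \<sqsubseteq>\<^bsub>B\<^esub> \<psi> (\<phi> a \<squnion>\<^bsub>B'\<^esub> \<phi> b)"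
      using cl.join_left[of "\<phi> a" "\<phi> b"] cl.join_right[of "\<phi> a" "\<phi> b"]
      by (intro B.join_le) (simp_all add: le')
    then show "\<phi> (a \<squnion>\<^bsub>B\<^esub> b) \<sqsubseteq>\<^bsub>B'\<^esub> \<phi> a \<squnion>\<^bsub>B'\<^esub> \<phi> b" by (simp add: le')
  qed simp_all
  have bot: "\<bottom>\<^bsub>B'\<^esub> = \<phi> \<bottom>\<^bsub>B\<^esub>"
    by (rule po.le_antisym[OF cl.bottom_lower]) (simp_all add: le')
  have top: "\<top>\<^bsub>B'\<^esub> = \<phi> \<top>\<^bsub>B\<^esub>"
    by (rule po.le_antisym[OF _ cl.top_higher]) (simp_all add: le')
  have surj: "\<exists>a\<in>carrier B. x = \<phi> a" if "x \<in> carrier B'" for x using that \<phi>\<psi> \<psi> by metis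
  interpret cba: complete_boolean_algebra B'
  proof unfold_locales
    fix x y z assume "x \<in> carrier B'" "y \<in> carrier B'" "z \<in> carrier B'"
    then obtain a b c where "x = \<phi> a" "y = \<phi> b" "z = \<phi> c" "a \<in> carrier B" "b \<in> carrier B" "c \<in> carrier B"
      using surj by metis
    then show "x \<sqinter>\<^bsub>B'\<^esub> (y \<squnion>\<^bsub>B'\<^esub> z) = x \<sqinter>\<^bsub>B'\<^esub> y \<squnion>\<^bsub>B'\<^esub> x \<sqinter>\<^bsub>B'\<^esub> z"
      by (simp add: meet join B.meet_join_distrib)
  next
    fix x assume "x \<in> carrier B'"
    then obtain a where a: "x = \<phi> a" "a \<in> carrier B" using surj by metis
    then show "\<exists>c\<in>carrier B'. x \<sqinter>\<^bsub>B'\<^esub> c = \<bottom>\<^bsub>B'\<^esub> \<and> x \<squnion>\<^bsub>B'\<^esub> c = \<top>\<^bsub>B'\<^esub>"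
      by (intro bexI[of _ "\<phi> (cmpl B a)"]) (simp_all add: meet join bot top B.meet_cmpl B.join_cmpl)
  qed
  have cm: "cmpl B' (\<phi> a) = \<phi> (cmpl B a)" if "a \<in> carrier B" for a
    using that by (intro cba.cmpl_eqI) (simp_all add: meet join bot top B.meet_cmpl B.join_cmpl)
  interpret B': de_vries_algebra B'
  proof unfold_locales
    show "\<top>\<^bsub>B'\<^esub> \<prec>\<^bsub>B'\<^esub> \<top>\<^bsub>B'\<^esub>" by (simp add: top pr B.DV1)
  next
    fix x y assume "x \<in> carrier B'" "y \<in> carrier B'" "x \<prec>\<^bsub>B'\<^esub> y"
    then show "x \<sqsubseteq>\<^bsub>B'\<^esub> y" using B.DV2 by (simp add: le' pr')
  next
    fix a b c d assume "a \<in> carrier B'" "b \<in> carrier B'" "c \<in> carrier B'" "d \<in> carrier B'"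
      "a \<sqsubseteq>\<^bsub>B'\<^esub> b" "b \<prec>\<^bsub>B'\<^esub> c" "c \<sqsubseteq>\<^bsub>B'\<^esub> d"
    then show "a \<prec>\<^bsub>B'\<^esub> d" using B.DV3[of "\<psi> a" "\<psi> b" "\<psi> c" "\<psi> d"] by (simp add: le' pr')
  next
    fix x y z assume "x \<in> carrier B'" "y \<in> carrier B'" "z \<in> carrier B'" "x \<prec>\<^bsub>B'\<^esub> y" "x \<prec>\<^bsub>B'\<^esub> z"
    moreover from this obtain a b c where "x = \<phi> a" "y = \<phi> b" "z = \<phi> c" "a \<in> carrier B" "b \<in> carrier B" "c \<in> carrier B"
      using surj by metis
    ultimately show "x \<prec>\<^bsub>B'\<^esub> y \<sqinter>\<^bsub>B'\<^esub> z" by (simp add: meet pr B.DV4)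
  next
    fix x y assume "x \<in> carrier B'" "y \<in> carrier B'" "x \<prec>\<^bsub>B'\<^esub> y"
    moreover from this obtain a b where "x = \<phi> a" "y = \<phi> b" "a \<in> carrier B" "b \<in> carrier B"
      using surj by metis
    ultimately show "cmpl B' y \<prec>\<^bsub>B'\<^esub> cmpl B' x" by (simp add: cm pr B.DV5)
  next
    fix x y assume xy: "x \<in> carrier B'" "y \<in> carrier B'" "x \<prec>\<^bsub>B'\<^esub> y"
    then obtain c where "c \<in> carrier B" "\<psi> x \<prec>\<^bsub>B\<^esub> c" "c \<prec>\<^bsub>B\<^esub> \<psi> y"
      using B.DV6[of "\<psi> x" "\<psi> y"] by (auto simp: pr')
    then show "\<exists>c\<in>carrier B'. x \<prec>\<^bsub>B'\<^esub> c \<and> c \<prec>\<^bsub>B'\<^esub> y"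
      using xy by (intro bexI[of _ "\<phi> c"]) (simp_all add: pr')
  next
    fix x assume x: "x \<in> carrier B'" "x \<noteq> \<bottom>\<^bsub>B'\<^esub>"
    then have "\<psi> x \<noteq> \<bottom>\<^bsub>B\<^esub>" using \<phi>\<psi>[of x] x bot by metis
    then obtain b where b: "b \<in> carrier B" "b \<noteq> \<bottom>\<^bsub>B\<^esub>" "b \<prec>\<^bsub>B\<^esub> \<psi> x"
      using B.DV7[of "\<psi> x"] x by auto
    then have "\<phi> b \<noteq> \<bottom>\<^bsub>B'\<^esub>" using \<psi>\<phi>[of b] bot by (metis B.bottom_closed \<psi>\<phi>)
    then show "\<exists>b\<in>carrier B'. b \<noteq> \<bottom>\<^bsub>B'\<^esub> \<and> b \<prec>\<^bsub>B'\<^esub> x"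
      using b x by (intro bexI[of _ "\<phi> b"]) (simp_all add: pr')
  qed
  have lub_below: "is_lub B' (\<phi> a) {\<phi> b |b. b \<in> carrier B \<and> b \<prec>\<^bsub>B\<^esub> a}" if "a \<in> carrier B" for a
  proof -
    have "{\<phi> b |b. b \<in> carrier B \<and> b \<prec>\<^bsub>B\<^esub> a} = \<phi> ` {b. b \<in> carrier B \<and> b \<prec>\<^bsub>B\<^esub> a}" by auto
    then show ?thesis using lub[OF B.is_lub_prec[OF that]] by auto
  qed
  have lub_below': "is_lub B (\<psi> x) {\<psi> y |y. y \<in> carrier B' \<and> y \<prec>\<^bsub>B'\<^esub> x}" if "x \<in> carrier B'" for x
  proof -
    have "{\<psi> y |y. y \<in> carrier B' \<and> y \<prec>\<^bsub>B'\<^esub> x} = {b. b \<in> carrier B \<and> b \<prec>\<^bsub>B\<^esub> \<psi> x}"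
    proof (rule subset_antisym; rule subsetI)
      fix b assume "b \<in> {b. b \<in> carrier B \<and> b \<prec>\<^bsub>B\<^esub> \<psi> x}"
      then have "b = \<psi> (\<phi> b) \<and> \<phi> b \<in> carrier B' \<and> \<phi> b \<prec>\<^bsub>B'\<^esub> x" using that by (simp add: pr')
      then show "b \<in> {\<psi> y |y. y \<in> carrier B' \<and> y \<prec>\<^bsub>B'\<^esub> x}" by blast
    qed (use that in \<open>auto simp: pr'\<close>)
    then show ?thesis using B.is_lub_prec[of "\<psi> x"] that by simp
  qed
  have m: "de_vries_morphism B B' \<phi>"
  proof unfold_locales
    show "\<phi> \<in> carrier B \<rightarrow>\<^sub>E carrier B'" using ext by (simp add: PiE_iff)
  qed (simp_all add: bot meet cm pr lub_below)
  have m': "de_vries_morphism B' B \<psi>"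
  proof unfold_locales
    show "\<psi> \<in> carrier B' \<rightarrow>\<^sub>E carrier B" by (simp add: PiE_iff) (simp add: \<psi>_def)
    fix x y assume "x \<in> carrier B'" "y \<in> carrier B'"
    moreover from this obtain a b where "x = \<phi> a" "y = \<phi> b" "a \<in> carrier B" "b \<in> carrier B"
      using surj by metis
    ultimately show "\<psi> (x \<sqinter>\<^bsub>B'\<^esub> y) = \<psi> x \<sqinter>\<^bsub>B\<^esub> \<psi> y"
      "x \<prec>\<^bsub>B'\<^esub> y \<Longrightarrow> cmpl B (\<psi> (cmpl B' x)) \<prec>\<^bsub>B\<^esub> \<psi> y"
      by (simp_all add: meet cm pr)
  qed (simp_all add: bot lub_below')
  \<comment> \<open>The maps are inverse to each other pointwise, so the supremum runs over all
    \<open>b \<prec> a\<close> themselves and equals a by \<open>is_lub_prec\<close>.\<close>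
  have "dev_comp B B \<psi> \<phi> = (\<lambda>a \<in> carrier B. a)"
  proof (rule dev_comp_eqI[where X = "carrier B"])
    fix a assume a: "a \<in> carrier B"
    have "{\<psi> (\<phi> b) |b. b \<in> carrier B \<and> b \<prec>\<^bsub>B\<^esub> a} = {b. b \<in> carrier B \<and> b \<prec>\<^bsub>B\<^esub> a}"
      by (rule setcompr_fixed_points) simp
    then show "is_lub B ((\<lambda>a \<in> carrier B. a) a) {\<psi> (\<phi> b) |b. b \<in> carrier B \<and> b \<prec>\<^bsub>B\<^esub> a}"
      using B.is_lub_prec[OF a] a by simp
  qed (auto intro: B.de_vries_algebra_axioms)
  moreover have "dev_comp B' B' \<phi> \<psi> = (\<lambda>b \<in> carrier B'. b)"
  proof (rule dev_comp_eqI[where X = "carrier B'"])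
    fix a assume a: "a \<in> carrier B'"
    have "{\<phi> (\<psi> b) |b. b \<in> carrier B' \<and> b \<prec>\<^bsub>B'\<^esub> a} = {b. b \<in> carrier B' \<and> b \<prec>\<^bsub>B'\<^esub> a}"
      by (rule setcompr_fixed_points) simp
    then show "is_lub B' ((\<lambda>a \<in> carrier B'. a) a) {\<phi> (\<psi> b) |b. b \<in> carrier B' \<and> b \<prec>\<^bsub>B'\<^esub> a}"
      using B'.is_lub_prec[OF a] a by simp
  qed (auto intro: B'.de_vries_algebra_axioms)
  ultimately show ?thesis using m m' by (auto simp: de_vries_isomorphism_def)
qed

lemma reflexives_simps [simp]:
  "x \<otimes>\<^bsub>reflexives D\<^esub> y = x \<otimes>\<^bsub>D\<^esub> y" "x \<oplus>\<^bsub>reflexives D\<^esub> y = x \<oplus>\<^bsub>D\<^esub> y" "\<zero>\<^bsub>reflexives D\<^esub> = \<zero>\<^bsub>D\<^esub>"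
  by (simp_all add: reflexives_def)

section \<open>Idempotents of the Dedekind algebra against annihilator ideals of its reflexive
  elements\<close>

context proximity_dedekind_algebra
begin

lemma mem_annihilator:
  "a \<in> annihilator (reflexives D) S \<longleftrightarrow> a \<in> A \<and> (\<forall>s\<in>S. a \<otimes> s = \<zero>)"
  by (simp add: annihilator_def)

lemma mem_sigma:
  assumes "e \<in> carrier (Id_DeV D)"
  shows "a \<in> sigma D e \<longleftrightarrow> a \<in> A \<and> a \<otimes> e = a"
proof -
  have [simp]: "e \<in> carrier D" and ee: "e \<otimes> e = e" using assms by simp_all
  have "a \<in> PIdl\<^bsub>D\<^esub> e \<longleftrightarrow> a \<otimes> e = a" if "a \<in> carrier D" for a
    using that ee by (auto simp: cgenideal_def m_assoc) (metis m_assoc)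
  then show ?thesis using assms by (auto simp: sigma_def)
qed

text \<open>The point is that A has enough elements to test annihilation. If ae were nonzero, some
  nonzero reflexive c would lie below x = (ae)^2. Then e absorbs c, so ac = 0 and cx = 0, whence c^2
  \<le> cx = 0, which is impossible in a reduced ring.\<close>

lemma annihilator_sigma:
  assumes "e \<in> carrier (Id_DeV D)"
  shows "annihilator (reflexives D) (sigma D e) = sigma D (\<one> \<ominus> e)"
proof -
  have [simp]: "e \<in> carrier D" and ee: "e \<otimes> e = e" using assms by simp_all
  have ce: "\<one> \<ominus> e \<in> carrier (Id_DeV D)" using ee by (simp add: idem_compl)
  have iff: "a \<otimes> (\<one> \<ominus> e) = a \<longleftrightarrow> a \<otimes> e = \<zero>" if [simp]: "a \<in> carrier D" for a
  proof -
    have "a \<otimes> (\<one> \<ominus> (\<one> \<ominus> e)) = a \<otimes> e" by (simp add: ring_simps)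
    then show ?thesis using mult_compl_zero_iff[of a "\<one> \<ominus> e"] by simp
  qed
  have "a \<otimes> e = \<zero>" if a: "a \<in> A" and ann: "\<And>b. \<lbrakk>b \<in> A; b \<otimes> e = b\<rbrakk> \<Longrightarrow> a \<otimes> b = \<zero>" for a
  proof (rule ccontr)
    assume nz: "a \<otimes> e \<noteq> \<zero>"
    have [simp]: "a \<in> carrier D" using a by simp
    define x where "x = (a \<otimes> e) \<otimes> (a \<otimes> e)"
    have [simp]: "x \<in> carrier D" and "\<zero> \<preceq> x" "x \<noteq> \<zero>"
      using nz nilpotent_zero[of "a \<otimes> e"] by (auto simp: x_def square_nonneg)
    then obtain c where c: "c \<in> A" "\<zero> \<preceq> c" "c \<noteq> \<zero>" "c \<preceq> x" by (metis reflexive_below)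
    have [simp]: "c \<in> carrier D" using c by simp
    have xe: "x \<otimes> (\<one> \<ominus> e) = \<zero>" unfolding x_def using ee by (simp add: ring_simps mult_assoc_eq[OF ee])
    have "\<zero> \<preceq> \<one> \<ominus> e" using idem_le_one[OF ee] by (simp add: le_iff_diff[symmetric])
    then have "c \<otimes> (\<one> \<ominus> e) \<preceq> \<zero>" "\<zero> \<preceq> c \<otimes> (\<one> \<ominus> e)"
      using mult_right_mono[OF c(4), of "\<one> \<ominus> e"] c xe by (simp_all add: mult_nonneg)
    then have "c \<otimes> (\<one> \<ominus> e) = \<zero>" by (intro le_antisym) simp_all
    then have "a \<otimes> c = \<zero>" using c by (intro ann) (simp_all add: mult_compl_zero_iff)
    then have "c \<otimes> x = \<zero>" unfolding x_def by (simp add: m_assoc[symmetric] m_comm[of c a])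
    then have "c \<otimes> c \<preceq> \<zero>" using mult_left_mono[OF c(4,2)] by simp
    then have "c \<otimes> c = \<zero>" by (intro le_antisym) (simp_all add: square_nonneg)
    then show False using nilpotent_zero[of c] c by simp
  qed
  moreover have "a \<otimes> b = \<zero>" if "a \<otimes> e = \<zero>" "b \<otimes> e = b" and [simp]: "a \<in> carrier D" "b \<in> carrier D" for a b
  proof -
    have "a \<otimes> (b \<otimes> e) = b \<otimes> (a \<otimes> e)" by (rule m_lcomm) simp_all
    then show ?thesis using that by simp
  qed
  ultimately have "a \<in> annihilator (reflexives D) (sigma D e) \<longleftrightarrow> a \<in> sigma D (\<one> \<ominus> e)" for a
    unfolding mem_annihilator mem_sigma[OF ce] Ball_def mem_sigma[OF assms]
    using iff A_carrier by blast
  then show ?thesis by blast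
qed

text \<open>An annihilator taken inside A is the trace on A of the annihilator in D, which has an
  idempotent generator.\<close>

lemma sigma_surj:
  assumes S: "S \<subseteq> A"
  obtains e where "e \<in> carrier (Id_DeV D)" "sigma D e = annihilator (reflexives D) S"
proof -
  have S': "S \<subseteq> carrier D" using S A_carrier by blast
  obtain e where e: "e \<in> carrier D" "e \<otimes> e = e"
    "\<And>a. a \<in> carrier D \<Longrightarrow> a \<otimes> e = a \<longleftrightarrow> (\<forall>s\<in>S. a \<otimes> s = \<zero>)"
    by (rule annihilating_idempotent[OF S']) blast
  then have "sigma D e = annihilator (reflexives D) S"
    using e by (auto simp: mem_sigma mem_annihilator)
  then show thesis using e by (intro that[of e]) simp_all
qed

text \<open>For the direction from ideals to idempotents: if e is not below f, the nonzero
  idempotent e(1 - f) dominates a nonzero reflexive c, which is absorbed by e but killed by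
  f.\<close>

lemma sigma_le_iff:
  assumes "e \<in> carrier (Id_DeV D)" "f \<in> carrier (Id_DeV D)"
  shows "sigma D e \<subseteq> sigma D f \<longleftrightarrow> e \<sqsubseteq>\<^bsub>Id_DeV D\<^esub> f"
proof
  have [simp]: "e \<in> carrier D" "f \<in> carrier D" and ee: "e \<otimes> e = e" and ff: "f \<otimes> f = f"
    using assms by simp_all
  {
    assume "e \<sqsubseteq>\<^bsub>Id_DeV D\<^esub> f"
    then have "a \<otimes> f = a" if "a \<in> carrier D" "a \<otimes> e = a" for a using that m_assoc[of a e f] by simp
    then show "sigma D e \<subseteq> sigma D f" using assms by (auto simp: mem_sigma)
  }
  assume sub: "sigma D e \<subseteq> sigma D f"
  show "e \<sqsubseteq>\<^bsub>Id_DeV D\<^esub> f"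
  proof (rule ccontr)
    assume "\<not> e \<sqsubseteq>\<^bsub>Id_DeV D\<^esub> f"
    then have nz: "e \<otimes> (\<one> \<ominus> f) \<noteq> \<zero>" by (simp add: mult_compl_zero_iff)
    have idem: "(e \<otimes> (\<one> \<ominus> f)) \<otimes> (e \<otimes> (\<one> \<ominus> f)) = e \<otimes> (\<one> \<ominus> f)"
      using ee ff by (intro idem_mult idem_compl) simp_all
    then obtain c where c: "c \<in> A" "\<zero> \<preceq> c" "c \<noteq> \<zero>" "c \<preceq> e \<otimes> (\<one> \<ominus> f)"
      using nz by (metis reflexive_below idem_nonneg m_closed minus_closed one_closed \<open>e \<in> carrier D\<close> \<open>f \<in> carrier D\<close>)
    have [simp]: "c \<in> carrier D" using c by simp
    have cc: "c \<otimes> (e \<otimes> (\<one> \<ominus> f)) = c" using le_idem_mult[OF c(2,4) idem] by simp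
    have "(c \<otimes> (e \<otimes> (\<one> \<ominus> f))) \<otimes> e = c \<otimes> (e \<otimes> (\<one> \<ominus> f))" using ee by (simp add: ring_simps mult_assoc_eq[OF ee])
    then have "c \<otimes> e = c" by (simp add: cc)
    moreover have "(c \<otimes> (e \<otimes> (\<one> \<ominus> f))) \<otimes> f = \<zero>" using ff by (simp add: ring_simps)
    then have "c \<otimes> f = \<zero>" by (simp add: cc)
    ultimately show False using sub c assms by (auto simp: mem_sigma subset_eq)
  qed
qed

text \<open>Comaximality is a partition of unity 1 = x + y in A, with x vanishing on e and y
  supported in f; then y equals 1 on e and yields a reflexive element between e and f. Conversely, a
  reflexive c between e and f splits every a as a(1 - c) + ac.\<close>

lemma sigma_prec_iff:
  assumes "e \<in> carrier (Id_DeV D)" "f \<in> carrier (Id_DeV D)"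
  shows "annihilator (reflexives D) (sigma D e) <+>\<^bsub>reflexives D\<^esub> sigma D f = A \<longleftrightarrow> e \<lhd> f"
proof -
  have [simp]: "e \<in> carrier D" "f \<in> carrier D" and ee: "e \<otimes> e = e" and ff: "f \<otimes> f = f"
    using assms by simp_all
  have ce: "\<one> \<ominus> e \<in> carrier (Id_DeV D)" using ee by (simp add: idem_compl)
  have iff: "a \<otimes> (\<one> \<ominus> e) = a \<longleftrightarrow> a \<otimes> e = \<zero>" if [simp]: "a \<in> carrier D" for a
  proof -
    have "a \<otimes> (\<one> \<ominus> (\<one> \<ominus> e)) = a \<otimes> e" by (simp add: ring_simps)
    then show ?thesis using mult_compl_zero_iff[of a "\<one> \<ominus> e"] by simp
  qed
  let ?sum = "annihilator (reflexives D) (sigma D e) <+>\<^bsub>reflexives D\<^esub> sigma D f"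
  have sum: "a \<in> ?sum \<longleftrightarrow> (\<exists>x\<in>A. \<exists>y\<in>A. x \<otimes> e = \<zero> \<and> y \<otimes> f = y \<and> a = x \<oplus> y)" for a
  proof -
    have "a \<in> ?sum \<longleftrightarrow> (\<exists>x\<in>sigma D (\<one> \<ominus> e). \<exists>y\<in>sigma D f. a = x \<oplus> y)"
      by (simp only: annihilator_sigma[OF assms(1)]) (simp add: set_add_def set_mult_def)
    then show ?thesis
      unfolding Bex_def mem_sigma[OF ce] mem_sigma[OF assms(2)] using iff A_carrier by blast
  qed
  show ?thesis
  proof
    assume "?sum = A"
    then have "\<one> \<in> ?sum" by simp
    then obtain x y where x: "x \<in> A" "x \<otimes> e = \<zero>" and y: "y \<in> A" "y \<otimes> f = y" and xy: "\<one> = x \<oplus> y"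
      unfolding sum by auto
    have [simp]: "x \<in> carrier D" "y \<in> carrier D" using x y by simp_all
    have "y \<otimes> e = (x \<oplus> y) \<otimes> e \<ominus> x \<otimes> e" by (simp add: ring_simps)
    then have ye: "y \<otimes> e = e" using x by (simp flip: xy)
    \<comment> \<open>y need not lie in [0, 1]. Its square is nonnegative, cutting at 1 bounds it,
      and neither operation changes it where y is 0 or 1.\<close>
    define c where "c = (y \<otimes> y) \<curlywedge> \<one>"
    have cA: "c \<in> A" and [simp]: "c \<in> carrier D" using y by (simp_all add: c_def)
    have "(y \<otimes> y) \<otimes> e = e" using ye by (simp add: m_assoc)
    then have "e \<preceq> y \<otimes> y"
      using mult_left_mono[OF idem_le_one[OF ee], of "y \<otimes> y"] by (simp add: square_nonneg)
    then have "e \<preceq> c" unfolding c_def using idem_le_one[OF ee] by (intro wedge_greatest) simp_all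
    moreover have "c \<preceq> f"
    proof -
      have f': "\<zero> \<preceq> \<one> \<ominus> f" using idem_le_one[OF ff] by (simp add: le_iff_diff[symmetric])
      have c0: "\<zero> \<preceq> c" unfolding c_def by (intro wedge_greatest) (simp_all add: square_nonneg)
      have "y \<otimes> (\<one> \<ominus> f) = \<zero>" using y by (simp add: mult_compl_zero_iff)
      then have "(y \<otimes> y) \<otimes> (\<one> \<ominus> f) = \<zero>" by (simp add: m_assoc)
      moreover have "c \<preceq> y \<otimes> y" by (simp add: c_def wedge_le1)
      ultimately have "c \<otimes> (\<one> \<ominus> f) \<preceq> \<zero>" using mult_right_mono[of c "y \<otimes> y" "\<one> \<ominus> f"] f' by simp
      then have "c \<otimes> (\<one> \<ominus> f) = \<zero>" using mult_nonneg[OF _ _ c0 f'] by (intro le_antisym) simp_all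
      then have "c \<otimes> f = c" by (simp add: mult_compl_zero_iff)
      moreover have "c \<preceq> \<one>" by (simp add: c_def wedge_le2)
      ultimately show ?thesis using ff by - (rule mult_idem_le, simp_all)
    qed
    ultimately show "e \<lhd> f" using cA prox_iff[of e f] by auto
  next
    assume "e \<lhd> f"
    then obtain c where c: "c \<in> A" "e \<preceq> c" "c \<preceq> f" using prox_iff[of e f] by auto
    have [simp]: "c \<in> carrier D" using c by simp
    have c0: "\<zero> \<preceq> c" and c1: "c \<preceq> \<one>"
      using le_trans[OF idem_nonneg c(2)] le_trans[OF c(3) idem_le_one] ee ff by simp_all
    have cf: "c \<otimes> f = c" using le_idem_mult[OF c0 c(3) ff] by simp
    have ce: "c \<otimes> e = e"
    proof (rule le_antisym)
      show "c \<otimes> e \<preceq> e" using mult_right_mono[OF c1 idem_nonneg[OF ee]] by simp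
      show "e \<preceq> c \<otimes> e" using mult_right_mono[OF c(2) idem_nonneg[OF ee]] ee by simp
    qed simp_all
    have "a \<in> ?sum" if a: "a \<in> A" for a
    proof -
      have [simp]: "a \<in> carrier D" using a by simp
      have "(a \<otimes> (\<one> \<ominus> c)) \<otimes> e = a \<otimes> (e \<ominus> c \<otimes> e)" by (simp add: ring_simps)
      also have "\<dots> = \<zero>" by (simp add: ce minus_eq r_neg)
      finally have "(a \<otimes> (\<one> \<ominus> c)) \<otimes> e = \<zero>" .
      moreover have "(a \<otimes> c) \<otimes> f = a \<otimes> c" by (simp add: m_assoc cf)
      moreover have "a = a \<otimes> (\<one> \<ominus> c) \<oplus> a \<otimes> c" by (simp add: ring_simps)
      ultimately show ?thesis unfolding sum using a c A_mult A_diff A_one by metis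
    qed
    then show "?sum = A" using sum by auto
  qed
qed

lemma sigma_isomorphism: "de_vries_isomorphism (Id_DeV D) (Ann_DeV (reflexives D)) (sigma D)"
proof (rule de_vries_transport[OF de_vries_algebra_Id])
  show "bij_betw (sigma D) (carrier (Id_DeV D)) (carrier (Ann_DeV (reflexives D)))"
  proof (rule bij_betw_imageI)
    show "inj_on (sigma D) (carrier (Id_DeV D))"
    proof (rule inj_onI)
      fix e f assume ef: "e \<in> carrier (Id_DeV D)" "f \<in> carrier (Id_DeV D)" and "sigma D e = sigma D f"
      then have "e \<otimes> f = e" "f \<otimes> e = f" using sigma_le_iff[of e f] sigma_le_iff[of f e] by simp_all
      then show "e = f" using ef by (simp add: m_comm)
    qed
    have "sigma D e \<in> carrier (Ann_DeV (reflexives D))" if e: "e \<in> carrier (Id_DeV D)" for e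
    proof -
      have [simp]: "e \<in> carrier D" using e by simp
      have ce: "\<one> \<ominus> e \<in> carrier (Id_DeV D)" using e by (simp add: idem_compl)
      have ee: "\<one> \<ominus> (\<one> \<ominus> e) = e" by (simp add: ring_simps)
      have "sigma D e = annihilator (reflexives D) (sigma D (\<one> \<ominus> e))"
        by (simp only: annihilator_sigma[OF ce] ee)
      moreover have "sigma D (\<one> \<ominus> e) \<subseteq> A" using mem_sigma[OF ce] by auto
      ultimately show ?thesis by (auto simp: Ann_DeV_def)
    qed
    moreover have "I \<in> sigma D ` carrier (Id_DeV D)" if "I \<in> carrier (Ann_DeV (reflexives D))" for I
      using that sigma_surj by (auto simp: Ann_DeV_def simp del: Id_simps) (metis image_eqI)
    ultimately show "sigma D ` carrier (Id_DeV D) = carrier (Ann_DeV (reflexives D))" by blast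
  qed
  show "sigma D \<in> extensional (carrier (Id_DeV D))" by (simp add: sigma_def)
qed (simp_all add: Ann_DeV_def sigma_le_iff sigma_prec_iff del: Id_simps(1,3))

end

section \<open>Proximity morphisms and homomorphisms of reflexive elements\<close>

context proximity_dedekind_algebra
begin

text \<open>Real multiples of the unit are reflexive. This bound and the next make the sets whose
  suprema define \<open>extension\<close> nonempty and bounded above.\<close>

lemma reflexive_lower_bound:
  assumes "a \<in> carrier D"
  obtains c where "c \<in> A" "c \<preceq> a"
proof -
  obtain r where r: "\<ominus> a \<preceq> r \<odot> \<one>" by (rule le_of_real[of "\<ominus> a"]) (use assms in simp)
  then have "\<ominus> (r \<odot> \<one>) \<preceq> a" using minus_le_iff[of "r \<odot> \<one>" "\<ominus> a"] assms by simp
  then show thesis by (intro that[of "\<ominus> (r \<odot> \<one>)"]) simp_all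
qed

lemma reflexive_upper_bound:
  assumes "a \<in> carrier D"
  obtains c where "c \<in> A" "a \<preceq> c"
proof -
  obtain r where "a \<preceq> r \<odot> \<one>" by (rule le_of_real[OF assms])
  then show thesis by (intro that[of "r \<odot> \<one>"]) simp_all
qed

text \<open>If \<open>u\<close> bounds the reflexive elements below \<open>b\<close> and \<open>0 < c \<le> (b - u)\<^sup>+\<close> with \<open>c\<close> reflexive, then
  adding \<open>c\<close> to a reflexive element below \<open>b\<close> gives another one, against the archimedean property.\<close>

lemma lub_reflexives_below:
  assumes b [simp]: "b \<in> carrier D"
  shows "lub b {c. c \<in> A \<and> c \<preceq> b}"
proof -
  have "b \<preceq> u" if [simp]: "u \<in> carrier D" and ub: "\<And>c. \<lbrakk>c \<in> A; c \<preceq> b\<rbrakk> \<Longrightarrow> c \<preceq> u" for u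
  proof (rule ccontr)
    assume nle: "\<not> b \<preceq> u"
    define x where "x = (b \<ominus> u) \<curlyvee> \<zero>"
    have [simp]: "x \<in> carrier D" and "\<zero> \<preceq> x" "b \<ominus> u \<preceq> x" by (simp_all add: x_def vee_ge1 vee_ge2)
    moreover from this have "x \<noteq> \<zero>" using nle diff_le_iff[of b u \<zero>] by auto
    ultimately obtain c where c: "c \<in> A" "\<zero> \<preceq> c" "c \<noteq> \<zero>" "c \<preceq> x" by (metis reflexive_below)
    have [simp]: "c \<in> carrier D" using c by simp
    have step: "d \<oplus> c \<preceq> b" if "d \<in> A" "d \<preceq> b" for d
    proof -
      have [simp]: "d \<in> carrier D" using that by simp
      have "(b \<ominus> d) \<ominus> (b \<ominus> u) = u \<ominus> d" by (simp add: ring_simps)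
      then have "b \<ominus> u \<preceq> b \<ominus> d"
        using ub[OF that] by (simp add: le_iff_diff[of d] le_iff_diff[of _ "b \<ominus> d"])
      moreover have "\<zero> \<preceq> b \<ominus> d" using that by (simp add: le_iff_diff[symmetric])
      ultimately have "x \<preceq> b \<ominus> d" unfolding x_def by (intro vee_least) simp_all
      then have "c \<preceq> b \<ominus> d" using c le_trans[of c x "b \<ominus> d"] by simp
      moreover have "b \<ominus> (d \<oplus> c) = (b \<ominus> d) \<ominus> c" by (simp add: ring_simps)
      ultimately show ?thesis by (simp add: le_iff_diff[of c] le_iff_diff[of _ b])
    qed
    obtain d where d: "d \<in> A" "d \<preceq> b" by (rule reflexive_lower_bound[OF b])
    have [simp]: "d \<in> carrier D" using d by simp
    have iter: "real n \<odot> c \<oplus> d \<in> A \<and> real n \<odot> c \<oplus> d \<preceq> b" for n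
    proof (induction n)
      case 0
      then show ?case using d by simp
    next
      case (Suc n)
      have "real (Suc n) \<odot> c = real n \<odot> c \<oplus> c" using smult_add_left[of c "real n" 1] by (simp add: add.commute)
      moreover have "(y \<oplus> c) \<oplus> d = (y \<oplus> d) \<oplus> c" if "y \<in> carrier D" for y
        by (simp add: ring_simps that)
      ultimately show ?case using step Suc c by simp
    qed
    have "c \<preceq> \<zero>"
    proof (rule archimedean[of c "b \<ominus> d"])
      fix n :: nat
      have "(real n \<odot> c \<oplus> d) \<ominus> d \<preceq> b \<ominus> d"
      proof -
        have "(b \<ominus> d) \<ominus> (y \<ominus> d) = b \<ominus> y" if "y \<in> carrier D" for y by (simp add: ring_simps that)
        then show ?thesis
          using iter[of n] by (simp add: le_iff_diff[of _ b] le_iff_diff[of _ "b \<ominus> d"])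
      qed
      moreover have "(y \<oplus> d) \<ominus> d = y" if "y \<in> carrier D" for y by (simp add: ring_simps that)
      ultimately show "[n] \<cdot> c \<preceq> b \<ominus> d" by (simp add: add_pow_eq_smult)
    qed simp_all
    then show False using c le_antisym[of c \<zero>] by simp
  qed
  moreover have "{c. c \<in> A \<and> c \<preceq> b} \<subseteq> carrier D" by auto
  ultimately show ?thesis by (simp add: lub_iff)
qed

end

text \<open>The conditions are what (PM1) to (PM8) give on A, with the positivity restrictions on
  scalars and multipliers kept, so that proximity morphisms are direct instances. Only values on A
  are constrained; identities and composites of maps therefore qualify without being
  restricted.\<close>

locale reflexive_hom =
  D: proximity_dedekind_algebra D + D': proximity_dedekind_algebra D'
  for D :: "('a, 'm) pda_scheme" and D' :: "('b, 'n) pda_scheme" and h :: "'a \<Rightarrow> 'b" +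
  assumes hom_closed: "c \<in> D.A \<Longrightarrow> h c \<in> D'.A"
    and hom_one: "h \<one>\<^bsub>D\<^esub> = \<one>\<^bsub>D'\<^esub>"
    and hom_add: "\<lbrakk>c \<in> D.A; d \<in> D.A\<rbrakk> \<Longrightarrow> h (c \<oplus>\<^bsub>D\<^esub> d) = h c \<oplus>\<^bsub>D'\<^esub> h d"
    and hom_wedge: "\<lbrakk>c \<in> D.A; d \<in> D.A\<rbrakk> \<Longrightarrow> h (c \<sqinter>\<^bsub>ord_of D\<^esub> d) = h c \<sqinter>\<^bsub>ord_of D'\<^esub> h d"
    and hom_smult: "\<lbrakk>c \<in> D.A; 0 < r\<rbrakk> \<Longrightarrow> h (r \<odot>\<^bsub>D\<^esub> c) = r \<odot>\<^bsub>D'\<^esub> h c"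
    and hom_mult: "\<lbrakk>c \<in> D.A; \<zero>\<^bsub>D\<^esub> \<preceq>\<^bsub>D\<^esub> c; d \<in> D.A\<rbrakk> \<Longrightarrow> h (c \<otimes>\<^bsub>D\<^esub> d) = h c \<otimes>\<^bsub>D'\<^esub> h d"
begin

definition extension :: "'a \<Rightarrow> 'b" where
  "extension = (\<lambda>a \<in> carrier D. \<Squnion>\<^bsub>ord_of D'\<^esub> {h c | c. c \<in> D.A \<and> c \<preceq>\<^bsub>D\<^esub> a})"

lemma hom_carrier [simp]: "c \<in> D.A \<Longrightarrow> h c \<in> carrier D'"
  using hom_closed by simp

lemma hom_mono:
  assumes c: "c \<in> D.A" and d: "d \<in> D.A" and le: "c \<preceq>\<^bsub>D\<^esub> d"
  shows "h c \<preceq>\<^bsub>D'\<^esub> h d"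
proof -
  have "h c = h c \<sqinter>\<^bsub>ord_of D'\<^esub> h d" using hom_wedge[OF c d] D.wedge_absorb[OF le] c d by simp
  then show ?thesis using D'.wedge_le2[of "h c" "h d"] c d by simp
qed

lemma hom_zero: "h \<zero>\<^bsub>D\<^esub> = \<zero>\<^bsub>D'\<^esub>"
  using hom_add[of "\<zero>\<^bsub>D\<^esub>" "\<zero>\<^bsub>D\<^esub>"] by simp

lemma hom_minus:
  assumes c: "c \<in> D.A"
  shows "h (\<ominus>\<^bsub>D\<^esub> c) = \<ominus>\<^bsub>D'\<^esub> h c"
proof -
  have "h (\<ominus>\<^bsub>D\<^esub> c) \<oplus>\<^bsub>D'\<^esub> h c = \<zero>\<^bsub>D'\<^esub>"
    using hom_add[of "\<ominus>\<^bsub>D\<^esub> c" c] c by (simp add: D.l_neg hom_zero)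
  then show ?thesis using D'.minus_equality[of "h (\<ominus>\<^bsub>D\<^esub> c)" "h c"] c by simp
qed

lemma extension_lub:
  assumes a: "a \<in> carrier D"
  shows "D'.lub (extension a) {h c | c. c \<in> D.A \<and> c \<preceq>\<^bsub>D\<^esub> a}"
proof -
  let ?H = "{h c | c. c \<in> D.A \<and> c \<preceq>\<^bsub>D\<^esub> a}"
  obtain l where l: "l \<in> D.A" "l \<preceq>\<^bsub>D\<^esub> a" by (rule D.reflexive_lower_bound[OF a])
  obtain u where u: "u \<in> D.A" "a \<preceq>\<^bsub>D\<^esub> u" by (rule D.reflexive_upper_bound[OF a])
  have "x \<preceq>\<^bsub>D'\<^esub> h u" if "x \<in> ?H" for x
    using that u a D.le_trans[of _ a u] by (auto intro!: hom_mono)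
  then obtain s where s: "D'.lub s ?H"
    using l u by (elim D'.lub_exists[of ?H "h u", rotated -1]) auto
  then show ?thesis using D'.ord.is_lub_sup_eq[OF s] a by (simp add: extension_def)
qed

lemma extension_closed [simp]: "a \<in> carrier D \<Longrightarrow> extension a \<in> carrier D'"
  using least_closed[OF extension_lub[of a]] by simp

lemma extension_le_iff:
  assumes "a \<in> carrier D" "u \<in> carrier D'"
  shows "extension a \<preceq>\<^bsub>D'\<^esub> u \<longleftrightarrow> (\<forall>c\<in>D.A. c \<preceq>\<^bsub>D\<^esub> a \<longrightarrow> h c \<preceq>\<^bsub>D'\<^esub> u)"
proof -
  have "{h c | c. c \<in> D.A \<and> c \<preceq>\<^bsub>D\<^esub> a} \<subseteq> carrier D'" by auto
  then have "\<forall>x\<in>{h c | c. c \<in> D.A \<and> c \<preceq>\<^bsub>D\<^esub> a}. x \<preceq>\<^bsub>D'\<^esub> extension a"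
    "(\<forall>x\<in>{h c | c. c \<in> D.A \<and> c \<preceq>\<^bsub>D\<^esub> a}. x \<preceq>\<^bsub>D'\<^esub> u) \<longrightarrow> extension a \<preceq>\<^bsub>D'\<^esub> u"
    using extension_lub[OF assms(1)] assms(2) by (simp_all only: D'.lub_iff) blast+
  then show ?thesis using assms D'.le_trans[of _ "extension a" u] hom_carrier extension_closed by blast
qed

lemma le_extension: "\<lbrakk>c \<in> D.A; c \<preceq>\<^bsub>D\<^esub> a; a \<in> carrier D\<rbrakk> \<Longrightarrow> h c \<preceq>\<^bsub>D'\<^esub> extension a"
  using extension_le_iff[of a "extension a"] by simp

lemma extension_reflexive: "c \<in> D.A \<Longrightarrow> extension c = h c"
  by (rule D'.le_antisym) (auto simp: extension_le_iff intro: hom_mono le_extension)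

lemma extension_mono:
  assumes "a \<preceq>\<^bsub>D\<^esub> b" "a \<in> carrier D" "b \<in> carrier D"
  shows "extension a \<preceq>\<^bsub>D'\<^esub> extension b"
  using assms D.le_trans[of _ a b] by (auto simp: extension_le_iff intro: le_extension)

text \<open>Equality fails to follow because a reflexive element below a + b need not split into
  reflexive elements below a and b. The other inequality is recovered when one summand c is
  reflexive, in \<open>extension_add\<close>, by superadditivity for a + c and -c.\<close>

lemma extension_superadditive:
  assumes [simp]: "a \<in> carrier D" "b \<in> carrier D"
  shows "extension a \<oplus>\<^bsub>D'\<^esub> extension b \<preceq>\<^bsub>D'\<^esub> extension (a \<oplus>\<^bsub>D\<^esub> b)"
proof (rule D'.lub_add_le[OF extension_lub extension_lub])
  fix x y assume "x \<in> {h c |c. c \<in> D.A \<and> c \<preceq>\<^bsub>D\<^esub> a}" "y \<in> {h c |c. c \<in> D.A \<and> c \<preceq>\<^bsub>D\<^esub> b}"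
  then obtain c d where "x = h c" "y = h d" "c \<in> D.A" "d \<in> D.A" "c \<preceq>\<^bsub>D\<^esub> a" "d \<preceq>\<^bsub>D\<^esub> b" by auto
  then show "x \<oplus>\<^bsub>D'\<^esub> y \<preceq>\<^bsub>D'\<^esub> extension (a \<oplus>\<^bsub>D\<^esub> b)"
    using le_extension[of "c \<oplus>\<^bsub>D\<^esub> d" "a \<oplus>\<^bsub>D\<^esub> b"] D.add_le_mono[of c a d b] by (simp add: hom_add)
qed auto

lemma extension_add:
  assumes [simp]: "a \<in> carrier D" and c: "c \<in> D.A"
  shows "extension (a \<oplus>\<^bsub>D\<^esub> c) = extension a \<oplus>\<^bsub>D'\<^esub> h c"
proof (rule D'.le_antisym)
  have [simp]: "c \<in> carrier D" using c by simp
  show "extension a \<oplus>\<^bsub>D'\<^esub> h c \<preceq>\<^bsub>D'\<^esub> extension (a \<oplus>\<^bsub>D\<^esub> c)"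
    using extension_superadditive[of a c] c by (simp add: extension_reflexive)
  have "(a \<oplus>\<^bsub>D\<^esub> c) \<oplus>\<^bsub>D\<^esub> (\<ominus>\<^bsub>D\<^esub> c) = a" by (simp add: D.a_assoc D.r_neg)
  then have "extension (a \<oplus>\<^bsub>D\<^esub> c) \<ominus>\<^bsub>D'\<^esub> h c \<preceq>\<^bsub>D'\<^esub> extension a"
    using extension_superadditive[of "a \<oplus>\<^bsub>D\<^esub> c" "\<ominus>\<^bsub>D\<^esub> c"] c
    by (simp add: extension_reflexive hom_minus D'.minus_eq)
  then show "extension (a \<oplus>\<^bsub>D\<^esub> c) \<preceq>\<^bsub>D'\<^esub> extension a \<oplus>\<^bsub>D'\<^esub> h c"
    using c by (simp add: D'.diff_le_iff D'.a_comm)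
qed (use c in simp_all)

lemma extension_wedge:
  assumes [simp]: "a \<in> carrier D" "b \<in> carrier D"
  shows "extension (a \<sqinter>\<^bsub>ord_of D\<^esub> b) = extension a \<sqinter>\<^bsub>ord_of D'\<^esub> extension b"
proof (rule D'.le_antisym)
  show "extension (a \<sqinter>\<^bsub>ord_of D\<^esub> b) \<preceq>\<^bsub>D'\<^esub> extension a \<sqinter>\<^bsub>ord_of D'\<^esub> extension b"
    by (intro D'.wedge_greatest extension_mono) (simp_all add: D.wedge_le1 D.wedge_le2)
  show "extension a \<sqinter>\<^bsub>ord_of D'\<^esub> extension b \<preceq>\<^bsub>D'\<^esub> extension (a \<sqinter>\<^bsub>ord_of D\<^esub> b)"
  proof (rule D'.lub_wedge_le[OF extension_lub extension_lub])
    fix x y assume "x \<in> {h c |c. c \<in> D.A \<and> c \<preceq>\<^bsub>D\<^esub> a}" "y \<in> {h c |c. c \<in> D.A \<and> c \<preceq>\<^bsub>D\<^esub> b}"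
    then obtain c d where xy: "x = h c" "y = h d" and c: "c \<in> D.A" "c \<preceq>\<^bsub>D\<^esub> a" and d: "d \<in> D.A" "d \<preceq>\<^bsub>D\<^esub> b" by auto
    have "c \<sqinter>\<^bsub>ord_of D\<^esub> d \<preceq>\<^bsub>D\<^esub> a \<sqinter>\<^bsub>ord_of D\<^esub> b"
      using D.le_trans[OF D.wedge_le1 c(2), of d] D.le_trans[OF D.wedge_le2 d(2), of c] c d
      by (intro D.wedge_greatest) simp_all
    then show "x \<sqinter>\<^bsub>ord_of D'\<^esub> y \<preceq>\<^bsub>D'\<^esub> extension (a \<sqinter>\<^bsub>ord_of D\<^esub> b)"
      using le_extension[of "c \<sqinter>\<^bsub>ord_of D\<^esub> d"] c d by (simp add: hom_wedge xy)
  qed auto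
qed simp_all

text \<open>Joins are reached through meets: superadditivity for the join and the meet of a and c,
  whose sum is a + c, gives an inequality between sums with the same meet term, which
  cancels.\<close>

lemma extension_vee:
  assumes [simp]: "a \<in> carrier D" and c: "c \<in> D.A"
  shows "extension (a \<squnion>\<^bsub>ord_of D\<^esub> c) = extension a \<squnion>\<^bsub>ord_of D'\<^esub> h c"
proof (rule D'.le_antisym)
  have [simp]: "c \<in> carrier D" "h c \<in> carrier D'" using c by simp_all
  show "extension a \<squnion>\<^bsub>ord_of D'\<^esub> h c \<preceq>\<^bsub>D'\<^esub> extension (a \<squnion>\<^bsub>ord_of D\<^esub> c)"
    using c by (intro D'.vee_least extension_mono le_extension) (simp_all add: D.vee_ge1 D.vee_ge2)
  let ?j = "extension a \<squnion>\<^bsub>ord_of D'\<^esub> h c" and ?m = "extension a \<sqinter>\<^bsub>ord_of D'\<^esub> h c"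
  have "extension (a \<squnion>\<^bsub>ord_of D\<^esub> c) \<oplus>\<^bsub>D'\<^esub> ?m \<preceq>\<^bsub>D'\<^esub> ?j \<oplus>\<^bsub>D'\<^esub> ?m"
    using extension_superadditive[of "a \<squnion>\<^bsub>ord_of D\<^esub> c" "a \<sqinter>\<^bsub>ord_of D\<^esub> c"] c
    by (simp add: D.vee_add_wedge D'.vee_add_wedge extension_wedge extension_add extension_reflexive)
  moreover have "(y \<oplus>\<^bsub>D'\<^esub> m) \<ominus>\<^bsub>D'\<^esub> (x \<oplus>\<^bsub>D'\<^esub> m) = y \<ominus>\<^bsub>D'\<^esub> x"
    if "x \<in> carrier D'" "y \<in> carrier D'" "m \<in> carrier D'" for x y m
    by (simp add: D'.ring_simps that)
  ultimately show "extension (a \<squnion>\<^bsub>ord_of D\<^esub> c) \<preceq>\<^bsub>D'\<^esub> ?j"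
    by (simp add: D'.le_iff_diff[of _ ?j] D'.le_iff_diff[of _ "?j \<oplus>\<^bsub>D'\<^esub> ?m"])
qed (use c in simp_all)

text \<open>One inequality for all positive scalars is enough: used with 1/r at the point ra, it
  becomes the reverse inequality for r.\<close>

lemma extension_smult:
  assumes [simp]: "a \<in> carrier D" and r: "0 < r"
  shows "extension (r \<odot>\<^bsub>D\<^esub> a) = r \<odot>\<^bsub>D'\<^esub> extension a"
proof -
  have *: "extension (s \<odot>\<^bsub>D\<^esub> x) \<preceq>\<^bsub>D'\<^esub> s \<odot>\<^bsub>D'\<^esub> extension x" if [simp]: "x \<in> carrier D" and s: "0 < s" for s x
  proof (subst extension_le_iff; (intro ballI impI)?)
    fix c assume c: "c \<in> D.A" "c \<preceq>\<^bsub>D\<^esub> s \<odot>\<^bsub>D\<^esub> x"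
    then have "(1 / s) \<odot>\<^bsub>D\<^esub> c \<preceq>\<^bsub>D\<^esub> x" using s by (simp add: D.smult_le_iff)
    then have "(1 / s) \<odot>\<^bsub>D'\<^esub> h c \<preceq>\<^bsub>D'\<^esub> extension x"
      using le_extension[of "(1 / s) \<odot>\<^bsub>D\<^esub> c" x] c s by (simp add: hom_smult)
    then show "h c \<preceq>\<^bsub>D'\<^esub> s \<odot>\<^bsub>D'\<^esub> extension x" using s c by (simp add: D'.smult_le_iff)
  qed simp_all
  have "extension a \<preceq>\<^bsub>D'\<^esub> (1 / r) \<odot>\<^bsub>D'\<^esub> extension (r \<odot>\<^bsub>D\<^esub> a)"
    using *[of "r \<odot>\<^bsub>D\<^esub> a" "1 / r"] r by (simp add: D.smult_smult)
  then have "r \<odot>\<^bsub>D'\<^esub> extension a \<preceq>\<^bsub>D'\<^esub> extension (r \<odot>\<^bsub>D\<^esub> a)" using r by (simp add: D'.smult_le_iff)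
  then show ?thesis using *[of a r] r by (intro D'.le_antisym) simp_all
qed

lemma extension_mult_ge:
  assumes [simp]: "a \<in> carrier D" and c: "c \<in> D.A" "\<zero>\<^bsub>D\<^esub> \<preceq>\<^bsub>D\<^esub> c"
  shows "h c \<otimes>\<^bsub>D'\<^esub> extension a \<preceq>\<^bsub>D'\<^esub> extension (c \<otimes>\<^bsub>D\<^esub> a)"
proof (rule D'.lub_mult_le[OF extension_lub])
  fix x assume "x \<in> {h c |c. c \<in> D.A \<and> c \<preceq>\<^bsub>D\<^esub> a}"
  then obtain d where d: "x = h d" "d \<in> D.A" "d \<preceq>\<^bsub>D\<^esub> a" by auto
  then show "h c \<otimes>\<^bsub>D'\<^esub> x \<preceq>\<^bsub>D'\<^esub> extension (c \<otimes>\<^bsub>D\<^esub> a)"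
    using le_extension[of "c \<otimes>\<^bsub>D\<^esub> d" "c \<otimes>\<^bsub>D\<^esub> a"] D.mult_left_mono[of d a c] c by (simp add: hom_mult)
qed (use c hom_mono[of "\<zero>\<^bsub>D\<^esub>" c] in \<open>auto simp: hom_zero\<close>)

text \<open>For \<open>0 \<le> c \<le> 1\<close> both summands of \<open>a = ca + (1 - c)a\<close> satisfy the easy inequality, and by
  superadditivity both inequalities must be equalities.\<close>

lemma extension_mult:
  assumes [simp]: "a \<in> carrier D" and c: "c \<in> D.A" "\<zero>\<^bsub>D\<^esub> \<preceq>\<^bsub>D\<^esub> c"
  shows "extension (c \<otimes>\<^bsub>D\<^esub> a) = h c \<otimes>\<^bsub>D'\<^esub> extension a"
proof -
  have *: "extension (c \<otimes>\<^bsub>D\<^esub> a) = h c \<otimes>\<^bsub>D'\<^esub> extension a"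
    if c: "c \<in> D.A" "\<zero>\<^bsub>D\<^esub> \<preceq>\<^bsub>D\<^esub> c" "c \<preceq>\<^bsub>D\<^esub> \<one>\<^bsub>D\<^esub>" for c
  proof (rule D'.le_antisym)
    have [simp]: "c \<in> carrier D" "h c \<in> carrier D'" using c by simp_all
    let ?c' = "\<one>\<^bsub>D\<^esub> \<ominus>\<^bsub>D\<^esub> c"
    have c': "?c' \<in> D.A" "\<zero>\<^bsub>D\<^esub> \<preceq>\<^bsub>D\<^esub> ?c'" using c by (simp_all add: D.le_iff_diff[symmetric])
    have hc': "h ?c' = \<one>\<^bsub>D'\<^esub> \<ominus>\<^bsub>D'\<^esub> h c"
      using c hom_add[of "\<one>\<^bsub>D\<^esub>" "\<ominus>\<^bsub>D\<^esub> c"] by (simp add: D.minus_eq D'.minus_eq hom_one hom_minus)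
    have "c \<otimes>\<^bsub>D\<^esub> a \<oplus>\<^bsub>D\<^esub> ?c' \<otimes>\<^bsub>D\<^esub> a = a" by (simp add: D.ring_simps)
    then have "extension (c \<otimes>\<^bsub>D\<^esub> a) \<oplus>\<^bsub>D'\<^esub> extension (?c' \<otimes>\<^bsub>D\<^esub> a) \<preceq>\<^bsub>D'\<^esub> extension a"
      using extension_superadditive[of "c \<otimes>\<^bsub>D\<^esub> a" "?c' \<otimes>\<^bsub>D\<^esub> a"] by simp
    moreover have "extension (c \<otimes>\<^bsub>D\<^esub> a) \<oplus>\<^bsub>D'\<^esub> (\<one>\<^bsub>D'\<^esub> \<ominus>\<^bsub>D'\<^esub> h c) \<otimes>\<^bsub>D'\<^esub> extension a \<preceq>\<^bsub>D'\<^esub>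
        extension (c \<otimes>\<^bsub>D\<^esub> a) \<oplus>\<^bsub>D'\<^esub> extension (?c' \<otimes>\<^bsub>D\<^esub> a)"
      using extension_mult_ge[OF _ c', of a] by (intro D'.add_le_mono) (simp_all add: hc')
    ultimately have "extension (c \<otimes>\<^bsub>D\<^esub> a) \<oplus>\<^bsub>D'\<^esub> (\<one>\<^bsub>D'\<^esub> \<ominus>\<^bsub>D'\<^esub> h c) \<otimes>\<^bsub>D'\<^esub> extension a \<preceq>\<^bsub>D'\<^esub> extension a"
      using D'.le_trans by simp
    moreover have "y \<ominus>\<^bsub>D'\<^esub> (x \<oplus>\<^bsub>D'\<^esub> (\<one>\<^bsub>D'\<^esub> \<ominus>\<^bsub>D'\<^esub> z) \<otimes>\<^bsub>D'\<^esub> y) = z \<otimes>\<^bsub>D'\<^esub> y \<ominus>\<^bsub>D'\<^esub> x"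
      if "x \<in> carrier D'" "y \<in> carrier D'" "z \<in> carrier D'" for x y z
      by (simp add: D'.ring_simps that)
    ultimately show "extension (c \<otimes>\<^bsub>D\<^esub> a) \<preceq>\<^bsub>D'\<^esub> h c \<otimes>\<^bsub>D'\<^esub> extension a"
      by (simp add: D'.le_iff_diff[of _ "extension a"] D'.le_iff_diff[of _ "h c \<otimes>\<^bsub>D'\<^esub> extension a"])
    show "h c \<otimes>\<^bsub>D'\<^esub> extension a \<preceq>\<^bsub>D'\<^esub> extension (c \<otimes>\<^bsub>D\<^esub> a)" using c by (intro extension_mult_ge) simp_all
  qed (use c in simp_all)
  have [simp]: "c \<in> carrier D" "h c \<in> carrier D'" using c by simp_all
  \<comment> \<open>Division by r brings an arbitrary nonnegative c into the case \<open>*\<close>;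
    positive scalars are then pulled out on both sides.\<close>
  obtain r where r: "0 < r" "c \<preceq>\<^bsub>D\<^esub> r \<odot>\<^bsub>D\<^esub> \<one>\<^bsub>D\<^esub>" by (rule D.le_of_real[of c]) simp
  let ?d = "(1 / r) \<odot>\<^bsub>D\<^esub> c"
  have "?d \<preceq>\<^bsub>D\<^esub> \<one>\<^bsub>D\<^esub>" using r by (simp add: D.smult_le_iff)
  then have d: "extension (?d \<otimes>\<^bsub>D\<^esub> a) = h ?d \<otimes>\<^bsub>D'\<^esub> extension a"
    using c r by (intro *) (simp_all add: D.smult_nonneg)
  have "extension (c \<otimes>\<^bsub>D\<^esub> a) = extension (r \<odot>\<^bsub>D\<^esub> (?d \<otimes>\<^bsub>D\<^esub> a))"
    using r by (simp add: D.smult_mult_left D.smult_smult)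
  also have "\<dots> = r \<odot>\<^bsub>D'\<^esub> (h ?d \<otimes>\<^bsub>D'\<^esub> extension a)" using r d by (simp add: extension_smult)
  also have "\<dots> = h c \<otimes>\<^bsub>D'\<^esub> extension a"
    using r c by (simp add: hom_smult D'.smult_mult_left D'.smult_smult)
  finally show ?thesis .
qed

text \<open>For (PM3), a reflexive c between a and b gives a reflexive value \<open>h c\<close>
  between -\<open>extension\<close>(-a) and \<open>extension b\<close>. For (PM4), the reflexive
  elements below b already exhaust the supremum.\<close>

lemma extension_morphism: "proximity_morphism D D' extension"
proof unfold_locales
  show "extension \<in> carrier D \<rightarrow>\<^sub>E carrier D'" by (rule PiE_I, simp, simp add: extension_def)
  show "extension \<zero>\<^bsub>D\<^esub> = \<zero>\<^bsub>D'\<^esub>" "extension \<one>\<^bsub>D\<^esub> = \<one>\<^bsub>D'\<^esub>"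
    by (simp_all add: extension_reflexive hom_zero hom_one)
next
  fix a b assume [simp]: "a \<in> carrier D" "b \<in> carrier D" and "a \<lhd>\<^bsub>D\<^esub> b"
  then obtain c where c: "c \<in> D.A" "a \<preceq>\<^bsub>D\<^esub> c" "c \<preceq>\<^bsub>D\<^esub> b" by (auto simp: D.prox_iff)
  have "h (\<ominus>\<^bsub>D\<^esub> c) \<preceq>\<^bsub>D'\<^esub> extension (\<ominus>\<^bsub>D\<^esub> a)"
    using c by (intro le_extension) (simp_all add: D.minus_le_iff)
  then have "\<ominus>\<^bsub>D'\<^esub> extension (\<ominus>\<^bsub>D\<^esub> a) \<preceq>\<^bsub>D'\<^esub> h c"
    using c D'.minus_le_iff[of "extension (\<ominus>\<^bsub>D\<^esub> a)" "\<ominus>\<^bsub>D'\<^esub> h c"] by (simp add: hom_minus)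
  moreover have "h c \<preceq>\<^bsub>D'\<^esub> extension b" using c by (intro le_extension) simp_all
  ultimately show "\<ominus>\<^bsub>D'\<^esub> extension (\<ominus>\<^bsub>D\<^esub> a) \<lhd>\<^bsub>D'\<^esub> extension b"
    using c hom_closed by (auto simp: D'.prox_iff)
next
  fix b assume b [simp]: "b \<in> carrier D"
  have S: "{extension x | x. x \<in> carrier D \<and> x \<lhd>\<^bsub>D\<^esub> b} \<subseteq> carrier D'" by auto
  have "extension b \<preceq>\<^bsub>D'\<^esub> u" if [simp]: "u \<in> carrier D'"
    and ub: "\<forall>x\<in>{extension x | x. x \<in> carrier D \<and> x \<lhd>\<^bsub>D\<^esub> b}. x \<preceq>\<^bsub>D'\<^esub> u" for u
  proof (unfold extension_le_iff[OF b that(1)], intro ballI impI)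
    fix c assume c: "c \<in> D.A" "c \<preceq>\<^bsub>D\<^esub> b"
    then have "c \<in> carrier D" "c \<lhd>\<^bsub>D\<^esub> b" by (simp_all add: D.A_prox_iff)
    then have "extension c \<preceq>\<^bsub>D'\<^esub> u" using ub by blast
    then show "h c \<preceq>\<^bsub>D'\<^esub> u" using c by (simp add: extension_reflexive)
  qed
  then show "D'.lub (extension b) {extension x | x. x \<in> carrier D \<and> x \<lhd>\<^bsub>D\<^esub> b}"
    using D.P2[of _ b] by (subst D'.lub_iff[OF S]) (auto intro!: extension_mono)
qed (auto simp: extension_add extension_wedge extension_vee extension_smult extension_mult
    extension_reflexive D.mem_A)

end

section \<open>Proximity morphisms as extensions of their reflexive parts\<close>

context proximity_morphism
begin

lemma closed [simp]: "a \<in> carrier D \<Longrightarrow> \<alpha> a \<in> carrier D'"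
  using map by auto

lemma mono:
  assumes "a \<preceq>\<^bsub>D\<^esub> b" "a \<in> carrier D" "b \<in> carrier D"
  shows "\<alpha> a \<preceq>\<^bsub>D'\<^esub> \<alpha> b"
  using PM2[of a b] D.wedge_absorb[OF assms] D'.wedge_le2[of "\<alpha> a" "\<alpha> b"] assms by simp

lemma reflexive_minus: "c \<in> D.A \<Longrightarrow> \<alpha> (\<ominus>\<^bsub>D\<^esub> c) = \<ominus>\<^bsub>D'\<^esub> \<alpha> c"
  using PM7[of "\<ominus>\<^bsub>D\<^esub> c" c] D'.minus_equality[of "\<alpha> (\<ominus>\<^bsub>D\<^esub> c)" "\<alpha> c"]
  by (simp add: D.mem_A D.l_neg PM1)

text \<open>(PM3) with a = b = c relates -\<alpha>(-c) to \<alpha>(c), and additivity on reflexive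
  elements makes the two equal.\<close>

lemma reflexive_closed: "c \<in> D.A \<Longrightarrow> \<alpha> c \<in> D'.A"
  using PM3[of c c] reflexive_minus[of c] by (simp add: D'.mem_A D.mem_A)

sublocale reflexive_hom D D' \<alpha>
  by unfold_locales (auto simp: reflexive_closed PM1 PM2 PM5 PM7 PM8 D.mem_A)

text \<open>In the supremum of (PM4) the reflexive elements are cofinal: every x in proximity to a
  lies below a reflexive c \<le> a.\<close>

lemma extension_eq: "extension = \<alpha>"
proof -
  have "extension a = \<alpha> a" if a [simp]: "a \<in> carrier D" for a
  proof (rule D'.le_antisym)
    show "extension a \<preceq>\<^bsub>D'\<^esub> \<alpha> a" by (auto simp: extension_le_iff intro: mono)
    have S: "{\<alpha> x | x. x \<in> carrier D \<and> x \<lhd>\<^bsub>D\<^esub> a} \<subseteq> carrier D'" by auto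
    have "\<alpha> x \<preceq>\<^bsub>D'\<^esub> extension a" if [simp]: "x \<in> carrier D" and "x \<lhd>\<^bsub>D\<^esub> a" for x
    proof -
      obtain c where c: "c \<in> D.A" "x \<preceq>\<^bsub>D\<^esub> c" "c \<preceq>\<^bsub>D\<^esub> a"
        using \<open>x \<lhd>\<^bsub>D\<^esub> a\<close> by (auto simp: D.prox_iff)
      then show ?thesis using D'.le_trans[OF mono[of x c] le_extension[of c a]] by simp
    qed
    then have "\<forall>y\<in>{\<alpha> x | x. x \<in> carrier D \<and> x \<lhd>\<^bsub>D\<^esub> a}. y \<preceq>\<^bsub>D'\<^esub> extension a" by blast
    moreover have "extension a \<in> carrier D'" by simp
    ultimately show "\<alpha> a \<preceq>\<^bsub>D'\<^esub> extension a" using PM4[OF a] unfolding D'.lub_iff[OF S] by blast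
  qed simp_all
  moreover have "extension \<in> extensional (carrier D)" by (simp add: extension_def)
  ultimately show ?thesis using map by (intro extensionalityI[of _ "carrier D"]) (auto simp: PiE_def)
qed

lemmas le_iff_reflexives = extension_le_iff[unfolded extension_eq]

end

lemma proximity_morphism_eqI:
  assumes "proximity_morphism D D' \<alpha>" "proximity_morphism D D' \<beta>"
    and eq: "\<And>c. c \<in> carrier (reflexives D) \<Longrightarrow> \<alpha> c = \<beta> c"
  shows "\<alpha> = \<beta>"
proof -
  interpret \<alpha>: proximity_morphism D D' \<alpha> by fact
  interpret \<beta>: proximity_morphism D D' \<beta> by fact
  have "{\<alpha> c | c. c \<in> \<alpha>.D.A \<and> c \<preceq>\<^bsub>D\<^esub> a} = {\<beta> c | c. c \<in> \<alpha>.D.A \<and> c \<preceq>\<^bsub>D\<^esub> a}" for a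
    using eq by force
  then have "\<alpha>.extension = \<beta>.extension" unfolding \<alpha>.extension_def \<beta>.extension_def by simp
  then show ?thesis by (simp add: \<alpha>.extension_eq \<beta>.extension_eq)
qed

text \<open>The identity is the extension of the inclusion of A, since every element is the supremum
  of the reflexive elements below it.\<close>

lemma (in proximity_dedekind_algebra) id_morphism: "proximity_morphism D D (\<lambda>a \<in> carrier D. a)"
proof -
  interpret reflexive_hom D D "\<lambda>a. a" by unfold_locales auto
  have "extension a = a" if "a \<in> carrier D" for a
  proof -
    have "{c |c. c \<in> A \<and> c \<preceq> a} = {c. c \<in> A \<and> c \<preceq> a}" by auto
    then show ?thesis
      using lub_reflexives_below[OF that] ord.is_lub_sup_eq[of a] that by (simp add: extension_def)
  qed
  then have "extension = (\<lambda>a \<in> carrier D. a)" by (auto simp: extension_def)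
  then show ?thesis using extension_morphism by simp
qed

section \<open>Composition of proximity morphisms and their category\<close>

locale proximity_morphism_pair =
  S: proximity_morphism D D' \<alpha> + T: proximity_morphism D' D'' \<beta>
  for D :: "('a, 'm) pda_scheme" and D' :: "('b, 'n) pda_scheme" and D'' :: "('c, 'k) pda_scheme"
    and \<alpha> \<beta>
begin

sublocale C: reflexive_hom D D'' "\<lambda>c. \<beta> (\<alpha> c)"
proof unfold_locales
  fix c d assume "c \<in> S.D.A" "\<zero>\<^bsub>D\<^esub> \<preceq>\<^bsub>D\<^esub> c" "d \<in> S.D.A"
  moreover from this have "\<zero>\<^bsub>D'\<^esub> \<preceq>\<^bsub>D'\<^esub> \<alpha> c" using S.mono[of "\<zero>\<^bsub>D\<^esub>" c] by (simp add: S.PM1)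
  ultimately show "\<beta> (\<alpha> (c \<otimes>\<^bsub>D\<^esub> d)) = \<beta> (\<alpha> c) \<otimes>\<^bsub>D''\<^esub> \<beta> (\<alpha> d)"
    by (simp add: S.hom_mult T.hom_mult S.reflexive_closed)
qed (simp_all add: S.hom_add T.hom_add S.hom_wedge T.hom_wedge S.hom_smult T.hom_smult S.PM1 T.PM1
    S.reflexive_closed T.reflexive_closed)

text \<open>Cofinality again: each x in proximity to a may be replaced by a reflexive element
  between x and a. Hence the composite is a morphism, and on reflexive elements it is the composite
  of maps.\<close>

lemma pda_comp_eq: "pda_comp D D'' \<beta> \<alpha> = C.extension"
proof -
  have "\<Squnion>\<^bsub>ord_of D''\<^esub> {\<beta> (\<alpha> x) | x. x \<in> carrier D \<and> x \<lhd>\<^bsub>D\<^esub> a} = C.extension a"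
    if a [simp]: "a \<in> carrier D" for a
  proof (rule T.D'.ord.is_lub_sup_eq)
    let ?S = "{\<beta> (\<alpha> x) | x. x \<in> carrier D \<and> x \<lhd>\<^bsub>D\<^esub> a}"
    have S: "?S \<subseteq> carrier D''" by auto
    have "\<beta> (\<alpha> x) \<preceq>\<^bsub>D''\<^esub> C.extension a" if [simp]: "x \<in> carrier D" and "x \<lhd>\<^bsub>D\<^esub> a" for x
    proof -
      obtain c where c: "c \<in> S.D.A" "x \<preceq>\<^bsub>D\<^esub> c" "c \<preceq>\<^bsub>D\<^esub> a"
        using \<open>x \<lhd>\<^bsub>D\<^esub> a\<close> by (auto simp: S.D.prox_iff)
      then show ?thesis
        using T.D'.le_trans[OF T.mono[OF S.mono[of x c]] C.le_extension[of c a]] by simp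
    qed
    moreover have "C.extension a \<preceq>\<^bsub>D''\<^esub> u"
      if [simp]: "u \<in> carrier D''" and ub: "\<forall>x\<in>?S. x \<preceq>\<^bsub>D''\<^esub> u" for u
    proof (unfold C.extension_le_iff[OF a that(1)], intro ballI impI)
      fix c assume c: "c \<in> S.D.A" "c \<preceq>\<^bsub>D\<^esub> a"
      then have "c \<in> carrier D" "c \<lhd>\<^bsub>D\<^esub> a" by (simp_all add: S.D.A_prox_iff)
      then show "\<beta> (\<alpha> c) \<preceq>\<^bsub>D''\<^esub> u" using ub by blast
    qed
    ultimately show "T.D'.lub (C.extension a) ?S" unfolding T.D'.lub_iff[OF S] by auto
  qed
  then show ?thesis by (intro extensionalityI[of _ "carrier D"]) (auto simp: pda_comp_def C.extension_def)
qed

lemma comp_morphism: "proximity_morphism D D'' (pda_comp D D'' \<beta> \<alpha>)"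
  unfolding pda_comp_eq by (rule C.extension_morphism)

lemma comp_reflexive: "c \<in> S.D.A \<Longrightarrow> pda_comp D D'' \<beta> \<alpha> c = \<beta> (\<alpha> c)"
  unfolding pda_comp_eq by (rule C.extension_reflexive)

end

text \<open>Equations between morphisms are checked on reflexive elements by
  \<open>proximity_morphism_eqI\<close>; there composition is composition of maps, so the unit and
  associative laws hold on the nose.\<close>

lemma category_PDA: "category PDA"
proof (unfold_locales, goal_cases)
  case (1 x)
  then show ?case using proximity_dedekind_algebra.id_morphism by (auto simp: PDA_def)
next
  case (2 x y z f g)
  then interpret proximity_morphism_pair x y z f g
    by (auto simp: PDA_def proximity_morphism_pair_def)
  show ?case using comp_morphism by (simp add: PDA_def)
next
  case (3 x y f)
  then interpret f: proximity_morphism x y f by (simp add: PDA_def)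
  interpret proximity_morphism_pair x x y "\<lambda>a \<in> carrier x. a" f
    using f.D.id_morphism f.proximity_morphism_axioms by (simp add: proximity_morphism_pair_def)
  have "pda_comp x y f (\<lambda>a \<in> carrier x. a) = f"
    by (rule proximity_morphism_eqI[OF comp_morphism f.proximity_morphism_axioms])
      (simp add: comp_reflexive)
  then show ?case by (simp add: PDA_def)
next
  case (4 x y f)
  then interpret f: proximity_morphism x y f by (simp add: PDA_def)
  interpret proximity_morphism_pair x y y f "\<lambda>a \<in> carrier y. a"
    using f.D'.id_morphism f.proximity_morphism_axioms by (simp add: proximity_morphism_pair_def)
  have "pda_comp x y (\<lambda>a \<in> carrier y. a) f = f"
    by (rule proximity_morphism_eqI[OF comp_morphism f.proximity_morphism_axioms])
      (simp add: comp_reflexive)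
  then show ?case by (simp add: PDA_def)
next
  case (5 w x y z f g h)
  then interpret f: proximity_morphism w x f + g: proximity_morphism x y g + h: proximity_morphism y z h
    by (simp_all add: PDA_def)
  interpret fg: proximity_morphism_pair w x y f g ..
  interpret gh: proximity_morphism_pair x y z g h ..
  interpret l: proximity_morphism_pair w y z "pda_comp w y g f" h
    using fg.comp_morphism h.proximity_morphism_axioms by (simp add: proximity_morphism_pair_def)
  interpret r: proximity_morphism_pair w x z f "pda_comp x z h g"
    using gh.comp_morphism f.proximity_morphism_axioms by (simp add: proximity_morphism_pair_def)
  have "pda_comp w z h (pda_comp w y g f) = pda_comp w z (pda_comp x z h g) f"
    by (rule proximity_morphism_eqI[OF l.comp_morphism r.comp_morphism])
      (simp add: l.comp_reflexive r.comp_reflexive fg.comp_reflexive gh.comp_reflexive f.reflexive_closed)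
  then show ?case by (simp add: PDA_def)
qed

section \<open>Restriction to idempotents\<close>

context proximity_morphism
begin

text \<open>\<alpha>(e) is the supremum of the values at reflexive c with 0 \<le> c \<le> e. For
  such c, d the element c + d - cd is reflexive and again below e, being absorbed by e and at most
  1, and \<alpha> commutes with this polynomial on A. So \<open>idempotent_lub\<close>
  applies.\<close>

lemma idempotent_image:
  assumes ee: "e \<otimes>\<^bsub>D\<^esub> e = e" and [simp]: "e \<in> carrier D"
  shows "\<alpha> e \<otimes>\<^bsub>D'\<^esub> \<alpha> e = \<alpha> e"
proof -
  define T where "T = {\<alpha> c | c. c \<in> D.A \<and> \<zero>\<^bsub>D\<^esub> \<preceq>\<^bsub>D\<^esub> c \<and> c \<preceq>\<^bsub>D\<^esub> e}"
  have T: "T \<subseteq> carrier D'" by (auto simp: T_def)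
  have e0: "\<zero>\<^bsub>D\<^esub> \<preceq>\<^bsub>D\<^esub> e" and e1: "e \<preceq>\<^bsub>D\<^esub> \<one>\<^bsub>D\<^esub>"
    using ee by (simp_all add: D.idem_nonneg D.idem_le_one)
  have lub: "D'.lub (\<alpha> e) T"
    unfolding D'.lub_iff[OF T]
  proof (intro conjI ballI impI)
    show "\<alpha> e \<in> carrier D'" by simp
    show "x \<preceq>\<^bsub>D'\<^esub> \<alpha> e" if "x \<in> T" for x using that by (auto simp: T_def intro: mono)
    fix u assume [simp]: "u \<in> carrier D'" and ub: "\<forall>x\<in>T. x \<preceq>\<^bsub>D'\<^esub> u"
    show "\<alpha> e \<preceq>\<^bsub>D'\<^esub> u"
    proof (subst le_iff_reflexives; (intro ballI impI)?)
      fix c assume c: "c \<in> D.A" "c \<preceq>\<^bsub>D\<^esub> e"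
      \<comment> \<open>Passing to the positive part keeps c reflexive and below e, so the
        restriction to nonnegative elements in \<open>T\<close> does not change the
        supremum.\<close>
      let ?c = "c \<squnion>\<^bsub>ord_of D\<^esub> \<zero>\<^bsub>D\<^esub>"
      have "?c \<in> D.A" "\<zero>\<^bsub>D\<^esub> \<preceq>\<^bsub>D\<^esub> ?c" "?c \<preceq>\<^bsub>D\<^esub> e"
        using c e0 by (auto intro: D.vee_least simp: D.vee_ge2)
      then have "\<alpha> ?c \<preceq>\<^bsub>D'\<^esub> u" using ub by (auto simp: T_def)
      moreover have "\<alpha> c \<preceq>\<^bsub>D'\<^esub> \<alpha> ?c" using c by (intro mono) (simp_all add: D.vee_ge1)
      ultimately show "\<alpha> c \<preceq>\<^bsub>D'\<^esub> u" using c D'.le_trans[of "\<alpha> c" "\<alpha> ?c" u] by simp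
    qed simp_all
  qed
  have "\<zero>\<^bsub>D'\<^esub> \<in> T" using e0 PM1(1) D.A_zero unfolding T_def by force
  then have ne: "T \<noteq> {}" by blast
  show ?thesis
  proof (rule D'.idempotent_lub(1)[OF lub T ne])
    fix x assume "x \<in> T"
    then obtain c where c: "x = \<alpha> c" "c \<in> D.A" "\<zero>\<^bsub>D\<^esub> \<preceq>\<^bsub>D\<^esub> c" "c \<preceq>\<^bsub>D\<^esub> e" by (auto simp: T_def)
    then show "\<zero>\<^bsub>D'\<^esub> \<preceq>\<^bsub>D'\<^esub> x \<and> x \<preceq>\<^bsub>D'\<^esub> \<one>\<^bsub>D'\<^esub>"
      using mono[of "\<zero>\<^bsub>D\<^esub>" c] mono[of c "\<one>\<^bsub>D\<^esub>"] D.le_trans[OF _ e1, of c] by (simp add: PM1)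
  next
    fix x y assume "x \<in> T" "y \<in> T"
    then obtain c d where x: "x = \<alpha> c" "y = \<alpha> d" and c: "c \<in> D.A" "\<zero>\<^bsub>D\<^esub> \<preceq>\<^bsub>D\<^esub> c" "c \<preceq>\<^bsub>D\<^esub> e"
      and d: "d \<in> D.A" "\<zero>\<^bsub>D\<^esub> \<preceq>\<^bsub>D\<^esub> d" "d \<preceq>\<^bsub>D\<^esub> e" by (auto simp: T_def)
    have [simp]: "c \<in> carrier D" "d \<in> carrier D" using c d by simp_all
    let ?j = "c \<oplus>\<^bsub>D\<^esub> d \<ominus>\<^bsub>D\<^esub> c \<otimes>\<^bsub>D\<^esub> d"
    have j: "?j \<in> D.A" using c d by simp
    have ce: "c \<otimes>\<^bsub>D\<^esub> e = c" "d \<otimes>\<^bsub>D\<^esub> e = d" using D.le_idem_mult[OF _ _ ee] c d by simp_all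
    have je: "?j \<otimes>\<^bsub>D\<^esub> e = ?j"
      using ce by (simp add: D.l_distr D.minus_mult_left D.m_assoc)
    have "\<zero>\<^bsub>D\<^esub> \<preceq>\<^bsub>D\<^esub> (\<one>\<^bsub>D\<^esub> \<ominus>\<^bsub>D\<^esub> c) \<otimes>\<^bsub>D\<^esub> (\<one>\<^bsub>D\<^esub> \<ominus>\<^bsub>D\<^esub> d)"
      using c d e1 D.le_trans[of _ e "\<one>\<^bsub>D\<^esub>"]
      by (intro D.mult_nonneg) (simp_all add: D.le_iff_diff[symmetric])
    moreover have "\<one>\<^bsub>D\<^esub> \<ominus>\<^bsub>D\<^esub> ?j = (\<one>\<^bsub>D\<^esub> \<ominus>\<^bsub>D\<^esub> c) \<otimes>\<^bsub>D\<^esub> (\<one>\<^bsub>D\<^esub> \<ominus>\<^bsub>D\<^esub> d)"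
      by (simp add: D.ring_simps)
    ultimately have "?j \<preceq>\<^bsub>D\<^esub> \<one>\<^bsub>D\<^esub>" by (simp add: D.le_iff_diff[of _ "\<one>\<^bsub>D\<^esub>"])
    then have "?j \<preceq>\<^bsub>D\<^esub> e" using ee je by - (rule D.mult_idem_le, simp_all)
    then have "\<alpha> ?j \<preceq>\<^bsub>D'\<^esub> \<alpha> e" by (intro mono) simp_all
    moreover have "\<alpha> ?j = x \<oplus>\<^bsub>D'\<^esub> y \<ominus>\<^bsub>D'\<^esub> x \<otimes>\<^bsub>D'\<^esub> y"
      using c d hom_add[of "c \<oplus>\<^bsub>D\<^esub> d" "\<ominus>\<^bsub>D\<^esub> (c \<otimes>\<^bsub>D\<^esub> d)"]
      by (simp add: D.minus_eq D'.minus_eq hom_add hom_minus hom_mult x)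
    ultimately show "x \<oplus>\<^bsub>D'\<^esub> y \<ominus>\<^bsub>D'\<^esub> x \<otimes>\<^bsub>D'\<^esub> y \<preceq>\<^bsub>D'\<^esub> \<alpha> e" by simp
  qed
qed

text \<open>Idempotents in proximity to e are enough to bound the image of e. For reflexive c with 0
  \<le> c \<le> e, \<open>idempotent_between\<close> gives g with c - \<epsilon> \<le> (c -
  \<epsilon>)^+ \<le> g, hence \<alpha>(c) - \<epsilon> \<le> \<alpha>(g) \<le> u for every
  \<epsilon> > 0.\<close>

lemma le_idempotent_if:
  assumes ee: "e \<otimes>\<^bsub>D\<^esub> e = e" and [simp]: "e \<in> carrier D" and uu: "u \<otimes>\<^bsub>D'\<^esub> u = u" and [simp]: "u \<in> carrier D'"
    and ub: "\<And>g. \<lbrakk>g \<in> carrier D; g \<otimes>\<^bsub>D\<^esub> g = g; g \<lhd>\<^bsub>D\<^esub> e\<rbrakk> \<Longrightarrow> \<alpha> g \<preceq>\<^bsub>D'\<^esub> u"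
  shows "\<alpha> e \<preceq>\<^bsub>D'\<^esub> u"
proof (subst le_iff_reflexives; (intro ballI impI)?)
  fix c0 assume c0: "c0 \<in> D.A" "c0 \<preceq>\<^bsub>D\<^esub> e"
  define c where "c = c0 \<squnion>\<^bsub>ord_of D\<^esub> \<zero>\<^bsub>D\<^esub>"
  have c: "c \<in> D.A" "\<zero>\<^bsub>D\<^esub> \<preceq>\<^bsub>D\<^esub> c" "c \<preceq>\<^bsub>D\<^esub> e"
    using c0 ee unfolding c_def by (auto intro!: D.vee_least simp: D.vee_ge2 D.idem_nonneg)
  have [simp]: "c \<in> carrier D" using c by simp
  have "\<alpha> c \<preceq>\<^bsub>D'\<^esub> u"
  proof (rule D'.archimedean_eps[where b = "\<one>\<^bsub>D'\<^esub>"])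
    fix \<epsilon> :: real assume \<epsilon>: "0 < \<epsilon>"
    let ?r = "c \<ominus>\<^bsub>D\<^esub> \<epsilon> \<odot>\<^bsub>D\<^esub> \<one>\<^bsub>D\<^esub>"
    define p where "p = ?r \<squnion>\<^bsub>ord_of D\<^esub> \<zero>\<^bsub>D\<^esub>"
    obtain g where g: "g \<in> carrier D" "g \<otimes>\<^bsub>D\<^esub> g = g" "g \<lhd>\<^bsub>D\<^esub> e" "p \<otimes>\<^bsub>D\<^esub> g = p"
      unfolding p_def by (rule D.idempotent_between[OF c ee _ \<epsilon>]) auto
    have [simp]: "p \<in> carrier D" by (simp add: p_def)
    have "?r \<preceq>\<^bsub>D\<^esub> c"
    proof -
      have "\<zero>\<^bsub>D\<^esub> \<preceq>\<^bsub>D\<^esub> \<epsilon> \<odot>\<^bsub>D\<^esub> \<one>\<^bsub>D\<^esub>" using \<epsilon> by (simp add: D.smult_nonneg)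
      then show ?thesis
        using D.add_le_mono[of "\<zero>\<^bsub>D\<^esub>" "\<epsilon> \<odot>\<^bsub>D\<^esub> \<one>\<^bsub>D\<^esub>" c c] by (simp add: D.diff_le_iff)
    qed
    then have "p \<preceq>\<^bsub>D\<^esub> c" unfolding p_def using c by (intro D.vee_least) simp_all
    then have "p \<preceq>\<^bsub>D\<^esub> \<one>\<^bsub>D\<^esub>"
      using D.le_trans[OF _ D.le_trans[OF c(3) D.idem_le_one[OF ee]]] by simp
    then have "p \<preceq>\<^bsub>D\<^esub> g" using g by - (rule D.mult_idem_le, simp_all)
    then have "?r \<preceq>\<^bsub>D\<^esub> g" using D.le_trans[OF D.vee_ge1[of ?r "\<zero>\<^bsub>D\<^esub>"]] g by (simp add: p_def)
    then have "\<alpha> ?r \<preceq>\<^bsub>D'\<^esub> \<alpha> g" using g by (intro mono) simp_all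
    then have "\<alpha> ?r \<preceq>\<^bsub>D'\<^esub> u" using D'.le_trans[OF _ ub[OF g(1-3)]] g by simp
    moreover have "\<alpha> ?r = \<alpha> c \<ominus>\<^bsub>D'\<^esub> \<epsilon> \<odot>\<^bsub>D'\<^esub> \<one>\<^bsub>D'\<^esub>"
      using c \<epsilon> hom_add[of c "\<ominus>\<^bsub>D\<^esub> (\<epsilon> \<odot>\<^bsub>D\<^esub> \<one>\<^bsub>D\<^esub>)"]
      by (simp add: D.minus_eq D'.minus_eq hom_minus hom_smult PM1)
    ultimately show "\<alpha> c \<preceq>\<^bsub>D'\<^esub> u \<oplus>\<^bsub>D'\<^esub> \<epsilon> \<odot>\<^bsub>D'\<^esub> \<one>\<^bsub>D'\<^esub>" by (simp add: D'.diff_le_iff D'.a_comm)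
  qed simp_all
  moreover have "\<alpha> c0 \<preceq>\<^bsub>D'\<^esub> \<alpha> c" unfolding c_def using c0 by (intro mono) (simp_all add: D.vee_ge1)
  ultimately show "\<alpha> c0 \<preceq>\<^bsub>D'\<^esub> u" using c0 D'.le_trans[of "\<alpha> c0" "\<alpha> c" u] by simp
qed simp_all

text \<open>The general set \<open>S\<close> serves two purposes: images of idempotents give (M4),
  and iterated images identify a restricted composite with a composite of restrictions.\<close>

lemma restriction_lub:
  assumes e: "e \<in> carrier (Id_DeV D)" and S: "S \<subseteq> carrier (Id_DeV D')"
    and le: "\<And>x. x \<in> S \<Longrightarrow> x \<preceq>\<^bsub>D'\<^esub> \<alpha> e"
    and ge: "\<And>g. \<lbrakk>g \<in> carrier (Id_DeV D); g \<lhd>\<^bsub>D\<^esub> e\<rbrakk> \<Longrightarrow> \<exists>x\<in>S. \<alpha> g \<preceq>\<^bsub>D'\<^esub> x"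
  shows "is_lub (Id_DeV D') (\<alpha> e) S"
proof -
  have [simp]: "e \<in> carrier D" and ee: "e \<otimes>\<^bsub>D\<^esub> e = e" using e by simp_all
  have ae: "\<alpha> e \<in> carrier (Id_DeV D')" using idempotent_image[OF ee] by simp
  have "\<alpha> e \<preceq>\<^bsub>D'\<^esub> u" if u: "u \<in> carrier (Id_DeV D')" and ub: "\<And>x. x \<in> S \<Longrightarrow> x \<preceq>\<^bsub>D'\<^esub> u" for u
  proof (rule le_idempotent_if[OF ee])
    fix g assume g: "g \<in> carrier D" "g \<otimes>\<^bsub>D\<^esub> g = g" "g \<lhd>\<^bsub>D\<^esub> e"
    then obtain x where "x \<in> S" "\<alpha> g \<preceq>\<^bsub>D'\<^esub> x" using ge[of g] by auto
    then show "\<alpha> g \<preceq>\<^bsub>D'\<^esub> u" using D'.le_trans[of "\<alpha> g" x u] ub[of x] S u g by auto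
  qed (use u in simp_all)
  moreover have order: "x \<sqsubseteq>\<^bsub>Id_DeV D'\<^esub> y \<longleftrightarrow> x \<preceq>\<^bsub>D'\<^esub> y"
    if "x \<in> carrier (Id_DeV D')" "y \<in> carrier (Id_DeV D')" for x y
    using that D'.idem_le_iff[of x y] by simp
  ultimately show ?thesis
    using ae S le unfolding is_lub_iff[OF S] by (metis (no_types, lifting) subsetD)
qed

lemma restriction_de_vries_morphism:
  "de_vries_morphism (Id_DeV D) (Id_DeV D') (restrict \<alpha> (carrier (Id_DeV D)))"
proof -
  interpret B: de_vries_algebra "Id_DeV D" by (rule D.de_vries_algebra_Id)
  interpret B': de_vries_algebra "Id_DeV D'" by (rule D'.de_vries_algebra_Id)
  have closed: "\<alpha> e \<in> carrier (Id_DeV D')" if "e \<in> carrier (Id_DeV D)" for e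
    using that idempotent_image[of e] by simp
  show ?thesis
  proof unfold_locales
    show "restrict \<alpha> (carrier (Id_DeV D)) \<in> carrier (Id_DeV D) \<rightarrow>\<^sub>E carrier (Id_DeV D')"
      using closed by (simp del: D.Id_simps D'.Id_simps)
    show "restrict \<alpha> (carrier (Id_DeV D)) \<bottom>\<^bsub>Id_DeV D\<^esub> = \<bottom>\<^bsub>Id_DeV D'\<^esub>"
      by (simp add: D.Id_bottom D'.Id_bottom PM1)
  next
    fix a b assume a: "a \<in> carrier (Id_DeV D)" "b \<in> carrier (Id_DeV D)"
    have ab: "a \<otimes>\<^bsub>D\<^esub> b \<in> carrier (Id_DeV D)" using a D.idem_mult[of a b] by simp
    have "\<alpha> (a \<otimes>\<^bsub>D\<^esub> b) = \<alpha> a \<otimes>\<^bsub>D'\<^esub> \<alpha> b"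
      using a PM2[of a b] closed[OF a(1)] closed[OF a(2)] by (simp add: D.idem_wedge D'.idem_wedge)
    then show "restrict \<alpha> (carrier (Id_DeV D)) (a \<sqinter>\<^bsub>Id_DeV D\<^esub> b) =
        restrict \<alpha> (carrier (Id_DeV D)) a \<sqinter>\<^bsub>Id_DeV D'\<^esub> restrict \<alpha> (carrier (Id_DeV D)) b"
      using a ab closed[OF a(1)] closed[OF a(2)]
      by (simp add: D.Id_meet D'.Id_meet del: D.Id_simps(1) D'.Id_simps(1))
    assume prec: "a \<prec>\<^bsub>Id_DeV D\<^esub> b"
    have ca: "\<one>\<^bsub>D\<^esub> \<ominus>\<^bsub>D\<^esub> a \<in> carrier (Id_DeV D)" using a by (simp add: D.idem_compl)
    \<comment> \<open>Adding the reflexive unit commutes with \<alpha> by (PM7). Thus 1 - \<alpha>(1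
      - a) = -\<alpha>(-a), and (M3) turns into (PM3).\<close>
    have "\<alpha> (\<one>\<^bsub>D\<^esub> \<ominus>\<^bsub>D\<^esub> a) = \<one>\<^bsub>D'\<^esub> \<oplus>\<^bsub>D'\<^esub> \<alpha> (\<ominus>\<^bsub>D\<^esub> a)"
      using PM7[of "\<ominus>\<^bsub>D\<^esub> a" "\<one>\<^bsub>D\<^esub>"] a D.P1 by (simp add: D.minus_eq D.a_comm PM1 D'.a_comm)
    moreover have "\<one>\<^bsub>D'\<^esub> \<ominus>\<^bsub>D'\<^esub> (\<one>\<^bsub>D'\<^esub> \<oplus>\<^bsub>D'\<^esub> x) = \<ominus>\<^bsub>D'\<^esub> x" if "x \<in> carrier D'" for x
      by (simp add: D'.ring_simps that)
    ultimately have "\<one>\<^bsub>D'\<^esub> \<ominus>\<^bsub>D'\<^esub> \<alpha> (\<one>\<^bsub>D\<^esub> \<ominus>\<^bsub>D\<^esub> a) = \<ominus>\<^bsub>D'\<^esub> \<alpha> (\<ominus>\<^bsub>D\<^esub> a)" using a by simp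
    then show "cmpl (Id_DeV D') (restrict \<alpha> (carrier (Id_DeV D)) (cmpl (Id_DeV D) a)) \<prec>\<^bsub>Id_DeV D'\<^esub>
        restrict \<alpha> (carrier (Id_DeV D)) b"
      using PM3[of a b] a prec ca closed[OF ca] by (simp add: D.Id_cmpl D'.Id_cmpl)
  next
    fix a assume a: "a \<in> carrier (Id_DeV D)"
    have eq: "{restrict \<alpha> (carrier (Id_DeV D)) b |b. b \<in> carrier (Id_DeV D) \<and> b \<prec>\<^bsub>Id_DeV D\<^esub> a} =
        \<alpha> ` {b. b \<in> carrier (Id_DeV D) \<and> b \<lhd>\<^bsub>D\<^esub> a}" by force
    have "is_lub (Id_DeV D') (\<alpha> a) (\<alpha> ` {b. b \<in> carrier (Id_DeV D) \<and> b \<lhd>\<^bsub>D\<^esub> a})"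
      using a idempotent_image by (intro restriction_lub) (auto intro: mono D.P2)
    then show "is_lub (Id_DeV D') (restrict \<alpha> (carrier (Id_DeV D)) a)
        {restrict \<alpha> (carrier (Id_DeV D)) b |b. b \<in> carrier (Id_DeV D) \<and> b \<prec>\<^bsub>Id_DeV D\<^esub> a}"
      unfolding eq using a by simp
  qed
qed

end

context proximity_morphism_pair
begin

text \<open>The two composites are suprema in different lattices, one in the algebra and one among
  its idempotents. With \<gamma> the composite proximity morphism, \<gamma>(g) \<le>
  \<beta>(\<alpha>(g)) \<le> \<gamma>(e) for idempotents g in proximity to e, so
  \<open>restriction_lub\<close> identifies \<gamma>(e) with the supremum among idempotents.\<close>

lemma restriction_comp:
  "restrict (pda_comp D D'' \<beta> \<alpha>) (carrier (Id_DeV D)) =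
    dev_comp (Id_DeV D) (Id_DeV D'') (restrict \<beta> (carrier (Id_DeV D'))) (restrict \<alpha> (carrier (Id_DeV D)))"
proof -
  let ?\<gamma> = "pda_comp D D'' \<beta> \<alpha>" and ?I = "carrier (Id_DeV D)" and ?I' = "carrier (Id_DeV D')"
  interpret \<gamma>: proximity_morphism D D'' ?\<gamma> by (rule comp_morphism)
  have closed: "\<alpha> e \<in> ?I'" if "e \<in> ?I" for e
    using that S.idempotent_image[of e] by simp
  have closed': "\<beta> e \<in> carrier (Id_DeV D'')" if "e \<in> ?I'" for e
    using that T.idempotent_image[of e] by simp
  have upper: "\<beta> (\<alpha> g) \<preceq>\<^bsub>D''\<^esub> ?\<gamma> e" if g: "g \<in> carrier D" "e \<in> carrier D" "g \<lhd>\<^bsub>D\<^esub> e" for g e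
  proof -
    obtain c where c: "c \<in> S.D.A" "g \<preceq>\<^bsub>D\<^esub> c" "c \<preceq>\<^bsub>D\<^esub> e" using g by (auto simp: S.D.prox_iff)
    then show ?thesis
      using T.D'.le_trans[OF T.mono[OF S.mono[of g c]] \<gamma>.mono[of c e, unfolded comp_reflexive[OF c(1)]]] g
      by simp
  qed
  have lower: "?\<gamma> g \<preceq>\<^bsub>D''\<^esub> \<beta> (\<alpha> g)" if "g \<in> carrier D" for g
    using that by (auto simp: \<gamma>.le_iff_reflexives comp_reflexive intro!: T.mono S.mono)
  have "dev_comp (Id_DeV D) (Id_DeV D'') (restrict \<beta> ?I') (restrict \<alpha> ?I) = restrict ?\<gamma> ?I"
  proof (rule dev_comp_eqI[where X = "carrier (Id_DeV D'')"])
    show "de_vries_algebra (Id_DeV D'')" by (rule T.D'.de_vries_algebra_Id)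
    show "restrict ?\<gamma> ?I \<in> ?I \<rightarrow>\<^sub>E carrier (Id_DeV D'')"
      using \<gamma>.idempotent_image by auto
    fix e assume e: "e \<in> ?I"
    have eq: "{restrict \<beta> ?I' (restrict \<alpha> ?I g) |g. g \<in> ?I \<and> g \<prec>\<^bsub>Id_DeV D\<^esub> e} =
        (\<lambda>g. \<beta> (\<alpha> g)) ` {g. g \<in> ?I \<and> g \<lhd>\<^bsub>D\<^esub> e}"
    proof -
      have "restrict \<beta> ?I' (restrict \<alpha> ?I g) = \<beta> (\<alpha> g)" if "g \<in> ?I" for g
        using that closed[OF that] by (simp del: S.D.Id_simps(1) S.D'.Id_simps(1))
      then show ?thesis
        unfolding setcompr_eq_image by (intro image_cong) (simp_all del: S.D.Id_simps(1) restrict_apply)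
    qed
    have "is_lub (Id_DeV D'') (?\<gamma> e) ((\<lambda>g. \<beta> (\<alpha> g)) ` {g. g \<in> ?I \<and> g \<lhd>\<^bsub>D\<^esub> e})"
    proof (rule \<gamma>.restriction_lub[OF e])
      show "(\<lambda>g. \<beta> (\<alpha> g)) ` {g. g \<in> ?I \<and> g \<lhd>\<^bsub>D\<^esub> e} \<subseteq> carrier (Id_DeV D'')"
        using closed closed' by blast
    qed (use e upper lower in auto)
    then show "is_lub (Id_DeV D'') (restrict ?\<gamma> ?I e)
        {restrict \<beta> ?I' (restrict \<alpha> ?I g) |g. g \<in> ?I \<and> g \<prec>\<^bsub>Id_DeV D\<^esub> e}"
      unfolding eq using e by simp
  qed
  then show ?thesis ..
qed

end

theorem theorem5p6:
  shows "(\<forall>D :: 'a pda. proximity_dedekind_algebra D \<longrightarrow>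
            de_vries_algebra (Id_DeV D) \<and>
            de_vries_isomorphism (Id_DeV D) (Ann_DeV (reflexives D)) (sigma D))
       \<and> covariant_functor (PDA :: ('b pda, 'b \<Rightarrow> 'b) cat) DeV
            Id_DeV (\<lambda>D D' \<alpha>. restrict \<alpha> (carrier (Id_DeV D)))"
proof (intro conjI allI impI)
  fix D :: "'a pda" assume "proximity_dedekind_algebra D"
  then interpret proximity_dedekind_algebra D .
  show "de_vries_algebra (Id_DeV D)" by (rule de_vries_algebra_Id)
  show "de_vries_isomorphism (Id_DeV D) (Ann_DeV (reflexives D)) (sigma D)" by (rule sigma_isomorphism)
next
  show "covariant_functor (PDA :: ('b pda, 'b \<Rightarrow> 'b) cat) DeV
      Id_DeV (\<lambda>D D' \<alpha>. restrict \<alpha> (carrier (Id_DeV D)))"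
  proof (intro covariant_functor.intro category_PDA category_DeV covariant_functor_axioms.intro)
    fix x :: "'b pda" assume "x \<in> Obj PDA"
    then interpret proximity_dedekind_algebra x by (simp add: PDA_def)
    show "Id_DeV x \<in> Obj DeV" using de_vries_algebra_Id by (simp add: DeV_def)
    show "restrict (Idt PDA x) (carrier (Id_DeV x)) = Idt DeV (Id_DeV x)"
      by (auto simp: PDA_def DeV_def fun_eq_iff)
  next
    fix x y :: "'b pda" and f assume "f \<in> Hom PDA x y"
    then interpret proximity_morphism x y f by (simp add: PDA_def)
    show "restrict f (carrier (Id_DeV x)) \<in> Hom DeV (Id_DeV x) (Id_DeV y)"
      using restriction_de_vries_morphism by (simp add: DeV_def)
  next
    fix x y z :: "'b pda" and f g assume "f \<in> Hom PDA x y" "g \<in> Hom PDA y z"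
    then interpret proximity_morphism_pair x y z f g
      by (simp add: PDA_def proximity_morphism_pair_def)
    show "restrict (Comp PDA x y z g f) (carrier (Id_DeV x)) =
        Comp DeV (Id_DeV x) (Id_DeV y) (Id_DeV z) (restrict g (carrier (Id_DeV y)))
          (restrict f (carrier (Id_DeV x)))"
      using restriction_comp by (simp add: PDA_def DeV_def)
  qed
qed

end
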